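(* Let $E$ be a row-finite graph (possibly with sinks) and let $F$ be a graph which is primitively equivalent to $E$. Then the graph $C^*$-algebras are isomorphic: $C^*(E)\cong C^*(F)$.
   Context: Graphs. A directed graph $E$ consists of a vertex set $E^0$, an edge set $E^1$ and source and range maps $s,r:E^1\to E^0$. Throughout, "graph" means a countable directed graph without multiple edges (at most one edge from $v$ to $w$ for each ordered pair $(v,w)$; loops allowed) which is connected (any two vertices are joined by an undirected path). $E$ is row-finite if every vertex is the source of only finitely many edges; a sink is a vertex which is the source of no edge. The vertex matrix $B_E$ is the $E^0\times E^0$ matrix with $B_E(v,w)=\#\{e\in E^1: s(e)=v,\ r(e)=w\}$ (a 0-1 matrix here). Primitive transfer. Let $B$ be a (possibly infinite) square 0-1 matrix; write $B_p$ for its $p$-th row and $E_i$ for the row with a $1$ in position $i$ and $0$ elsewhere. Suppose $B_p$ is a nonzero row and $B_p=E_{k_1}+\cdots+E_{k_r}+B_{m_1}+\cdots+B_{m_s}$ for some distinct indices $k_1,\dots,k_r,m_1,\dots,m_s$ (all $r+s$ of them pairwise distinct) with $p\notin\{m_1,\dots,m_s\}$ and no $B_{m_i}$ a zero row. Let $C$ be the matrix which agrees with $B$ outside row $p$, and with $C_{pj}=1$ if $j\in\{k_1,\dots,k_r,m_1,\dots,m_s\}$ and $C_{pj}=0$ otherwise. Then $C$ is called a primitive transfer of $B$ (at $p$). Primitive equivalence. Two square 0-1 matrices $B,C$ of the same (possibly infinite) size are primitively equivalent if there are matrices $D_1=B,D_2,\dots,D_q=C$ such that for each $1\le i\le q-1$: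 $D_i$ is a primitive transfer of $D_{i+1}$, or $D_{i+1}$ is a primitive transfer of $D_i$, or $D_i=PD_{i+1}P^{-1}$ for a permutation matrix $P$. Two graphs are primitively equivalent if their vertex matrices are. Graph algebra. For a row-finite graph $E$, a Cuntz-Krieger $E$-family consists of mutually orthogonal projections $\{P_v: v\in E^0\}$ and partial isometries $\{S_e:e\in E^1\}$ with $S_e^*S_e=P_{r(e)}$ for all $e$, and $P_v=\sum_{s(e)=v}S_eS_e^*$ for every $v\in s(E^1)$. $C^*(E)$ is the universal $C^*$-algebra generated by a Cuntz-Krieger $E$-family. *)

theory Defs
  imports
    "HOL-Analysis.Abstract_Metric_Spaces"
    "HOL-Analysis.Abstract_Topology_2"
    "HOL-Library.Countable_Set"
    "HOL-Algebra.Module"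
    "Graph_Theory.Digraph_Component"
begin

section \<open>Graphs\<close>

text \<open>
  Following the convention that connected graphs have a vertex, \<open>Digraph_Component.connected\<close>
  includes \<open>verts E \<noteq> {}\<close>. Loops are allowed.
\<close>

definition countable_connected_digraph :: "('v, 'e) pre_digraph \<Rightarrow> bool" where
  "countable_connected_digraph E \<longleftrightarrow>
     nomulti_digraph E \<and> countable (verts E) \<and> countable (arcs E) \<and>
     Digraph_Component.connected E"

definition row_finite :: "('v, 'e) pre_digraph \<Rightarrow> bool" where
  "row_finite E \<longleftrightarrow> (\<forall>v\<in>verts E. finite (out_arcs E v))"

definition vertex_matrix :: "('v, 'e) pre_digraph \<Rightarrow> 'v \<Rightarrow> 'v \<Rightarrow> nat" where
  "vertex_matrix E v w = card {e \<in> arcs E. tail E e = v \<and> head E e = w}"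


section \<open>Primitive equivalence of square matrices\<close>

text \<open>
  A square matrix with index set \<open>I\<close> is a function \<open>'i \<Rightarrow> 'i \<Rightarrow> nat\<close> of which only the values
  on \<open>I \<times> I\<close> matter.
\<close>

definition zero_one_matrix :: "'i set \<Rightarrow> ('i \<Rightarrow> 'i \<Rightarrow> nat) \<Rightarrow> bool" where
  "zero_one_matrix I B \<longleftrightarrow> (\<forall>i\<in>I. \<forall>j\<in>I. B i j \<in> {0, 1})"

definition zero_row :: "'i set \<Rightarrow> ('i \<Rightarrow> 'i \<Rightarrow> nat) \<Rightarrow> 'i \<Rightarrow> bool" where
  "zero_row I B i \<longleftrightarrow> (\<forall>j\<in>I. B i j = 0)"

text \<open>
  \<open>K\<close> and \<open>M\<close> are the sets of the indices \<open>k\<^sub>1, \<dots>, k\<^sub>r\<close> and \<open>m\<^sub>1, \<dots>, m\<^sub>s\<close>; either may be empty.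
\<close>

definition primitive_transfer_at ::
    "'i set \<Rightarrow> 'i \<Rightarrow> ('i \<Rightarrow> 'i \<Rightarrow> nat) \<Rightarrow> ('i \<Rightarrow> 'i \<Rightarrow> nat) \<Rightarrow> bool" where
  "primitive_transfer_at I p B C \<longleftrightarrow>
     zero_one_matrix I B \<and> p \<in> I \<and> \<not> zero_row I B p \<and>
     (\<exists>K M. finite K \<and> finite M \<and> K \<subseteq> I \<and> M \<subseteq> I \<and> K \<inter> M = {} \<and> p \<notin> M \<and>
        (\<forall>m\<in>M. \<not> zero_row I B m) \<and>
        (\<forall>j\<in>I. B p j = (\<Sum>k\<in>K. if j = k then 1 else 0) + (\<Sum>m\<in>M. B m j)) \<and>
        (\<forall>i\<in>I - {p}. \<forall>j\<in>I. C i j = B i j) \<and>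
        (\<forall>j\<in>I. C p j = (if j \<in> K \<union> M then 1 else 0)))"

definition primitive_transfer ::
    "'i set \<Rightarrow> ('i \<Rightarrow> 'i \<Rightarrow> nat) \<Rightarrow> ('i \<Rightarrow> 'i \<Rightarrow> nat) \<Rightarrow> bool" where
  \<comment> \<open>the second matrix is a primitive transfer of the first\<close>
  "primitive_transfer I B C \<longleftrightarrow> (\<exists>p. primitive_transfer_at I p B C)"

text \<open>
  If \<open>P\<close> is the permutation matrix with entry \<open>1\<close> exactly at the positions \<open>(i, \<pi> i)\<close>, then the
  \<open>(i, j)\<close> entry of \<open>P D P\<^sup>-\<^sup>1\<close> is \<open>D (\<pi> i) (\<pi> j)\<close>.
\<close>

definition permutation_conjugate ::
    "'i set \<Rightarrow> ('i \<Rightarrow> 'i \<Rightarrow> nat) \<Rightarrow> ('i \<Rightarrow> 'i \<Rightarrow> nat) \<Rightarrow> bool" where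
  "permutation_conjugate I C D \<longleftrightarrow>
     (\<exists>\<pi>. bij_betw \<pi> I I \<and> (\<forall>i\<in>I. \<forall>j\<in>I. C i j = D (\<pi> i) (\<pi> j)))"

definition primitively_equivalent ::
    "'i set \<Rightarrow> ('i \<Rightarrow> 'i \<Rightarrow> nat) \<Rightarrow> ('i \<Rightarrow> 'i \<Rightarrow> nat) \<Rightarrow> bool" where
  "primitively_equivalent I B C \<longleftrightarrow>
     zero_one_matrix I B \<and> zero_one_matrix I C \<and>
     (\<exists>(D :: nat \<Rightarrow> 'i \<Rightarrow> 'i \<Rightarrow> nat) q. 1 \<le> q \<and> D 1 = B \<and> D q = C \<and>
        (\<forall>i. 1 \<le> i \<and> i \<le> q - 1 \<longrightarrow>
           primitive_transfer I (D (i + 1)) (D i) \<or>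
           primitive_transfer I (D i) (D (i + 1)) \<or>
           permutation_conjugate I (D i) (D (i + 1))))"

text \<open>
  The two vertex matrices have different index sets; they are compared by means of an
  identification \<open>\<phi>\<close> of the vertex sets. The choice of \<open>\<phi>\<close> is immaterial since two choices
  differ by a permutation.
\<close>

definition graphs_primitively_equivalent ::
    "('v, 'e) pre_digraph \<Rightarrow> ('w, 'f) pre_digraph \<Rightarrow> bool" where
  "graphs_primitively_equivalent E F \<longleftrightarrow>
     (\<exists>\<phi>. bij_betw \<phi> (verts E) (verts F) \<and>
        primitively_equivalent (verts E) (vertex_matrix E)
          (\<lambda>v w. vertex_matrix F (\<phi> v) (\<phi> w)))"


section \<open>C*-algebras\<close>

text \<open>
  C*-algebras need not be unital: the field \<open>one\<close> inherited from the ring record is not used.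
\<close>

record 'a cstar = "(complex, 'a) module" +
  star :: "'a \<Rightarrow> 'a"
  cnorm :: "'a \<Rightarrow> real"

text \<open>
  \<open>Metric_space\<close> wants a function that is nonnegative and symmetric also outside the carrier.
\<close>

definition cdist :: "'a cstar \<Rightarrow> 'a \<Rightarrow> 'a \<Rightarrow> real" where
  "cdist A x y = (if x \<in> carrier A \<and> y \<in> carrier A then cnorm A (x \<ominus>\<^bsub>A\<^esub> y) else 0)"

locale pre_cstar_algebra = abelian_group A for A :: "'a cstar" (structure) +
  assumes smult_closed [simp, intro]: "x \<in> carrier A \<Longrightarrow> a \<odot> x \<in> carrier A"
    and smult_add_left: "x \<in> carrier A \<Longrightarrow> (a + b) \<odot> x = a \<odot> x \<oplus> b \<odot> x"
    and smult_add_right: "\<lbrakk>x \<in> carrier A; y \<in> carrier A\<rbrakk> \<Longrightarrow> a \<odot> (x \<oplus> y) = a \<odot> x \<oplus> a \<odot> y"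
    and smult_smult: "x \<in> carrier A \<Longrightarrow> a \<odot> (b \<odot> x) = (a * b) \<odot> x"
    and smult_one: "x \<in> carrier A \<Longrightarrow> 1 \<odot> x = x"
    and mult_closed [simp, intro]: "\<lbrakk>x \<in> carrier A; y \<in> carrier A\<rbrakk> \<Longrightarrow> x \<otimes> y \<in> carrier A"
    and mult_assoc: "\<lbrakk>x \<in> carrier A; y \<in> carrier A; z \<in> carrier A\<rbrakk>
          \<Longrightarrow> (x \<otimes> y) \<otimes> z = x \<otimes> (y \<otimes> z)"
    and mult_add_left: "\<lbrakk>x \<in> carrier A; y \<in> carrier A; z \<in> carrier A\<rbrakk>
          \<Longrightarrow> (x \<oplus> y) \<otimes> z = x \<otimes> z \<oplus> y \<otimes> z"
    and mult_add_right: "\<lbrakk>x \<in> carrier A; y \<in> carrier A; z \<in> carrier A\<rbrakk>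
          \<Longrightarrow> z \<otimes> (x \<oplus> y) = z \<otimes> x \<oplus> z \<otimes> y"
    and smult_mult_left: "\<lbrakk>x \<in> carrier A; y \<in> carrier A\<rbrakk> \<Longrightarrow> (a \<odot> x) \<otimes> y = a \<odot> (x \<otimes> y)"
    and smult_mult_right: "\<lbrakk>x \<in> carrier A; y \<in> carrier A\<rbrakk> \<Longrightarrow> x \<otimes> (a \<odot> y) = a \<odot> (x \<otimes> y)"
    and star_closed [simp, intro]: "x \<in> carrier A \<Longrightarrow> star A x \<in> carrier A"
    and star_star: "x \<in> carrier A \<Longrightarrow> star A (star A x) = x"
    and star_add: "\<lbrakk>x \<in> carrier A; y \<in> carrier A\<rbrakk> \<Longrightarrow> star A (x \<oplus> y) = star A x \<oplus> star A y"
    and star_smult: "x \<in> carrier A \<Longrightarrow> star A (a \<odot> x) = cnj a \<odot> star A x"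
    and star_mult: "\<lbrakk>x \<in> carrier A; y \<in> carrier A\<rbrakk> \<Longrightarrow> star A (x \<otimes> y) = star A y \<otimes> star A x"
    and cnorm_nonneg: "x \<in> carrier A \<Longrightarrow> 0 \<le> cnorm A x"
    and cnorm_eq_zero_iff: "x \<in> carrier A \<Longrightarrow> cnorm A x = 0 \<longleftrightarrow> x = \<zero>"
    and cnorm_add: "\<lbrakk>x \<in> carrier A; y \<in> carrier A\<rbrakk> \<Longrightarrow> cnorm A (x \<oplus> y) \<le> cnorm A x + cnorm A y"
    and cnorm_smult: "x \<in> carrier A \<Longrightarrow> cnorm A (a \<odot> x) = cmod a * cnorm A x"
    and cnorm_mult: "\<lbrakk>x \<in> carrier A; y \<in> carrier A\<rbrakk> \<Longrightarrow> cnorm A (x \<otimes> y) \<le> cnorm A x * cnorm A y"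
    and cstar_identity: "x \<in> carrier A \<Longrightarrow> cnorm A (star A x \<otimes> x) = (cnorm A x)\<^sup>2"
locale cstar_algebra = pre_cstar_algebra +
  assumes complete: "Metric_space.mcomplete (carrier A) (cdist A)"

definition star_hom :: "'a cstar \<Rightarrow> 'b cstar \<Rightarrow> ('a \<Rightarrow> 'b) \<Rightarrow> bool" where
  "star_hom A B f \<longleftrightarrow>
     (\<forall>x\<in>carrier A. f x \<in> carrier B) \<and>
     (\<forall>x\<in>carrier A. \<forall>y\<in>carrier A. f (x \<oplus>\<^bsub>A\<^esub> y) = f x \<oplus>\<^bsub>B\<^esub> f y) \<and>
     (\<forall>a. \<forall>x\<in>carrier A. f (a \<odot>\<^bsub>A\<^esub> x) = a \<odot>\<^bsub>B\<^esub> f x) \<and>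
     (\<forall>x\<in>carrier A. \<forall>y\<in>carrier A. f (x \<otimes>\<^bsub>A\<^esub> y) = f x \<otimes>\<^bsub>B\<^esub> f y) \<and>
     (\<forall>x\<in>carrier A. f (star A x) = star B (f x))"

definition cstar_isomorphic :: "'a cstar \<Rightarrow> 'b cstar \<Rightarrow> bool" where
  "cstar_isomorphic A B \<longleftrightarrow> (\<exists>f. star_hom A B f \<and> bij_betw f (carrier A) (carrier B))"

definition closed_star_subalgebra :: "'a cstar \<Rightarrow> 'a set \<Rightarrow> bool" where
  "closed_star_subalgebra A D \<longleftrightarrow>
     D \<subseteq> carrier A \<and> \<zero>\<^bsub>A\<^esub> \<in> D \<and>
     (\<forall>x\<in>D. \<forall>y\<in>D. x \<oplus>\<^bsub>A\<^esub> y \<in> D) \<and>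
     (\<forall>a. \<forall>x\<in>D. a \<odot>\<^bsub>A\<^esub> x \<in> D) \<and>
     (\<forall>x\<in>D. \<forall>y\<in>D. x \<otimes>\<^bsub>A\<^esub> y \<in> D) \<and>
     (\<forall>x\<in>D. star A x \<in> D) \<and>
     closedin (Metric_space.mtopology (carrier A) (cdist A)) D"

definition cstar_generated_by :: "'a cstar \<Rightarrow> 'a set \<Rightarrow> bool" where
  "cstar_generated_by A X \<longleftrightarrow>
     X \<subseteq> carrier A \<and> (\<forall>D. closed_star_subalgebra A D \<and> X \<subseteq> D \<longrightarrow> D = carrier A)"

definition projection :: "'a cstar \<Rightarrow> 'a \<Rightarrow> bool" where
  "projection A p \<longleftrightarrow> p \<in> carrier A \<and> star A p = p \<and> p \<otimes>\<^bsub>A\<^esub> p = p"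

definition partial_isometry :: "'a cstar \<Rightarrow> 'a \<Rightarrow> bool" where
  "partial_isometry A s \<longleftrightarrow> s \<in> carrier A \<and> s \<otimes>\<^bsub>A\<^esub> star A s \<otimes>\<^bsub>A\<^esub> s = s"


section \<open>Graph C*-algebras\<close>

text \<open>
  The graph is meant to be row-finite, so that the sum over \<open>out_arcs E v\<close> is a finite sum. There
  is no relation at a sink \<open>v\<close> (no arc starts there).
\<close>

definition cuntz_krieger_family ::
    "('v, 'e) pre_digraph \<Rightarrow> 'a cstar \<Rightarrow> ('v \<Rightarrow> 'a) \<Rightarrow> ('e \<Rightarrow> 'a) \<Rightarrow> bool" where
  "cuntz_krieger_family E A P S \<longleftrightarrow>
     (\<forall>v\<in>verts E. projection A (P v)) \<and>
     (\<forall>v\<in>verts E. \<forall>w\<in>verts E. v \<noteq> w \<longrightarrow> P v \<otimes>\<^bsub>A\<^esub> P w = \<zero>\<^bsub>A\<^esub>) \<and>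
     (\<forall>e\<in>arcs E. partial_isometry A (S e)) \<and>
     (\<forall>e\<in>arcs E. star A (S e) \<otimes>\<^bsub>A\<^esub> S e = P (head E e)) \<and>
     (\<forall>v\<in>tail E ` arcs E. P v = (\<Oplus>\<^bsub>A\<^esub>e\<in>out_arcs E v. S e \<otimes>\<^bsub>A\<^esub> star A (S e)))"

text \<open>
  \<open>is_graph_cstar E A P S\<close>: the C*-algebra \<open>A\<close> is \<open>C*(E)\<close>, the universal C*-algebra generated by
  a Cuntz-Krieger \<open>E\<close>-family, and \<open>(P, S)\<close> is its universal family. HOL cannot quantify over all
  types, so universality is required with respect to the C*-algebras whose elements are real
  numbers. For a countable graph this is no restriction: a Cuntz-Krieger family generates a
  separable C*-algebra, which has at most as many elements as there are real numbers. Lemma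
  \<open>is_graph_cstar_universal\<close> below derives the universal property for C*-algebras of any type, and
  \<open>graph_cstar_exists\<close> shows that \<open>C*(E)\<close> exists. The homomorphism is unique because \<open>(P, S)\<close>
  generates \<open>A\<close>.
\<close>

definition is_graph_cstar ::
    "('v, 'e) pre_digraph \<Rightarrow> 'a cstar \<Rightarrow> ('v \<Rightarrow> 'a) \<Rightarrow> ('e \<Rightarrow> 'a) \<Rightarrow> bool" where
  "is_graph_cstar E A P S \<longleftrightarrow>
     cstar_algebra A \<and> cuntz_krieger_family E A P S \<and>
     cstar_generated_by A (P ` verts E \<union> S ` arcs E) \<and>
     (\<forall>(B :: real cstar) Q T. cstar_algebra B \<and> cuntz_krieger_family E B Q T \<longrightarrow>
        (\<exists>f. star_hom A B f \<and> (\<forall>v\<in>verts E. f (P v) = Q v) \<and> (\<forall>e\<in>arcs E. f (S e) = T e)))"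


section \<open>Existence and universality\<close>

subsection \<open>Elementary facts\<close>

context pre_cstar_algebra
begin

lemma smult_zero_left: "x \<in> carrier A \<Longrightarrow> 0 \<odot> x = \<zero>"
  using smult_add_left[of x 0 0] by (metis add.r_cancel_one' smult_closed add_0)

lemma smult_uminus: "x \<in> carrier A \<Longrightarrow> (- 1) \<odot> x = \<ominus> x"
  using smult_add_left[of x "-1" 1] by (simp add: smult_zero_left smult_one minus_equality)

lemma diff_smult: "\<lbrakk>x \<in> carrier A; y \<in> carrier A\<rbrakk> \<Longrightarrow> x \<ominus> y = x \<oplus> (- 1) \<odot> y"
  by (simp add: minus_eq smult_uminus)

lemma cnorm_minus: "x \<in> carrier A \<Longrightarrow> cnorm A (\<ominus> x) = cnorm A x"
  using cnorm_smult[of x "-1"] by (simp add: smult_uminus)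

lemma cnorm_diff_commute:
  "\<lbrakk>x \<in> carrier A; y \<in> carrier A\<rbrakk> \<Longrightarrow> cnorm A (x \<ominus> y) = cnorm A (y \<ominus> x)"
  using cnorm_minus[of "x \<ominus> y"] by (simp add: minus_eq minus_add a_comm)

lemma cnorm_zero [simp]: "cnorm A \<zero> = 0"
  by (simp add: cnorm_eq_zero_iff)

lemma diff_eq_zero_iff: "\<lbrakk>x \<in> carrier A; y \<in> carrier A\<rbrakk> \<Longrightarrow> x \<ominus> y = \<zero> \<longleftrightarrow> x = y"
  by (metis a_inv_closed minus_eq minus_equality minus_minus r_neg)

lemma cnorm_diff_triangle:
  assumes "x \<in> carrier A" "y \<in> carrier A" "z \<in> carrier A"
  shows "cnorm A (x \<ominus> z) \<le> cnorm A (x \<ominus> y) + cnorm A (y \<ominus> z)"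
proof -
  have "x \<ominus> z = (x \<ominus> y) \<oplus> (y \<ominus> z)"
  proof -
    have "(x \<oplus> \<ominus> y) \<oplus> (y \<oplus> \<ominus> z) = x \<oplus> ((\<ominus> y \<oplus> y) \<oplus> \<ominus> z)"
      using assms by (simp only: a_assoc a_closed a_inv_closed)
    then show ?thesis
      using assms by (simp add: minus_eq l_neg)
  qed
  then show ?thesis
    using cnorm_add assms by simp
qed

lemma metric: "Metric_space (carrier A) (cdist A)"
  by unfold_locales
    (auto simp: cdist_def cnorm_diff_commute cnorm_eq_zero_iff cnorm_nonneg diff_eq_zero_iff
      cnorm_diff_triangle)

text \<open>Convergence and completeness in terms of sequences and the norm.\<close>

definition converges :: "(nat \<Rightarrow> 'a) \<Rightarrow> 'a \<Rightarrow> bool" where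
  "converges \<sigma> l \<longleftrightarrow> (\<lambda>n. cnorm A (\<sigma> n \<ominus> l)) \<longlonglongrightarrow> 0"

lemma convergesI:
  assumes "\<And>n. cnorm A (\<sigma> n \<ominus> l) \<le> b n" "b \<longlonglongrightarrow> 0" "\<And>n. \<sigma> n \<in> carrier A" "l \<in> carrier A"
  shows "converges \<sigma> l"
  unfolding converges_def
  by (rule tendsto_sandwich[OF _ _ tendsto_const assms(2)]) (auto simp: assms cnorm_nonneg)

lemma limitin_iff_converges:
  assumes "\<And>n. \<sigma> n \<in> carrier A"
  shows "limitin (Metric_space.mtopology (carrier A) (cdist A)) \<sigma> l sequentially
    \<longleftrightarrow> l \<in> carrier A \<and> converges \<sigma> l"
proof -
  have "\<bar>cnorm A (\<sigma> n \<ominus> l) - 0\<bar> = cdist A (\<sigma> n) l" if "l \<in> carrier A" for n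
    using that assms cnorm_nonneg[of "\<sigma> n \<ominus> l"] by (simp add: cdist_def)
  then show ?thesis
    unfolding Metric_space.limit_metric_sequentially[OF metric] converges_def LIMSEQ_iff real_norm_def
    using assms by (intro conj_cong refl) simp
qed

lemma closed_iff:
  "closedin (Metric_space.mtopology (carrier A) (cdist A)) D \<longleftrightarrow>
    D \<subseteq> carrier A \<and> (\<forall>\<sigma> l. (\<forall>n. \<sigma> n \<in> D) \<and> l \<in> carrier A \<and> converges \<sigma> l \<longrightarrow> l \<in> D)"
  unfolding Metric_space.metric_closedin_iff_sequentially_closed[OF metric]
proof (intro conj_cong refl iff_allI)
  fix \<sigma> l assume "D \<subseteq> carrier A"
  then show "(range \<sigma> \<subseteq> D \<and> limitin (Metric_space.mtopology (carrier A) (cdist A)) \<sigma> l sequentially \<longrightarrow> l \<in> D)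
    = ((\<forall>n. \<sigma> n \<in> D) \<and> l \<in> carrier A \<and> converges \<sigma> l \<longrightarrow> l \<in> D)"
    using limitin_iff_converges[of \<sigma> l] by (auto simp: image_subset_iff)
qed

lemma complete_iff:
  "Metric_space.mcomplete (carrier A) (cdist A) \<longleftrightarrow>
    (\<forall>\<sigma>. (\<forall>n. \<sigma> n \<in> carrier A) \<and>
      (\<forall>\<epsilon>>0. \<exists>N. \<forall>m\<ge>N. \<forall>n\<ge>N. cnorm A (\<sigma> m \<ominus> \<sigma> n) < \<epsilon>) \<longrightarrow>
      (\<exists>l\<in>carrier A. converges \<sigma> l))" (is "?L \<longleftrightarrow> ?R")
proof -
  interpret M: Metric_space "carrier A" "cdist A"
    by (rule metric)
  have c: "M.MCauchy \<sigma> \<longleftrightarrow> (\<forall>n. \<sigma> n \<in> carrier A) \<and>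
      (\<forall>\<epsilon>>0. \<exists>N. \<forall>m\<ge>N. \<forall>n\<ge>N. cnorm A (\<sigma> m \<ominus> \<sigma> n) < \<epsilon>)" for \<sigma>
    unfolding M.MCauchy_def image_subset_iff
  proof (intro conj_cong)
    assume "\<forall>n. \<sigma> n \<in> carrier A"
    then have "cdist A (\<sigma> m) (\<sigma> n) = cnorm A (\<sigma> m \<ominus> \<sigma> n)" for m n
      by (simp add: cdist_def)
    then show "(\<forall>\<epsilon>>0. \<exists>N. \<forall>n n'. N \<le> n \<longrightarrow> N \<le> n' \<longrightarrow> cdist A (\<sigma> n) (\<sigma> n') < \<epsilon>) \<longleftrightarrow>
        (\<forall>\<epsilon>>0. \<exists>N. \<forall>m\<ge>N. \<forall>n\<ge>N. cnorm A (\<sigma> m \<ominus> \<sigma> n) < \<epsilon>)"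
      by simp
  qed simp
  have d: "(\<exists>x. limitin M.mtopology \<sigma> x sequentially) \<longleftrightarrow> (\<exists>l\<in>carrier A. converges \<sigma> l)"
    if "\<forall>n. \<sigma> n \<in> carrier A" for \<sigma>
    using limitin_iff_converges[of \<sigma>] that by blast
  show ?thesis
    unfolding M.mcomplete_def c using d by blast
qed

lemma cnorm_star_aux: "x \<in> carrier A \<Longrightarrow> cnorm A x \<le> cnorm A (star A x)"
proof (cases "x = \<zero>")
  case False
  assume x: "x \<in> carrier A"
  have "cnorm A x * cnorm A x \<le> cnorm A (star A x) * cnorm A x"
    using cstar_identity[OF x] cnorm_mult[of "star A x" x] x by (simp add: power2_eq_square)
  moreover have "cnorm A x > 0"
    using False x cnorm_nonneg cnorm_eq_zero_iff by (metis order_le_less)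
  ultimately show ?thesis
    by simp
qed (simp add: cnorm_nonneg)

lemma cnorm_star: "x \<in> carrier A \<Longrightarrow> cnorm A (star A x) = cnorm A x"
  using cnorm_star_aux[of x] cnorm_star_aux[of "star A x"] by (simp add: star_star)

lemma projection_cnorm: "projection A p \<Longrightarrow> cnorm A p \<le> 1"
  using cstar_identity[of p] cnorm_nonneg[of p]
  by (auto simp: projection_def power2_eq_square)

lemma cnorm_le_one_if_projection:
  assumes "s \<in> carrier A" "projection A (star A s \<otimes> s)"
  shows "cnorm A s \<le> 1"
proof -
  have "(cnorm A s)\<^sup>2 \<le> 1\<^sup>2"
    using cstar_identity[OF assms(1)] projection_cnorm[OF assms(2)] by simp
  then show ?thesis
    by (rule power2_le_imp_le) simp
qed

end

lemma star_homD:
  assumes "star_hom A B f"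
  shows "x \<in> carrier A \<Longrightarrow> f x \<in> carrier B"
    and "\<lbrakk>x \<in> carrier A; y \<in> carrier A\<rbrakk> \<Longrightarrow> f (x \<oplus>\<^bsub>A\<^esub> y) = f x \<oplus>\<^bsub>B\<^esub> f y"
    and "x \<in> carrier A \<Longrightarrow> f (a \<odot>\<^bsub>A\<^esub> x) = a \<odot>\<^bsub>B\<^esub> f x"
    and "\<lbrakk>x \<in> carrier A; y \<in> carrier A\<rbrakk> \<Longrightarrow> f (x \<otimes>\<^bsub>A\<^esub> y) = f x \<otimes>\<^bsub>B\<^esub> f y"
    and "x \<in> carrier A \<Longrightarrow> f (star A x) = star B (f x)"
  using assms by (simp_all add: star_hom_def)

lemma star_hom_zero:
  assumes "star_hom A B f" "pre_cstar_algebra A" "pre_cstar_algebra B"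
  shows "f \<zero>\<^bsub>A\<^esub> = \<zero>\<^bsub>B\<^esub>"
proof -
  interpret A: pre_cstar_algebra A by fact
  interpret B: pre_cstar_algebra B by fact
  have "f (0 \<odot>\<^bsub>A\<^esub> \<zero>\<^bsub>A\<^esub>) = 0 \<odot>\<^bsub>B\<^esub> f \<zero>\<^bsub>A\<^esub>"
    by (rule star_homD(3)[OF assms(1)]) simp
  then show ?thesis
    using star_homD(1)[OF assms(1) A.zero_closed] by (simp add: A.smult_zero_left B.smult_zero_left)
qed

lemma star_hom_finsum:
  assumes "star_hom A B f" "pre_cstar_algebra A" "pre_cstar_algebra B"
    and "\<And>x. x \<in> X \<Longrightarrow> h x \<in> carrier A"
  shows "f (\<Oplus>\<^bsub>A\<^esub>x\<in>X. h x) = (\<Oplus>\<^bsub>B\<^esub>x\<in>X. f (h x))"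
proof -
  interpret A: pre_cstar_algebra A by fact
  interpret B: pre_cstar_algebra B by fact
  note zero = star_hom_zero[OF assms(1-3)]
  show ?thesis
  proof (cases "finite X")
    case True
    then show ?thesis
      using assms(4)
    proof (induction X rule: finite_induct)
      case (insert x F)
      have h: "h \<in> F \<rightarrow> carrier A" "h x \<in> carrier A"
        using insert.prems by auto
      then have "(\<lambda>x. f (h x)) \<in> F \<rightarrow> carrier B" "f (h x) \<in> carrier B"
        using star_homD(1)[OF assms(1)] by auto
      then show ?case
        using insert h by (simp add: star_homD(2)[OF assms(1)])
    qed (simp add: zero)
  qed (simp add: zero)
qed

lemma cuntz_krieger_family_map:
  assumes "star_hom A B f" "pre_cstar_algebra A" "pre_cstar_algebra B"
    and "cuntz_krieger_family E A P S"
  shows "cuntz_krieger_family E B (\<lambda>v. f (P v)) (\<lambda>e. f (S e))"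
proof -
  interpret A: pre_cstar_algebra A by fact
  interpret B: pre_cstar_algebra B by fact
  note f = star_homD[OF assms(1)]
  have S: "S e \<in> carrier A" if "e \<in> arcs E" for e
    using assms(4) that by (auto simp: cuntz_krieger_family_def partial_isometry_def)
  have "f (\<Oplus>\<^bsub>A\<^esub>e\<in>out_arcs E v. S e \<otimes>\<^bsub>A\<^esub> star A (S e)) =
      (\<Oplus>\<^bsub>B\<^esub>e\<in>out_arcs E v. f (S e \<otimes>\<^bsub>A\<^esub> star A (S e)))" for v
    by (rule star_hom_finsum[OF assms(1-3)]) (auto simp: S)
  moreover have "(\<Oplus>\<^bsub>B\<^esub>e\<in>out_arcs E v. f (S e \<otimes>\<^bsub>A\<^esub> star A (S e))) = (\<Oplus>\<^bsub>B\<^esub>e\<in>out_arcs E v. f (S e) \<otimes>\<^bsub>B\<^esub> star B (f (S e)))" for v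
    by (rule B.finsum_cong') (auto simp: S f)
  ultimately have sum: "f (\<Oplus>\<^bsub>A\<^esub>e\<in>out_arcs E v. S e \<otimes>\<^bsub>A\<^esub> star A (S e)) =
      (\<Oplus>\<^bsub>B\<^esub>e\<in>out_arcs E v. f (S e) \<otimes>\<^bsub>B\<^esub> star B (f (S e)))" for v
    by simp
  have "partial_isometry B (f (S e))" "star B (f (S e)) \<otimes>\<^bsub>B\<^esub> f (S e) = f (P (head E e))"
    if "e \<in> arcs E" for e
  proof -
    have "S e \<otimes>\<^bsub>A\<^esub> star A (S e) \<otimes>\<^bsub>A\<^esub> S e = S e" "star A (S e) \<otimes>\<^bsub>A\<^esub> S e = P (head E e)"
      using assms(4) that by (auto simp: cuntz_krieger_family_def partial_isometry_def)
    then show "partial_isometry B (f (S e))" "star B (f (S e)) \<otimes>\<^bsub>B\<^esub> f (S e) = f (P (head E e))"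
      using S[OF that] f unfolding partial_isometry_def by (metis A.mult_closed A.star_closed)+
  qed
  moreover have "projection B (f (P v))" if "v \<in> verts E" for v
    using assms(4) that unfolding cuntz_krieger_family_def projection_def by (metis f)
  moreover have "f (P v) \<otimes>\<^bsub>B\<^esub> f (P w) = \<zero>\<^bsub>B\<^esub>" if "v \<in> verts E" "w \<in> verts E" "v \<noteq> w" for v w
  proof -
    have "P v \<otimes>\<^bsub>A\<^esub> P w = \<zero>\<^bsub>A\<^esub>" "P v \<in> carrier A" "P w \<in> carrier A"
      using assms(4) that by (auto simp: cuntz_krieger_family_def projection_def)
    then show ?thesis
      using f(4) star_hom_zero[OF assms(1-3)] by metis
  qed
  moreover have "f (P v) = (\<Oplus>\<^bsub>B\<^esub>e\<in>out_arcs E v. f (S e) \<otimes>\<^bsub>B\<^esub> star B (f (S e)))"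
    if "v \<in> tail E ` arcs E" for v
    using assms(4) that sum unfolding cuntz_krieger_family_def by metis
  ultimately show ?thesis
    unfolding cuntz_krieger_family_def by (intro conjI ballI impI)
qed

subsection \<open>Closed *-subalgebras\<close>

lemma closed_star_subalgebraD:
  assumes "closed_star_subalgebra A D"
  shows "D \<subseteq> carrier A" and "\<zero>\<^bsub>A\<^esub> \<in> D"
    and "\<lbrakk>x \<in> D; y \<in> D\<rbrakk> \<Longrightarrow> x \<oplus>\<^bsub>A\<^esub> y \<in> D"
    and "x \<in> D \<Longrightarrow> a \<odot>\<^bsub>A\<^esub> x \<in> D"
    and "\<lbrakk>x \<in> D; y \<in> D\<rbrakk> \<Longrightarrow> x \<otimes>\<^bsub>A\<^esub> y \<in> D"
    and "x \<in> D \<Longrightarrow> star A x \<in> D"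
  using assms unfolding closed_star_subalgebra_def by blast+

lemma (in pre_cstar_algebra) closed_star_subalgebra_limit:
  assumes "closed_star_subalgebra A D" "\<And>n. \<sigma> n \<in> D" "l \<in> carrier A" "converges \<sigma> l"
  shows "l \<in> D"
proof -
  have "\<forall>\<sigma> l. (\<forall>n. \<sigma> n \<in> D) \<and> l \<in> carrier A \<and> converges \<sigma> l \<longrightarrow> l \<in> D"
    using assms(1) unfolding closed_star_subalgebra_def closed_iff by (elim conjE)
  from this[rule_format, of \<sigma> l] show ?thesis
    using assms(2-4) by blast
qed

lemma (in pre_cstar_algebra) closed_star_subalgebraI:
  assumes "D \<subseteq> carrier A" "\<zero> \<in> D"
    and "\<And>x y. \<lbrakk>x \<in> D; y \<in> D\<rbrakk> \<Longrightarrow> x \<oplus> y \<in> D" "\<And>x a. x \<in> D \<Longrightarrow> a \<odot> x \<in> D"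
    and "\<And>x y. \<lbrakk>x \<in> D; y \<in> D\<rbrakk> \<Longrightarrow> x \<otimes> y \<in> D" "\<And>x. x \<in> D \<Longrightarrow> star A x \<in> D"
    and "\<And>\<sigma> l. \<lbrakk>\<And>n. \<sigma> n \<in> D; l \<in> carrier A; converges \<sigma> l\<rbrakk> \<Longrightarrow> l \<in> D"
  shows "closed_star_subalgebra A D"
  unfolding closed_star_subalgebra_def closed_iff
proof (intro conjI allI ballI impI assms(1-6))
  fix \<sigma> l assume *: "(\<forall>n. \<sigma> n \<in> D) \<and> l \<in> carrier A \<and> converges \<sigma> l"
  show "l \<in> D"
    by (rule assms(7)[of \<sigma>]) (use * in simp_all)
qed

lemma (in cstar_algebra) subalgebra:
  assumes D: "closed_star_subalgebra A D"
  shows "cstar_algebra (A\<lparr>carrier := D\<rparr>)"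
proof -
  let ?B = "A\<lparr>carrier := D\<rparr>"
  have sub: "x \<in> carrier A" if "x \<in> D" for x
    using D that by (auto simp: closed_star_subalgebra_def)
  have cl: "\<zero> \<in> D" "\<And>x y. \<lbrakk>x \<in> D; y \<in> D\<rbrakk> \<Longrightarrow> x \<oplus> y \<in> D" "\<And>x a. x \<in> D \<Longrightarrow> a \<odot> x \<in> D"
      "\<And>x y. \<lbrakk>x \<in> D; y \<in> D\<rbrakk> \<Longrightarrow> x \<otimes> y \<in> D" "\<And>x. x \<in> D \<Longrightarrow> star A x \<in> D"
    by (fact closed_star_subalgebraD(2-6)[OF D])+
  have "\<exists>y\<in>D. y \<oplus> x = \<zero>" if "x \<in> D" for x
    using cl(3)[OF that, of "-1"] sub[OF that] by (intro bexI[of _ "(-1) \<odot> x"]) (auto simp: smult_uminus l_neg)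
  then have "abelian_group ?B"
    by (intro abelian_groupI) (simp_all add: cl sub a_ac)
  then interpret B: pre_cstar_algebra ?B
    by (intro pre_cstar_algebra.intro pre_cstar_algebra_axioms.intro)
      (simp_all add: cl sub smult_add_left smult_add_right smult_smult smult_one mult_assoc
        mult_add_left mult_add_right smult_mult_left smult_mult_right star_star star_add star_smult
        star_mult cnorm_nonneg cnorm_eq_zero_iff cnorm_add cnorm_smult cnorm_mult cstar_identity)
  have diff: "x \<ominus>\<^bsub>?B\<^esub> y = x \<ominus> y" if "x \<in> D" "y \<in> D" for x y
    using B.diff_smult[of x y] diff_smult[of x y] that sub by simp
  show ?thesis
  proof (unfold_locales, unfold B.complete_iff, intro allI impI)
    fix \<sigma> :: "nat \<Rightarrow> 'a" assume a: "(\<forall>n. \<sigma> n \<in> carrier ?B) \<and> (\<forall>\<epsilon>>0. \<exists>N. \<forall>m\<ge>N. \<forall>n\<ge>N. cnorm ?B (\<sigma> m \<ominus>\<^bsub>?B\<^esub> \<sigma> n) < \<epsilon>)"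
    then have \<sigma>: "\<sigma> n \<in> D" for n
      by simp
    moreover have "\<forall>\<epsilon>>0. \<exists>N. \<forall>m\<ge>N. \<forall>n\<ge>N. cnorm A (\<sigma> m \<ominus> \<sigma> n) < \<epsilon>"
      using a by (simp add: diff[OF \<sigma> \<sigma>])
    ultimately obtain l where l: "l \<in> carrier A" "converges \<sigma> l"
      using complete unfolding complete_iff using sub by blast
    then have "l \<in> D"
      by (rule closed_star_subalgebra_limit[OF D \<sigma>])
    then show "\<exists>l\<in>carrier ?B. B.converges \<sigma> l"
      using l \<sigma> by (auto simp: B.converges_def converges_def diff)
  qed
qed

lemma (in cstar_algebra) closed_star_subalgebra_trans:
  assumes D: "closed_star_subalgebra A D" and D': "closed_star_subalgebra (A\<lparr>carrier := D\<rparr>) D'"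
  shows "closed_star_subalgebra A D'"
proof -
  interpret B: cstar_algebra "A\<lparr>carrier := D\<rparr>"
    by (rule subalgebra[OF D])
  have sub: "x \<in> carrier A" if "x \<in> D" for x
    using D that by (auto simp: closed_star_subalgebra_def)
  have D'D: "D' \<subseteq> D"
    using D' by (auto simp: closed_star_subalgebra_def)
  have diff: "x \<ominus>\<^bsub>A\<lparr>carrier := D\<rparr>\<^esub> y = x \<ominus> y" if "x \<in> D" "y \<in> D" for x y
    using B.diff_smult[of x y] diff_smult[of x y] that sub by simp
  show ?thesis
  proof (rule closed_star_subalgebraI)
    fix \<sigma> l assume \<sigma>: "\<And>n. \<sigma> n \<in> D'" and l: "l \<in> carrier A" "converges \<sigma> l"
    have \<sigma>D: "\<sigma> n \<in> D" for n
      using \<sigma> D'D by auto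
    have lD: "l \<in> D"
      by (rule closed_star_subalgebra_limit[OF D \<sigma>D l])
    have "B.converges \<sigma> l"
      using l(2) by (simp add: converges_def B.converges_def diff[OF \<sigma>D lD])
    then show "l \<in> D'"
      using B.closed_star_subalgebra_limit[OF D' \<sigma>] lD by simp
  qed (use closed_star_subalgebraD(2-6)[OF D'] D'D sub in auto)
qed

lemma star_hom_subalgebra: 
  assumes "closed_star_subalgebra A D"
  shows "star_hom (A\<lparr>carrier := D\<rparr>) A (\<lambda>x. x)"
  using closed_star_subalgebraD(1)[OF assms] by (auto simp: star_hom_def)

lemma (in cstar_algebra) cuntz_krieger_family_subalgebra:
  assumes D: "closed_star_subalgebra A D" and CK: "cuntz_krieger_family E A P S"
    and PS: "P ` verts E \<union> S ` arcs E \<subseteq> D"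
  shows "cuntz_krieger_family E (A\<lparr>carrier := D\<rparr>) P S"
proof -
  interpret B: cstar_algebra "A\<lparr>carrier := D\<rparr>"
    by (rule subalgebra[OF D])
  have SS: "S e \<otimes> star A (S e) \<in> D" if "e \<in> arcs E" for e
    using PS D that by (auto simp: closed_star_subalgebra_def)
  have "(\<Oplus>\<^bsub>A\<lparr>carrier := D\<rparr>\<^esub>e\<in>out_arcs E v. S e \<otimes> star A (S e)) = (\<Oplus>e\<in>out_arcs E v. S e \<otimes> star A (S e))" for v
    by (rule star_hom_finsum[OF star_hom_subalgebra[OF D] B.pre_cstar_algebra_axioms pre_cstar_algebra_axioms])
      (simp add: SS)
  then show ?thesis
    using CK PS unfolding cuntz_krieger_family_def projection_def partial_isometry_def
    by (simp add: image_subset_iff)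
qed

lemma (in cstar_algebra) generated_subalgebra:
  assumes "X \<subseteq> carrier A"
  shows "\<exists>D. closed_star_subalgebra A D \<and> X \<subseteq> D \<and> cstar_generated_by (A\<lparr>carrier := D\<rparr>) X"
proof -
  define \<D> where "\<D> = {D. closed_star_subalgebra A D \<and> X \<subseteq> D}"
  define D where "D = \<Inter>\<D>"
  have \<D>: "closed_star_subalgebra A D'" if "D' \<in> \<D>" for D'
    using that by (simp add: \<D>_def)
  have carrier: "carrier A \<in> \<D>"
    using assms by (auto simp: \<D>_def intro!: closed_star_subalgebraI)
  have D: "closed_star_subalgebra A D"
  proof (rule closed_star_subalgebraI)
    show "D \<subseteq> carrier A"
      using carrier by (auto simp: D_def)
  next
    fix \<sigma> l assume \<sigma>: "\<And>n. \<sigma> n \<in> D" and l: "l \<in> carrier A" "converges \<sigma> l"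
    show "l \<in> D"
      unfolding D_def
    proof
      fix D' assume D': "D' \<in> \<D>"
      show "l \<in> D'"
        by (rule closed_star_subalgebra_limit[OF \<D>[OF D'] _ l]) (use \<sigma> D' in \<open>simp add: D_def\<close>)
    qed
  qed (simp_all add: D_def closed_star_subalgebraD(2-6)[OF \<D>])
  have "X \<subseteq> D"
    by (auto simp: D_def \<D>_def)
  moreover have "D' = D" if "closed_star_subalgebra (A\<lparr>carrier := D\<rparr>) D'" "X \<subseteq> D'" for D'
  proof
    show "D' \<subseteq> D"
      using closed_star_subalgebraD(1)[OF that(1)] by simp
    show "D \<subseteq> D'"
      using closed_star_subalgebra_trans[OF D that(1)] that(2) by (auto simp: D_def \<D>_def)
  qed
  ultimately show ?thesis
    using D unfolding cstar_generated_by_def by (intro exI[of _ D]) simp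
qed

subsection \<open>Products and existence\<close>

definition product_cstar :: "('i \<Rightarrow> 'a cstar) \<Rightarrow> ('i \<Rightarrow> 'a) cstar" where
  "product_cstar B =
     \<lparr>carrier = {f. (\<forall>i. f i \<in> carrier (B i)) \<and> (\<exists>K. \<forall>i. cnorm (B i) (f i) \<le> K)},
      monoid.mult = (\<lambda>f g i. f i \<otimes>\<^bsub>B i\<^esub> g i),
      monoid.one = (\<lambda>i. \<one>\<^bsub>B i\<^esub>),
      ring.zero = (\<lambda>i. \<zero>\<^bsub>B i\<^esub>),
      ring.add = (\<lambda>f g i. f i \<oplus>\<^bsub>B i\<^esub> g i),
      module.smult = (\<lambda>a f i. a \<odot>\<^bsub>B i\<^esub> f i),
      star = (\<lambda>f i. star (B i) (f i)),
      cnorm = (\<lambda>f. SUP i. cnorm (B i) (f i))\<rparr>"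

lemma product_cstar_simps:
  "f \<in> carrier (product_cstar B) \<longleftrightarrow> (\<forall>i. f i \<in> carrier (B i)) \<and> (\<exists>K. \<forall>i. cnorm (B i) (f i) \<le> K)"
  "f \<otimes>\<^bsub>product_cstar B\<^esub> g = (\<lambda>i. f i \<otimes>\<^bsub>B i\<^esub> g i)"
  "f \<oplus>\<^bsub>product_cstar B\<^esub> g = (\<lambda>i. f i \<oplus>\<^bsub>B i\<^esub> g i)"
  "\<zero>\<^bsub>product_cstar B\<^esub> = (\<lambda>i. \<zero>\<^bsub>B i\<^esub>)"
  "a \<odot>\<^bsub>product_cstar B\<^esub> f = (\<lambda>i. a \<odot>\<^bsub>B i\<^esub> f i)"
  "star (product_cstar B) f = (\<lambda>i. star (B i) (f i))"
  by (simp_all add: product_cstar_def)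

lemma cstar_algebra_product:
  fixes B :: "'i \<Rightarrow> 'a cstar"
  assumes "\<And>i. cstar_algebra (B i)"
  shows "cstar_algebra (product_cstar B)"
proof -
  let ?P = "product_cstar B"
  have pre: "pre_cstar_algebra (B i)" for i
    using assms by (rule cstar_algebra.axioms(1))
  have ab: "abelian_group (B i)" for i
    using pre by (rule pre_cstar_algebra.axioms(1))
  note abg = abelian_group.axioms(1)[OF ab]
  note ax = pre_cstar_algebra.smult_closed[OF pre] pre_cstar_algebra.mult_closed[OF pre]
    pre_cstar_algebra.star_closed[OF pre] abelian_monoid.a_closed[OF abg]
    abelian_monoid.zero_closed[OF abg]
  note eq = pre_cstar_algebra.smult_add_left[OF pre] pre_cstar_algebra.smult_add_right[OF pre]
    pre_cstar_algebra.smult_smult[OF pre] pre_cstar_algebra.smult_one[OF pre]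
    pre_cstar_algebra.mult_assoc[OF pre] pre_cstar_algebra.mult_add_left[OF pre]
    pre_cstar_algebra.mult_add_right[OF pre] pre_cstar_algebra.smult_mult_left[OF pre]
    pre_cstar_algebra.smult_mult_right[OF pre] pre_cstar_algebra.star_star[OF pre]
    pre_cstar_algebra.star_add[OF pre] pre_cstar_algebra.star_smult[OF pre]
    pre_cstar_algebra.star_mult[OF pre]
  note cn = pre_cstar_algebra.cnorm_add[OF pre] pre_cstar_algebra.cnorm_mult[OF pre]
    pre_cstar_algebra.cnorm_smult[OF pre] pre_cstar_algebra.cnorm_star[OF pre]
    pre_cstar_algebra.cnorm_nonneg[OF pre]
  have comp: "f i \<in> carrier (B i)" if "f \<in> carrier ?P" for f i
    using that by (simp add: product_cstar_simps)
  have le: "cnorm (B i) (f i) \<le> cnorm ?P f" if "f \<in> carrier ?P" for f i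
    using that unfolding product_cstar_def
    by (auto intro!: cSUP_upper bdd_aboveI2)
  have least: "cnorm ?P f \<le> K" if "\<And>i. cnorm (B i) (f i) \<le> K" for f K
    using that by (auto simp: product_cstar_def intro: cSUP_least)
  have carrierI: "f \<in> carrier ?P" if "\<And>i. f i \<in> carrier (B i)" "\<And>i. cnorm (B i) (f i) \<le> K" for f K
    using that by (auto simp: product_cstar_simps)
  have nonneg: "0 \<le> cnorm ?P f" if "f \<in> carrier ?P" for f
    using le[OF that] cn(5)[OF comp[OF that]] by (meson order_trans)
  have add: "f \<oplus>\<^bsub>?P\<^esub> g \<in> carrier ?P" "cnorm ?P (f \<oplus>\<^bsub>?P\<^esub> g) \<le> cnorm ?P f + cnorm ?P g"
    if f: "f \<in> carrier ?P" and g: "g \<in> carrier ?P" for f g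
  proof -
    have b: "cnorm (B i) (f i \<oplus>\<^bsub>B i\<^esub> g i) \<le> cnorm ?P f + cnorm ?P g" for i
      using cn(1)[OF comp[OF f] comp[OF g], of i] le[OF f, of i] le[OF g, of i] by linarith
    show "f \<oplus>\<^bsub>?P\<^esub> g \<in> carrier ?P"
      by (rule carrierI[where K="cnorm ?P f + cnorm ?P g"]) (simp_all add: product_cstar_simps(3) b ax comp f g)
    show "cnorm ?P (f \<oplus>\<^bsub>?P\<^esub> g) \<le> cnorm ?P f + cnorm ?P g"
      by (rule least) (simp add: product_cstar_simps(3) b)
  qed
  have mult: "f \<otimes>\<^bsub>?P\<^esub> g \<in> carrier ?P" "cnorm ?P (f \<otimes>\<^bsub>?P\<^esub> g) \<le> cnorm ?P f * cnorm ?P g"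
    if f: "f \<in> carrier ?P" and g: "g \<in> carrier ?P" for f g
  proof -
    have b: "cnorm (B i) (f i \<otimes>\<^bsub>B i\<^esub> g i) \<le> cnorm ?P f * cnorm ?P g" for i
      using cn(2)[OF comp[OF f] comp[OF g], of i]
        mult_mono[OF le[OF f, of i] le[OF g, of i] nonneg[OF f] cn(5)[OF comp[OF g]]] by linarith
    show "f \<otimes>\<^bsub>?P\<^esub> g \<in> carrier ?P"
      by (rule carrierI[where K="cnorm ?P f * cnorm ?P g"]) (simp_all add: product_cstar_simps(2) b ax comp f g)
    show "cnorm ?P (f \<otimes>\<^bsub>?P\<^esub> g) \<le> cnorm ?P f * cnorm ?P g"
      by (rule least) (simp add: product_cstar_simps(2) b)
  qed
  have smult: "a \<odot>\<^bsub>?P\<^esub> f \<in> carrier ?P" "cnorm ?P (a \<odot>\<^bsub>?P\<^esub> f) = cmod a * cnorm ?P f"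
    if f: "f \<in> carrier ?P" for a f
  proof -
    have c: "cnorm (B i) (a \<odot>\<^bsub>B i\<^esub> f i) = cmod a * cnorm (B i) (f i)" for i
      by (rule cn(3)[OF comp[OF f]])
    then have b: "cnorm (B i) (a \<odot>\<^bsub>B i\<^esub> f i) \<le> cmod a * cnorm ?P f" for i
      using le[OF f, of i] by (simp add: mult_left_mono)
    show cl: "a \<odot>\<^bsub>?P\<^esub> f \<in> carrier ?P"
      by (rule carrierI[where K="cmod a * cnorm ?P f"]) (simp_all add: product_cstar_simps(5) b ax comp f)
    have 1: "cnorm ?P (a \<odot>\<^bsub>?P\<^esub> f) \<le> cmod a * cnorm ?P f"
      by (rule least) (simp add: product_cstar_simps(5) b)
    show "cnorm ?P (a \<odot>\<^bsub>?P\<^esub> f) = cmod a * cnorm ?P f"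
    proof (cases "a = 0")
      case True
      then show ?thesis
        using 1 nonneg[OF cl] by simp
    next
      case False
      have "cnorm ?P f \<le> cnorm ?P (a \<odot>\<^bsub>?P\<^esub> f) / cmod a"
      proof (rule least)
        fix i
        show "cnorm (B i) (f i) \<le> cnorm ?P (a \<odot>\<^bsub>?P\<^esub> f) / cmod a"
          using le[OF cl, of i] c[of i] False by (simp add: product_cstar_simps(5) field_simps)
      qed
      then show ?thesis
        using 1 False by (simp add: field_simps)
    qed
  qed
  have star: "star ?P f \<in> carrier ?P" if f: "f \<in> carrier ?P" for f
    by (rule carrierI[where K="cnorm ?P f"])
      (simp_all add: product_cstar_simps(6) ax comp f cn(4) le)
  have zero: "\<zero>\<^bsub>?P\<^esub> \<in> carrier ?P"
    by (rule carrierI[where K=0]) (simp_all add: product_cstar_simps(4) ax pre_cstar_algebra.cnorm_zero[OF pre])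
  have "\<exists>g\<in>carrier ?P. g \<oplus>\<^bsub>?P\<^esub> f = \<zero>\<^bsub>?P\<^esub>" if f: "f \<in> carrier ?P" for f
    using smult(1)[OF f, of "-1"] comp[OF f]
    by (intro bexI[of _ "(-1) \<odot>\<^bsub>?P\<^esub> f"])
      (simp_all add: product_cstar_simps pre_cstar_algebra.smult_uminus[OF pre] abelian_group.l_neg[OF ab])
  then have "abelian_group ?P"
    by (intro abelian_groupI add zero)
      (auto simp: product_cstar_simps(3,4) fun_eq_iff abelian_monoid.a_assoc[OF abg]
        abelian_monoid.a_comm[OF abg] abelian_monoid.l_zero[OF abg] comp)
  then interpret P: pre_cstar_algebra ?P
  proof (intro pre_cstar_algebra.intro pre_cstar_algebra_axioms.intro)
    fix f assume f: "f \<in> carrier ?P"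
    show "cnorm ?P f = 0 \<longleftrightarrow> f = \<zero>\<^bsub>?P\<^esub>"
    proof
      assume "cnorm ?P f = 0"
      then have "cnorm (B i) (f i) = 0" for i
        using le[OF f, of i] cn(5)[OF comp[OF f], of i] by simp
      then show "f = \<zero>\<^bsub>?P\<^esub>"
        using pre_cstar_algebra.cnorm_eq_zero_iff[OF pre comp[OF f]] by (auto simp: product_cstar_simps(4))
    next
      assume "f = \<zero>\<^bsub>?P\<^esub>"
      then have "cnorm ?P f \<le> 0"
        by (intro least) (simp add: product_cstar_simps(4) pre_cstar_algebra.cnorm_zero[OF pre])
      then show "cnorm ?P f = 0"
        using nonneg[OF f] by simp
    qed
    note id = pre_cstar_algebra.cstar_identity[OF pre comp[OF f]]
    have 1: "cnorm ?P (star ?P f \<otimes>\<^bsub>?P\<^esub> f) \<le> (cnorm ?P f)\<^sup>2"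
      by (rule least) (simp add: product_cstar_simps id le[OF f] cn(5) comp[OF f] power_mono)
    have "cnorm ?P f \<le> sqrt (cnorm ?P (star ?P f \<otimes>\<^bsub>?P\<^esub> f))"
    proof (rule least, rule real_le_rsqrt)
      fix i
      show "(cnorm (B i) (f i))\<^sup>2 \<le> cnorm ?P (star ?P f \<otimes>\<^bsub>?P\<^esub> f)"
        using le[OF mult(1)[OF star[OF f] f], of i] id[of i] by (simp add: product_cstar_simps)
    qed
    then have "(cnorm ?P f)\<^sup>2 \<le> cnorm ?P (star ?P f \<otimes>\<^bsub>?P\<^esub> f)"
      by (metis nonneg[OF f] nonneg[OF mult(1)[OF star[OF f] f]] power_mono real_sqrt_pow2)
    then show "cnorm ?P (star ?P f \<otimes>\<^bsub>?P\<^esub> f) = (cnorm ?P f)\<^sup>2"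
      using 1 by simp
  qed (simp_all add: add mult smult star nonneg, simp_all add: product_cstar_simps(2-6) fun_eq_iff comp eq ax)
  have diff: "(f \<ominus>\<^bsub>?P\<^esub> g) i = f i \<ominus>\<^bsub>B i\<^esub> g i" if "f \<in> carrier ?P" "g \<in> carrier ?P" for f g i
    using P.diff_smult[OF that] pre_cstar_algebra.diff_smult[OF pre comp comp, OF that]
    by (simp add: product_cstar_simps)
  show ?thesis
  proof (unfold_locales, unfold P.complete_iff, intro allI impI)
    fix \<sigma> :: "nat \<Rightarrow> 'i \<Rightarrow> 'a"
    assume a: "(\<forall>n. \<sigma> n \<in> carrier ?P) \<and> (\<forall>\<epsilon>>0. \<exists>N. \<forall>m\<ge>N. \<forall>n\<ge>N. cnorm ?P (\<sigma> m \<ominus>\<^bsub>?P\<^esub> \<sigma> n) < \<epsilon>)"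
    then have \<sigma>: "\<sigma> n \<in> carrier ?P" for n
      by simp
    have cauchy: "\<exists>N. \<forall>m\<ge>N. \<forall>n\<ge>N. \<forall>i. cnorm (B i) (\<sigma> m i \<ominus>\<^bsub>B i\<^esub> \<sigma> n i) < \<epsilon>" if \<epsilon>: "0 < \<epsilon>" for \<epsilon>
    proof -
      obtain N where N: "\<forall>m\<ge>N. \<forall>n\<ge>N. cnorm ?P (\<sigma> m \<ominus>\<^bsub>?P\<^esub> \<sigma> n) < \<epsilon>"
        using a \<epsilon> by blast
      have "cnorm (B i) (\<sigma> m i \<ominus>\<^bsub>B i\<^esub> \<sigma> n i) < \<epsilon>" if "m \<ge> N" "n \<ge> N" for m n i
        using le[OF P.minus_closed[OF \<sigma>[of m] \<sigma>[of n]], of i] N that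
        by (force simp: diff[OF \<sigma> \<sigma>])
      then show ?thesis
        by blast
    qed
    have "\<exists>l. l \<in> carrier (B i) \<and> pre_cstar_algebra.converges (B i) (\<lambda>n. \<sigma> n i) l" for i
    proof -
      interpret Bi: cstar_algebra "B i"
        by (rule assms)
      have "\<forall>\<epsilon>>0. \<exists>N. \<forall>m\<ge>N. \<forall>n\<ge>N. cnorm (B i) (\<sigma> m i \<ominus>\<^bsub>B i\<^esub> \<sigma> n i) < \<epsilon>"
        using cauchy by blast
      with Bi.complete[unfolded Bi.complete_iff, rule_format, of "\<lambda>n. \<sigma> n i"] comp[OF \<sigma>] show ?thesis
        by blast
    qed
    then obtain l where l: "\<And>i. l i \<in> carrier (B i)"
        "\<And>i. pre_cstar_algebra.converges (B i) (\<lambda>n. \<sigma> n i) (l i)"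
      by metis
    have lim: "\<exists>N. \<forall>m\<ge>N. \<forall>i. cnorm (B i) (\<sigma> m i \<ominus>\<^bsub>B i\<^esub> l i) \<le> \<epsilon>" if \<epsilon>: "0 < \<epsilon>" for \<epsilon>
    proof -
      obtain N where N: "\<forall>m\<ge>N. \<forall>n\<ge>N. \<forall>i. cnorm (B i) (\<sigma> m i \<ominus>\<^bsub>B i\<^esub> \<sigma> n i) < \<epsilon>"
        using cauchy[OF \<epsilon>] by blast
      have "cnorm (B i) (\<sigma> m i \<ominus>\<^bsub>B i\<^esub> l i) \<le> \<epsilon>" if m: "m \<ge> N" for m i
      proof -
        interpret Bi: cstar_algebra "B i"
          by (rule assms)
        have "(\<lambda>n. \<epsilon> + cnorm (B i) (\<sigma> n i \<ominus>\<^bsub>B i\<^esub> l i)) \<longlonglongrightarrow> \<epsilon> + 0"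
          using l(2)[of i] unfolding Bi.converges_def by (intro tendsto_intros)
        moreover have "cnorm (B i) (\<sigma> m i \<ominus>\<^bsub>B i\<^esub> l i) \<le> \<epsilon> + cnorm (B i) (\<sigma> n i \<ominus>\<^bsub>B i\<^esub> l i)"
          if n: "n \<ge> N" for n
        proof -
          have "cnorm (B i) (\<sigma> m i \<ominus>\<^bsub>B i\<^esub> \<sigma> n i) < \<epsilon>"
            using N m n by blast
          then show ?thesis
            using Bi.cnorm_diff_triangle[OF comp[OF \<sigma>[of m]] comp[OF \<sigma>[of n]] l(1)] by linarith
        qed
        ultimately show ?thesis
          by (intro LIMSEQ_le_const[where X="\<lambda>n. \<epsilon> + cnorm (B i) (\<sigma> n i \<ominus>\<^bsub>B i\<^esub> l i)"]) auto
      qed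
      then show ?thesis
        by blast
    qed
    have lP: "l \<in> carrier ?P"
    proof -
      obtain N where N: "\<forall>m\<ge>N. \<forall>i. cnorm (B i) (\<sigma> m i \<ominus>\<^bsub>B i\<^esub> l i) \<le> 1"
        using lim[of 1] by auto
      have "cnorm (B i) (l i) \<le> 1 + cnorm ?P (\<sigma> N)" for i
      proof -
        interpret Bi: cstar_algebra "B i"
          by (rule assms)
        have "cnorm (B i) (l i \<ominus>\<^bsub>B i\<^esub> \<zero>\<^bsub>B i\<^esub>) \<le>
            cnorm (B i) (l i \<ominus>\<^bsub>B i\<^esub> \<sigma> N i) + cnorm (B i) (\<sigma> N i \<ominus>\<^bsub>B i\<^esub> \<zero>\<^bsub>B i\<^esub>)"
          using Bi.cnorm_diff_triangle[OF l(1) comp[OF \<sigma>[of N]] Bi.zero_closed] .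
        moreover have "x \<ominus>\<^bsub>B i\<^esub> \<zero>\<^bsub>B i\<^esub> = x" if "x \<in> carrier (B i)" for x
          using that by (simp add: Bi.minus_eq)
        moreover have "cnorm (B i) (l i \<ominus>\<^bsub>B i\<^esub> \<sigma> N i) \<le> 1"
          using N Bi.cnorm_diff_commute[OF l(1) comp[OF \<sigma>[of N]]] by simp
        ultimately show ?thesis
          using le[OF \<sigma>[of N], of i] l(1)[of i] comp[OF \<sigma>[of N], of i] by simp
      qed
      then show ?thesis
        by (rule carrierI[OF l(1)])
    qed
    moreover have "P.converges \<sigma> l"
      unfolding P.converges_def
    proof (rule LIMSEQ_I)
      fix r :: real assume r: "0 < r"
      then obtain N where N: "\<forall>m\<ge>N. \<forall>i. cnorm (B i) (\<sigma> m i \<ominus>\<^bsub>B i\<^esub> l i) \<le> r / 2"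
        using lim[of "r / 2"] by auto
      have "cnorm ?P (\<sigma> m \<ominus>\<^bsub>?P\<^esub> l) \<le> r / 2" if "m \<ge> N" for m
        using N that by (intro least) (simp add: diff[OF \<sigma> lP])
      then have "norm (cnorm ?P (\<sigma> m \<ominus>\<^bsub>?P\<^esub> l) - 0) < r" if "m \<ge> N" for m
        using that r nonneg[OF P.minus_closed[OF \<sigma>[of m] lP]] by (smt (verit, best) field_sum_of_halves real_norm_def)
      then show "\<exists>N. \<forall>m\<ge>N. norm (cnorm ?P (\<sigma> m \<ominus>\<^bsub>?P\<^esub> l) - 0) < r"
        by blast
    qed
    ultimately show "\<exists>l\<in>carrier ?P. P.converges \<sigma> l"
      by blast
  qed
qed

definition zero_cstar :: "'a \<Rightarrow> 'a cstar" where
  "zero_cstar z = \<lparr>carrier = {z}, monoid.mult = (\<lambda>_ _. z), monoid.one = z, ring.zero = z, ring.add = (\<lambda>_ _. z),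
     module.smult = (\<lambda>_ _. z), star = (\<lambda>_. z), cnorm = (\<lambda>_. 0)\<rparr>"

lemma zero_cstar_simps:
  "carrier (zero_cstar z) = {z}" "x \<otimes>\<^bsub>zero_cstar z\<^esub> y = z" "\<zero>\<^bsub>zero_cstar z\<^esub> = z"
  "x \<oplus>\<^bsub>zero_cstar z\<^esub> y = z" "a \<odot>\<^bsub>zero_cstar z\<^esub> x = z" "star (zero_cstar z) x = z"
  "cnorm (zero_cstar z) x = 0"
  by (simp_all add: zero_cstar_def)

lemma cstar_algebra_zero: "cstar_algebra (zero_cstar z)"
proof -
  have "abelian_group (zero_cstar z)"
    by (intro abelian_groupI) (simp_all add: zero_cstar_simps)
  then interpret pre_cstar_algebra "zero_cstar z"
    by (intro pre_cstar_algebra.intro pre_cstar_algebra_axioms.intro) (simp_all add: zero_cstar_simps)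
  have "converges \<sigma> z" for \<sigma>
    by (simp add: converges_def zero_cstar_simps)
  then show ?thesis
    by (unfold_locales, unfold complete_iff, intro allI impI bexI[of _ z])
      (simp_all add: zero_cstar_simps)
qed

lemma cuntz_krieger_family_zero: "cuntz_krieger_family E (zero_cstar z) (\<lambda>_. z) (\<lambda>_. z)"
proof -
  interpret cstar_algebra "zero_cstar z"
    by (rule cstar_algebra_zero)
  have "(\<Oplus>\<^bsub>zero_cstar z\<^esub>e\<in>out_arcs E v. z) \<in> carrier (zero_cstar z)" for v
    by (rule finsum_closed) (simp add: zero_cstar_simps)
  then have "(\<Oplus>\<^bsub>zero_cstar z\<^esub>e\<in>out_arcs E v. z) = z" for v
    by (simp add: zero_cstar_simps)
  then show ?thesis
    by (simp add: cuntz_krieger_family_def projection_def partial_isometry_def zero_cstar_simps)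
qed

lemma star_hom_comp:
  assumes "star_hom A B f" "star_hom B C g"
  shows "star_hom A C (\<lambda>x. g (f x))"
  using assms by (simp add: star_hom_def)

lemma star_hom_component: "star_hom (product_cstar B) (B i) (\<lambda>f. f i)"
  by (simp add: star_hom_def product_cstar_simps)

lemma graph_cstar_exists:
  fixes E :: "('v, 'e) pre_digraph"
  assumes wf: "wf_digraph E"
  shows "\<exists>(A :: (real cstar \<times> ('v \<Rightarrow> real) \<times> ('e \<Rightarrow> real) \<Rightarrow> real) cstar) P S. is_graph_cstar E A P S"
proof -
  define valid :: "real cstar \<times> ('v \<Rightarrow> real) \<times> ('e \<Rightarrow> real) \<Rightarrow> bool" where
    "valid = (\<lambda>(B, Q, T). cstar_algebra B \<and> cuntz_krieger_family E B Q T)"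
  define fam where "fam i = (if valid i then i else (zero_cstar 0, \<lambda>_. 0, \<lambda>_. 0))" for i
  define B where "B i = fst (fam i)" for i
  define P where "P v i = fst (snd (fam i)) v" for v i
  define S where "S e i = snd (snd (fam i)) e" for e i
  have valid: "valid (fam i)" for i
    by (simp add: fam_def valid_def cstar_algebra_zero cuntz_krieger_family_zero)
  have B: "cstar_algebra (B i)" and CK: "cuntz_krieger_family E (B i) (\<lambda>v. P v i) (\<lambda>e. S e i)" for i
    using valid[of i] by (simp_all add: valid_def B_def P_def S_def case_prod_unfold)
  let ?A = "product_cstar B"
  interpret A: cstar_algebra ?A
    by (rule cstar_algebra_product[OF B])
  have hom: "star_hom ?A (B i) (\<lambda>f. f i)" for i
    by (rule star_hom_component)
  have pre: "pre_cstar_algebra (B i)" for i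
    using B by (rule cstar_algebra.axioms(1))
  have P: "P v \<in> carrier ?A" if "v \<in> verts E" for v
  proof -
    have "projection (B i) (P v i)" for i
      using CK[of i] that by (simp add: cuntz_krieger_family_def)
    then show ?thesis
      using pre_cstar_algebra.projection_cnorm[OF pre]
      unfolding product_cstar_simps projection_def by blast
  qed
  have S: "S e \<in> carrier ?A" if e: "e \<in> arcs E" for e
  proof -
    have "head E e \<in> verts E"
      using wf e by (simp add: wf_digraph_def)
    then have "S e i \<in> carrier (B i)" "projection (B i) (star (B i) (S e i) \<otimes>\<^bsub>B i\<^esub> S e i)" for i
      using CK[of i] e by (simp_all add: cuntz_krieger_family_def partial_isometry_def)
    then show ?thesis
      using pre_cstar_algebra.cnorm_le_one_if_projection[OF pre]
      unfolding product_cstar_simps by blast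
  qed
  have SS: "S e \<otimes>\<^bsub>?A\<^esub> star ?A (S e) \<in> carrier ?A" if "e \<in> out_arcs E v" for e v
    using S that by simp
  have sum: "(\<Oplus>\<^bsub>?A\<^esub>e\<in>out_arcs E v. S e \<otimes>\<^bsub>?A\<^esub> star ?A (S e)) i =
      (\<Oplus>\<^bsub>B i\<^esub>e\<in>out_arcs E v. S e i \<otimes>\<^bsub>B i\<^esub> star (B i) (S e i))" for v i
    using star_hom_finsum[OF hom A.pre_cstar_algebra_axioms pre,
        of "out_arcs E v" "\<lambda>e. S e \<otimes>\<^bsub>?A\<^esub> star ?A (S e)" i, OF SS]
    by (simp only: product_cstar_simps(2,6))
  have CK: "cuntz_krieger_family E ?A P S"
    unfolding cuntz_krieger_family_def projection_def partial_isometry_def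
  proof (intro conjI ballI impI)
    fix v assume v: "v \<in> tail E ` arcs E"
    show "P v = (\<Oplus>\<^bsub>?A\<^esub>e\<in>out_arcs E v. S e \<otimes>\<^bsub>?A\<^esub> star ?A (S e))"
      using CK v unfolding cuntz_krieger_family_def by (auto simp: fun_eq_iff sum)
  qed (use CK in \<open>simp_all add: P S\<close>, use CK in \<open>auto simp: product_cstar_simps(2-6) fun_eq_iff
        cuntz_krieger_family_def projection_def partial_isometry_def\<close>)
  have "P ` verts E \<union> S ` arcs E \<subseteq> carrier ?A"
    using P S by auto
  then obtain D where D: "closed_star_subalgebra ?A D" "P ` verts E \<union> S ` arcs E \<subseteq> D"
      "cstar_generated_by (?A\<lparr>carrier := D\<rparr>) (P ` verts E \<union> S ` arcs E)"
    using A.generated_subalgebra by blast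
  have "\<exists>f. star_hom (?A\<lparr>carrier := D\<rparr>) C f \<and> (\<forall>v\<in>verts E. f (P v) = Q v) \<and> (\<forall>e\<in>arcs E. f (S e) = T e)"
    if C: "cstar_algebra C" "cuntz_krieger_family E C Q T" for C :: "real cstar" and Q T
  proof -
    let ?i = "(C, Q, T)"
    have "fam ?i = ?i"
      using C by (simp add: fam_def valid_def)
    then have "B ?i = C" "\<And>v. P v ?i = Q v" "\<And>e. S e ?i = T e"
      by (simp_all add: B_def P_def S_def)
    moreover have "star_hom (?A\<lparr>carrier := D\<rparr>) (B ?i) (\<lambda>f. f ?i)"
      by (rule star_hom_comp[OF star_hom_subalgebra[OF D(1)] hom])
    ultimately show ?thesis
      by (intro exI[of _ "\<lambda>f. f ?i"]) simp
  qed
  then have "is_graph_cstar E (?A\<lparr>carrier := D\<rparr>) P S"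
    unfolding is_graph_cstar_def
    by (intro conjI A.subalgebra[OF D(1)] A.cuntz_krieger_family_subalgebra[OF D(1) CK D(2)] D(3)) simp
  then show ?thesis
    by blast
qed

subsection \<open>Universality for arbitrary types\<close>

context pre_cstar_algebra
begin

lemma smult_diff_right: "\<lbrakk>x \<in> carrier A; y \<in> carrier A\<rbrakk> \<Longrightarrow> a \<odot> (x \<ominus> y) = a \<odot> x \<ominus> a \<odot> y"
  by (simp add: diff_smult smult_add_right smult_smult mult.commute)

lemma smult_diff_left: "x \<in> carrier A \<Longrightarrow> (a - b) \<odot> x = a \<odot> x \<ominus> b \<odot> x"
  using smult_add_left[of x a "- b"] by (simp add: diff_smult smult_smult)

lemma mult_diff_right:
  "\<lbrakk>x \<in> carrier A; y \<in> carrier A; z \<in> carrier A\<rbrakk> \<Longrightarrow> z \<otimes> (x \<ominus> y) = z \<otimes> x \<ominus> z \<otimes> y"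
  by (simp add: diff_smult mult_add_right smult_mult_right)

lemma mult_diff_left:
  "\<lbrakk>x \<in> carrier A; y \<in> carrier A; z \<in> carrier A\<rbrakk> \<Longrightarrow> (x \<ominus> y) \<otimes> z = x \<otimes> z \<ominus> y \<otimes> z"
  by (simp add: diff_smult mult_add_left smult_mult_left)

lemma star_diff: "\<lbrakk>x \<in> carrier A; y \<in> carrier A\<rbrakk> \<Longrightarrow> star A (x \<ominus> y) = star A x \<ominus> star A y"
  by (simp add: diff_smult star_add star_smult)

lemma add_diff_cancel:
  assumes "x \<in> carrier A" "y \<in> carrier A" "z \<in> carrier A"
  shows "(x \<oplus> z) \<ominus> (y \<oplus> z) = x \<ominus> y" "(z \<oplus> x) \<ominus> (z \<oplus> y) = x \<ominus> y"
proof -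
  have "(x \<oplus> z) \<ominus> (y \<oplus> z) = x \<oplus> (z \<oplus> \<ominus> z) \<oplus> \<ominus> y"
    using assms by (simp add: minus_eq minus_add a_ac del: r_neg)
  then show "(x \<oplus> z) \<ominus> (y \<oplus> z) = x \<ominus> y"
    using assms by (simp add: minus_eq r_neg)
  then show "(z \<oplus> x) \<ominus> (z \<oplus> y) = x \<ominus> y"
    using assms by (simp add: a_comm)
qed

lemma cnorm_le_cnorm_diff:
  assumes "x \<in> carrier A" "l \<in> carrier A"
  shows "cnorm A x \<le> cnorm A (x \<ominus> l) + cnorm A l"
proof -
  have zero: "\<ominus> \<zero> = \<zero>"
    by (rule minus_equality) simp_all
  have "y \<ominus> \<zero> = y" if "y \<in> carrier A" for y
    using that by (simp only: minus_eq zero r_zero)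
  then show ?thesis
    using cnorm_diff_triangle[OF assms zero_closed] assms by simp
qed

lemma converges_add:
  assumes "\<And>n. \<sigma> n \<in> carrier A" "\<And>n. \<tau> n \<in> carrier A" "l \<in> carrier A" "m \<in> carrier A"
    and "converges \<sigma> l" "converges \<tau> m"
  shows "converges (\<lambda>n. \<sigma> n \<oplus> \<tau> n) (l \<oplus> m)"
proof (rule convergesI)
  fix n
  show "cnorm A ((\<sigma> n \<oplus> \<tau> n) \<ominus> (l \<oplus> m)) \<le> cnorm A (\<sigma> n \<ominus> l) + cnorm A (\<tau> n \<ominus> m)"
    using cnorm_diff_triangle[of "\<sigma> n \<oplus> \<tau> n" "l \<oplus> \<tau> n" "l \<oplus> m"] assms(1-4)
    by (simp add: add_diff_cancel)
  show "(\<lambda>n. cnorm A (\<sigma> n \<ominus> l) + cnorm A (\<tau> n \<ominus> m)) \<longlonglongrightarrow> 0"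
    using tendsto_add[OF assms(5,6)[unfolded converges_def]] by simp
qed (simp_all add: assms)

lemma converges_mult:
  assumes "\<And>n. \<sigma> n \<in> carrier A" "\<And>n. \<tau> n \<in> carrier A" "l \<in> carrier A" "m \<in> carrier A"
    and "converges \<sigma> l" "converges \<tau> m"
  shows "converges (\<lambda>n. \<sigma> n \<otimes> \<tau> n) (l \<otimes> m)"
proof (rule convergesI)
  fix n
  have "cnorm A (\<sigma> n \<otimes> (\<tau> n \<ominus> m)) \<le> cnorm A (\<sigma> n) * cnorm A (\<tau> n \<ominus> m)"
    using assms(1-4) by (intro cnorm_mult) auto
  also have "\<dots> \<le> (cnorm A (\<sigma> n \<ominus> l) + cnorm A l) * cnorm A (\<tau> n \<ominus> m)"
    using assms(1-4) by (intro mult_right_mono cnorm_le_cnorm_diff cnorm_nonneg) auto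
  moreover have "cnorm A ((\<sigma> n \<ominus> l) \<otimes> m) \<le> cnorm A (\<sigma> n \<ominus> l) * cnorm A m"
    using assms(1-4) by (intro cnorm_mult) auto
  ultimately show "cnorm A ((\<sigma> n \<otimes> \<tau> n) \<ominus> (l \<otimes> m)) \<le>
      (cnorm A (\<sigma> n \<ominus> l) + cnorm A l) * cnorm A (\<tau> n \<ominus> m) + cnorm A (\<sigma> n \<ominus> l) * cnorm A m"
    using cnorm_diff_triangle[of "\<sigma> n \<otimes> \<tau> n" "\<sigma> n \<otimes> m" "l \<otimes> m"] assms(1-4)
    by (simp add: mult_diff_left mult_diff_right)
  have "(\<lambda>n. (cnorm A (\<sigma> n \<ominus> l) + cnorm A l) * cnorm A (\<tau> n \<ominus> m) + cnorm A (\<sigma> n \<ominus> l) * cnorm A m)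
      \<longlonglongrightarrow> (0 + cnorm A l) * 0 + 0 * cnorm A m"
    using assms(5,6) unfolding converges_def by (intro tendsto_intros)
  then show "(\<lambda>n. (cnorm A (\<sigma> n \<ominus> l) + cnorm A l) * cnorm A (\<tau> n \<ominus> m) + cnorm A (\<sigma> n \<ominus> l) * cnorm A m)
      \<longlonglongrightarrow> 0"
    by simp
qed (simp_all add: assms)

lemma converges_star:
  assumes "\<And>n. \<sigma> n \<in> carrier A" "l \<in> carrier A" "converges \<sigma> l"
  shows "converges (\<lambda>n. star A (\<sigma> n)) (star A l)"
proof -
  have "cnorm A (star A (\<sigma> n) \<ominus> star A l) = cnorm A (\<sigma> n \<ominus> l)" for n
    by (simp only: star_diff[symmetric] cnorm_star minus_closed assms)
  then show ?thesis
    using assms(3) by (simp add: converges_def)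
qed

lemma converges_smult:
  assumes "\<And>n. \<sigma> n \<in> carrier A" "l \<in> carrier A" "converges \<sigma> l" "q \<longlonglongrightarrow> a"
  shows "converges (\<lambda>n. q n \<odot> \<sigma> n) (a \<odot> l)"
proof (rule convergesI)
  fix n
  show "cnorm A (q n \<odot> \<sigma> n \<ominus> a \<odot> l) \<le>
      cmod (q n) * cnorm A (\<sigma> n \<ominus> l) + cmod (q n - a) * cnorm A l"
    using cnorm_diff_triangle[of "q n \<odot> \<sigma> n" "q n \<odot> l" "a \<odot> l"] assms(1,2)
      cnorm_smult[of "\<sigma> n \<ominus> l" "q n"] cnorm_smult[of l "q n - a"]
    by (simp add: smult_diff_left smult_diff_right)
  have "(\<lambda>n. cmod (q n) * cnorm A (\<sigma> n \<ominus> l) + cmod (q n - a) * cnorm A l)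
      \<longlonglongrightarrow> cmod a * 0 + cmod (a - a) * cnorm A l"
    using assms(3,4) unfolding converges_def by (intro tendsto_intros)
  then show "(\<lambda>n. cmod (q n) * cnorm A (\<sigma> n \<ominus> l) + cmod (q n - a) * cnorm A l) \<longlonglongrightarrow> 0"
    by simp
qed (simp_all add: assms)

lemma converges_unique:
  assumes "\<And>n. \<sigma> n \<in> carrier A" "l \<in> carrier A" "m \<in> carrier A" "converges \<sigma> l" "converges \<sigma> m"
  shows "l = m"
proof -
  have "cnorm A (l \<ominus> m) \<le> cnorm A (\<sigma> n \<ominus> l) + cnorm A (\<sigma> n \<ominus> m)" for n
    using cnorm_diff_triangle[of l "\<sigma> n" m] assms(1-3) by (simp add: cnorm_diff_commute)
  moreover have "(\<lambda>n. cnorm A (\<sigma> n \<ominus> l) + cnorm A (\<sigma> n \<ominus> m)) \<longlonglongrightarrow> 0 + 0"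
    using assms(4,5) unfolding converges_def by (intro tendsto_intros)
  ultimately have "cnorm A (l \<ominus> m) \<le> 0 + 0"
    by (intro LIMSEQ_le_const) auto
  then show ?thesis
    using cnorm_nonneg[of "l \<ominus> m"] cnorm_eq_zero_iff[of "l \<ominus> m"] diff_eq_zero_iff[of l m] assms(2,3)
    by simp
qed

end

definition rational_complex :: "complex set" where
  "rational_complex = range (\<lambda>(a, b). Complex (of_rat a) (of_rat b))"

lemma rational_complex_dense: "\<exists>q. (\<forall>n::nat. q n \<in> rational_complex) \<and> q \<longlonglongrightarrow> a"
proof -
  have rat: "\<exists>r. \<bar>of_rat r - x\<bar> < inverse (real (Suc n))" for x :: real and n
  proof -
    obtain r where "x < of_rat r" "of_rat r < x + inverse (real (Suc n))"
      using of_rat_dense[of x "x + inverse (real (Suc n))"] by auto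
    then show ?thesis
      by (intro exI[of _ r]) simp
  qed
  have conv: "\<exists>r. (\<lambda>n. of_rat (r n)) \<longlonglongrightarrow> x" for x :: real
  proof -
    obtain r where r: "\<And>n. \<bar>of_rat (r n) - x\<bar> < inverse (real (Suc n))"
      using rat[of x] by metis
    have "(\<lambda>n. of_rat (r n) - x) \<longlonglongrightarrow> 0"
      by (rule LIMSEQ_norm_0) (use r in \<open>simp add: inverse_eq_divide\<close>)
    then show ?thesis
      using LIM_zero_iff by blast
  qed
  obtain r s where "(\<lambda>n. of_rat (r n)) \<longlonglongrightarrow> Re a" "(\<lambda>n. of_rat (s n)) \<longlonglongrightarrow> Im a"
    using conv by blast
  then have "(\<lambda>n. Complex (of_rat (r n)) (of_rat (s n))) \<longlonglongrightarrow> Complex (Re a) (Im a)"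
    by (rule tendsto_Complex)
  then show ?thesis
    by (intro exI[of _ "\<lambda>n. Complex (of_rat (r n)) (of_rat (s n))"])
      (auto simp: rational_complex_def image_iff)
qed

primrec rational_stage :: "'a cstar \<Rightarrow> 'a set \<Rightarrow> nat \<Rightarrow> 'a set" where
  "rational_stage A X 0 = insert \<zero>\<^bsub>A\<^esub> X"
| "rational_stage A X (Suc n) = (let R = rational_stage A X n in
     R \<union> (\<lambda>(x, y). x \<oplus>\<^bsub>A\<^esub> y) ` (R \<times> R) \<union> (\<lambda>(x, y). x \<otimes>\<^bsub>A\<^esub> y) ` (R \<times> R) \<union>
     star A ` R \<union> (\<lambda>(q, x). q \<odot>\<^bsub>A\<^esub> x) ` (rational_complex \<times> R))"

lemma countable_rational_stage: "countable X \<Longrightarrow> countable (rational_stage A X n)"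
  by (induction n) (auto simp: Let_def rational_complex_def)

lemma rational_stage_mono: "m \<le> n \<Longrightarrow> rational_stage A X m \<subseteq> rational_stage A X n"
  by (rule lift_Suc_mono_le[of "rational_stage A X"]) (auto simp: Let_def)

lemma rational_stage_ops:
  assumes "x \<in> rational_stage A X n"
  shows "y \<in> rational_stage A X n \<Longrightarrow> x \<oplus>\<^bsub>A\<^esub> y \<in> rational_stage A X (Suc n)"
    and "y \<in> rational_stage A X n \<Longrightarrow> x \<otimes>\<^bsub>A\<^esub> y \<in> rational_stage A X (Suc n)"
    and "star A x \<in> rational_stage A X (Suc n)"
    and "q \<in> rational_complex \<Longrightarrow> q \<odot>\<^bsub>A\<^esub> x \<in> rational_stage A X (Suc n)"
proof -
  let ?R = "rational_stage A X n"
  show "x \<oplus>\<^bsub>A\<^esub> y \<in> rational_stage A X (Suc n)" if "y \<in> ?R"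
  proof -
    have "x \<oplus>\<^bsub>A\<^esub> y \<in> (\<lambda>(x, y). x \<oplus>\<^bsub>A\<^esub> y) ` (?R \<times> ?R)"
      by (rule image_eqI[of _ _ "(x, y)"]) (simp_all add: assms that)
    then show ?thesis
      by (simp add: Let_def)
  qed
  show "x \<otimes>\<^bsub>A\<^esub> y \<in> rational_stage A X (Suc n)" if "y \<in> ?R"
  proof -
    have "x \<otimes>\<^bsub>A\<^esub> y \<in> (\<lambda>(x, y). x \<otimes>\<^bsub>A\<^esub> y) ` (?R \<times> ?R)"
      by (rule image_eqI[of _ _ "(x, y)"]) (simp_all add: assms that)
    then show ?thesis
      by (simp add: Let_def)
  qed
  show "star A x \<in> rational_stage A X (Suc n)"
    using assms by (simp add: Let_def)
  show "q \<odot>\<^bsub>A\<^esub> x \<in> rational_stage A X (Suc n)" if "q \<in> rational_complex"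
  proof -
    have "q \<odot>\<^bsub>A\<^esub> x \<in> (\<lambda>(q, x). q \<odot>\<^bsub>A\<^esub> x) ` (rational_complex \<times> ?R)"
      by (rule image_eqI[of _ _ "(q, x)"]) (simp_all add: assms that)
    then show ?thesis
      by (simp add: Let_def)
  qed
qed

lemma (in cstar_algebra) separable_subalgebra:
  assumes X: "countable X" "X \<subseteq> carrier A"
  shows "\<exists>D (g :: 'a \<Rightarrow> real). closed_star_subalgebra A D \<and> X \<subseteq> D \<and> inj_on g D"
proof -
  define R where "R = (\<Union>n. rational_stage A X n)"
  have "rational_stage A X n \<subseteq> carrier A" for n
    by (induction n) (use X(2) in \<open>auto simp: Let_def\<close>)
  then have RA: "x \<in> carrier A" if "x \<in> R" for x
    using that by (auto simp: R_def)
  have count: "countable R"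
    by (simp add: R_def countable_rational_stage X(1))
  have two: "\<exists>n. x \<in> rational_stage A X n \<and> y \<in> rational_stage A X n" if xy: "x \<in> R" "y \<in> R" for x y
  proof -
    obtain m n where "x \<in> rational_stage A X m" "y \<in> rational_stage A X n"
      using xy by (auto simp: R_def)
    then show ?thesis
      using rational_stage_mono[of m "max m n" A X] rational_stage_mono[of n "max m n" A X]
      by (intro exI[of _ "max m n"]) auto
  qed
  have Suc: "x \<in> R" if "x \<in> rational_stage A X (Suc n)" for x n
    using that unfolding R_def by blast
  have R: "X \<subseteq> R" "\<zero> \<in> R"
    using Suc[of _ 0] by (auto simp: Let_def)
  have R2: "x \<oplus> y \<in> R" "x \<otimes> y \<in> R" if xy: "x \<in> R" "y \<in> R" for x y
  proof -
    obtain n where "x \<in> rational_stage A X n" "y \<in> rational_stage A X n"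
      using two[OF xy] by blast
    then show "x \<oplus> y \<in> R" "x \<otimes> y \<in> R"
      by (blast intro: Suc rational_stage_ops(1,2))+
  qed
  have R1: "star A x \<in> R" "\<And>q. q \<in> rational_complex \<Longrightarrow> q \<odot> x \<in> R" if x: "x \<in> R" for x
  proof -
    obtain n where n: "x \<in> rational_stage A X n"
      using x by (auto simp: R_def)
    then show "star A x \<in> R"
      by (blast intro: Suc rational_stage_ops(3))
    show "q \<odot> x \<in> R" if "q \<in> rational_complex" for q
      using n that by (blast intro: Suc rational_stage_ops(4))
  qed
  define D where "D = {l \<in> carrier A. \<exists>\<sigma>. (\<forall>n. \<sigma> n \<in> R) \<and> converges \<sigma> l}"
  have DI: "l \<in> D" if "\<And>n. \<sigma> n \<in> R" "l \<in> carrier A" "converges \<sigma> l" for \<sigma> l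
    using that unfolding D_def by blast
  have DE: "\<exists>\<sigma>. (\<forall>n. \<sigma> n \<in> R) \<and> converges \<sigma> l" "l \<in> carrier A" if "l \<in> D" for l
    using that unfolding D_def by blast+
  have RD: "x \<in> D" if "x \<in> R" for x
    by (rule DI[of "\<lambda>_. x"]) (use that RA in \<open>simp_all add: converges_def r_neg minus_eq\<close>)
  have "closed_star_subalgebra A D"
  proof (rule closed_star_subalgebraI)
    show "D \<subseteq> carrier A"
      using DE(2) by blast
    show "\<zero> \<in> D"
      by (rule RD[OF R(2)])
  next
    fix l m assume lm: "l \<in> D" "m \<in> D"
    note c = DE(2)[OF lm(1)] DE(2)[OF lm(2)]
    obtain \<sigma> \<tau> where s: "\<And>n. \<sigma> n \<in> R" "converges \<sigma> l" "\<And>n. \<tau> n \<in> R" "converges \<tau> m"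
      using DE(1)[OF lm(1)] DE(1)[OF lm(2)] by blast
    show "l \<oplus> m \<in> D"
      by (rule DI[of "\<lambda>n. \<sigma> n \<oplus> \<tau> n"])
        (simp_all add: R2 s(1,3) c converges_add[OF RA[OF s(1)] RA[OF s(3)] c s(2,4)])
    show "l \<otimes> m \<in> D"
      by (rule DI[of "\<lambda>n. \<sigma> n \<otimes> \<tau> n"])
        (simp_all add: R2 s(1,3) c converges_mult[OF RA[OF s(1)] RA[OF s(3)] c s(2,4)])
  next
    fix l a assume l: "l \<in> D"
    note c = DE(2)[OF l]
    obtain \<sigma> where s: "\<And>n. \<sigma> n \<in> R" "converges \<sigma> l"
      using DE(1)[OF l] by blast
    obtain q where q: "\<And>n. q n \<in> rational_complex" "q \<longlonglongrightarrow> a"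
      using rational_complex_dense by blast
    show "a \<odot> l \<in> D"
      by (rule DI[of "\<lambda>n. q n \<odot> \<sigma> n"])
        (simp_all add: R1 s(1) q(1) c converges_smult[OF RA[OF s(1)] c s(2) q(2)])
    show "star A l \<in> D"
      by (rule DI[of "\<lambda>n. star A (\<sigma> n)"])
        (simp_all add: R1 s(1) c converges_star[OF RA[OF s(1)] c s(2)])
  next
    fix \<sigma> l assume \<sigma>: "\<And>n. \<sigma> n \<in> D" and l: "l \<in> carrier A" "converges \<sigma> l"
    note c = DE(2)[OF \<sigma>]
    have "\<exists>r\<in>R. cnorm A (r \<ominus> \<sigma> n) < inverse (real (Suc n))" for n
    proof -
      obtain \<tau> where t: "\<And>k. \<tau> k \<in> R" "converges \<tau> (\<sigma> n)"
        using DE(1)[OF \<sigma>[of n]] by blast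
      obtain k where "norm (cnorm A (\<tau> k \<ominus> \<sigma> n) - 0) < inverse (real (Suc n))"
        using LIMSEQ_D[OF t(2)[unfolded converges_def], of "inverse (real (Suc n))"] by auto
      then show ?thesis
        using t(1) by (intro bexI[of _ "\<tau> k"]) auto
    qed
    then obtain r where r: "\<And>n. r n \<in> R" "\<And>n. cnorm A (r n \<ominus> \<sigma> n) < inverse (real (Suc n))"
      by metis
    have "converges r l"
    proof (rule convergesI)
      show "cnorm A (r n \<ominus> l) \<le> inverse (real (Suc n)) + cnorm A (\<sigma> n \<ominus> l)" for n
        using cnorm_diff_triangle[OF RA[OF r(1)[of n]] c[of n] l(1)] r(2)[of n] by linarith
      show "(\<lambda>n. inverse (real (Suc n)) + cnorm A (\<sigma> n \<ominus> l)) \<longlonglongrightarrow> 0"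
        using tendsto_add[OF LIMSEQ_inverse_real_of_nat l(2)[unfolded converges_def]] by simp
    qed (simp_all add: RA r l)
    then show "l \<in> D"
      by (rule DI[OF r(1) l(1)])
  qed
  moreover have "X \<subseteq> D"
    using R(1) RD by blast
  moreover have "\<exists>g :: 'a \<Rightarrow> real. inj_on g D"
  proof -
    obtain h :: "nat set \<Rightarrow> real" where h: "inj h"
      using nat_sets_lepoll_reals01 unfolding lepoll_def by blast
    obtain s where s: "\<And>l n. l \<in> D \<Longrightarrow> s l n \<in> R" "\<And>l. l \<in> D \<Longrightarrow> converges (s l) l"
      using DE(1) by metis
    define c where "c l = {prod_encode (n, to_nat_on R (s l n)) |n. True}" for l
    have "inj_on c D"
    proof (rule inj_onI)
      fix l m assume lm: "l \<in> D" "m \<in> D" and eq: "c l = c m"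
      have "s l n = s m n" for n
      proof -
        have "prod_encode (n, to_nat_on R (s l n)) \<in> c m"
          unfolding eq[symmetric] by (auto simp: c_def)
        then have "to_nat_on R (s l n) = to_nat_on R (s m n)"
          by (auto simp: c_def prod_encode_eq)
        then show ?thesis
          using inj_on_to_nat_on[OF count] s(1) lm by (auto dest: inj_onD)
      qed
      then have "s l = s m"
        by (rule ext)
      then have "converges (s l) m"
        using s(2)[OF lm(2)] by simp
      then show "l = m"
        by (rule converges_unique[OF RA[OF s(1)[OF lm(1)]] DE(2)[OF lm(1)] DE(2)[OF lm(2)] s(2)[OF lm(1)]])
    qed
    then have "inj_on (\<lambda>l. h (c l)) D"
      using h by (auto simp: inj_on_def)
    then show ?thesis
      by blast
  qed
  ultimately show ?thesis
    by blast
qed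

definition transport_cstar :: "('a \<Rightarrow> 'b) \<Rightarrow> ('b \<Rightarrow> 'a) \<Rightarrow> 'a cstar \<Rightarrow> 'b cstar" where
  "transport_cstar g h A =
     \<lparr>carrier = g ` carrier A, monoid.mult = (\<lambda>x y. g (h x \<otimes>\<^bsub>A\<^esub> h y)), monoid.one = g \<one>\<^bsub>A\<^esub>,
      ring.zero = g \<zero>\<^bsub>A\<^esub>, ring.add = (\<lambda>x y. g (h x \<oplus>\<^bsub>A\<^esub> h y)),
      module.smult = (\<lambda>a x. g (a \<odot>\<^bsub>A\<^esub> h x)), star = (\<lambda>x. g (star A (h x))),
      cnorm = (\<lambda>x. cnorm A (h x))\<rparr>"

lemma (in cstar_algebra) transport:
  assumes h: "\<And>x. x \<in> carrier A \<Longrightarrow> h (g x) = x"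
  shows "cstar_algebra (transport_cstar g h A)"
    and "star_hom A (transport_cstar g h A) g" and "star_hom (transport_cstar g h A) A h"
proof -
  let ?T = "transport_cstar g h A"
  have s: "carrier ?T = g ` carrier A" "\<And>x y. x \<otimes>\<^bsub>?T\<^esub> y = g (h x \<otimes> h y)" "\<zero>\<^bsub>?T\<^esub> = g \<zero>"
      "\<And>x y. x \<oplus>\<^bsub>?T\<^esub> y = g (h x \<oplus> h y)" "\<And>a x. a \<odot>\<^bsub>?T\<^esub> x = g (a \<odot> h x)"
      "\<And>x. star ?T x = g (star A (h x))" "\<And>x. cnorm ?T x = cnorm A (h x)"
    by (simp_all add: transport_cstar_def)
  show "star_hom A ?T g" "star_hom ?T A h"
    by (auto simp: star_hom_def s h)
  have g_eq: "g x = g y \<longleftrightarrow> x = y" if "x \<in> carrier A" "y \<in> carrier A" for x y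
    using h that by metis
  have "\<exists>y\<in>carrier ?T. y \<oplus>\<^bsub>?T\<^esub> x = \<zero>\<^bsub>?T\<^esub>" if "x \<in> carrier ?T" for x
    using that by (auto simp: s h intro!: bexI[of _ "\<ominus> _"] l_neg arg_cong[of _ _ g])
  then have "abelian_group ?T"
    by (intro abelian_groupI) (auto simp: s h a_ac)
  then interpret T: pre_cstar_algebra ?T
    by (intro pre_cstar_algebra.intro pre_cstar_algebra_axioms.intro)
      (auto simp: s h g_eq smult_add_left smult_add_right smult_smult smult_one mult_assoc
        mult_add_left mult_add_right smult_mult_left smult_mult_right star_star star_add star_smult
        star_mult cnorm_nonneg cnorm_eq_zero_iff cnorm_add cnorm_smult cnorm_mult cstar_identity g_eq)
  have hT: "h x \<in> carrier A" "g (h x) = x" if "x \<in> carrier ?T" for x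
    using that by (auto simp: s h)
  have diff: "cnorm ?T (x \<ominus>\<^bsub>?T\<^esub> y) = cnorm A (h x \<ominus> h y)" if "x \<in> carrier ?T" "y \<in> carrier ?T" for x y
    using T.diff_smult[OF that] diff_smult[of "h x" "h y"] hT(1)[OF that(1)] hT(1)[OF that(2)]
    by (simp add: s h)
  show "cstar_algebra ?T"
  proof (unfold_locales, unfold T.complete_iff, intro allI impI)
    fix \<sigma> :: "nat \<Rightarrow> 'b"
    assume a: "(\<forall>n. \<sigma> n \<in> carrier ?T) \<and> (\<forall>\<epsilon>>0. \<exists>N. \<forall>m\<ge>N. \<forall>n\<ge>N. cnorm ?T (\<sigma> m \<ominus>\<^bsub>?T\<^esub> \<sigma> n) < \<epsilon>)"
    then have \<sigma>: "\<sigma> n \<in> carrier ?T" for n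
      by simp
    have "\<forall>\<epsilon>>0. \<exists>N. \<forall>m\<ge>N. \<forall>n\<ge>N. cnorm A (h (\<sigma> m) \<ominus> h (\<sigma> n)) < \<epsilon>"
      using a by (simp add: diff[OF \<sigma> \<sigma>])
    with complete[unfolded complete_iff, rule_format, of "\<lambda>n. h (\<sigma> n)"] hT(1)[OF \<sigma>]
    obtain l where l: "l \<in> carrier A" "converges (\<lambda>n. h (\<sigma> n)) l"
      by blast
    then have gl: "g l \<in> carrier ?T"
      by (simp add: s)
    have "T.converges \<sigma> (g l)"
      using l(2) unfolding converges_def T.converges_def diff[OF \<sigma> gl] h[OF l(1)] .
    then show "\<exists>l\<in>carrier ?T. T.converges \<sigma> l"
      using gl by blast
  qed
qed

lemma is_graph_cstar_universal:
  fixes E :: "('v, 'e) pre_digraph" and A :: "'a cstar" and B :: "'b cstar"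
  assumes E: "countable (verts E)" "countable (arcs E)"
    and A: "is_graph_cstar E A P S"
    and B: "cstar_algebra B" "cuntz_krieger_family E B Q T"
  shows "\<exists>f. star_hom A B f \<and> (\<forall>v\<in>verts E. f (P v) = Q v) \<and> (\<forall>e\<in>arcs E. f (S e) = T e)"
proof -
  interpret B: cstar_algebra B
    by fact
  let ?X = "Q ` verts E \<union> T ` arcs E"
  have "countable ?X" "?X \<subseteq> carrier B"
    using E B(2) by (auto simp: cuntz_krieger_family_def projection_def partial_isometry_def)
  from B.separable_subalgebra[OF this] obtain D and g :: "'b \<Rightarrow> real"
    where D: "closed_star_subalgebra B D" "?X \<subseteq> D" and g: "inj_on g D"
    by (elim exE conjE)
  let ?D = "B\<lparr>carrier := D\<rparr>" and ?h = "the_inv_into D g"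
  interpret D: cstar_algebra ?D
    by (rule B.subalgebra[OF D(1)])
  have h: "?h (g x) = x" if "x \<in> carrier ?D" for x
    using the_inv_into_f_f[OF g] that by simp
  let ?T = "transport_cstar g ?h ?D"
  have T: "cstar_algebra ?T" "star_hom ?D ?T g" "star_hom ?T ?D ?h"
    by (rule D.transport, erule h)+
  have pre: "pre_cstar_algebra ?T"
    using T(1) by (rule cstar_algebra.axioms(1))
  have CK: "cuntz_krieger_family E ?T (\<lambda>v. g (Q v)) (\<lambda>e. g (T e))"
    by (rule cuntz_krieger_family_map[OF T(2) D.pre_cstar_algebra_axioms pre
          B.cuntz_krieger_family_subalgebra[OF D(1) B(2) D(2)]])
  have "\<forall>(C :: real cstar) Q T. cstar_algebra C \<and> cuntz_krieger_family E C Q T \<longrightarrow>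
      (\<exists>f. star_hom A C f \<and> (\<forall>v\<in>verts E. f (P v) = Q v) \<and> (\<forall>e\<in>arcs E. f (S e) = T e))"
    using A unfolding is_graph_cstar_def by (elim conjE)
  from this[rule_format, OF conjI[OF T(1) CK]] obtain f
    where f: "star_hom A ?T f" "\<forall>v\<in>verts E. f (P v) = g (Q v)" "\<forall>e\<in>arcs E. f (S e) = g (T e)"
    by (elim exE conjE)
  have "star_hom A B (\<lambda>x. ?h (f x))"
    using star_hom_comp[OF star_hom_comp[OF f(1) T(3)] star_hom_subalgebra[OF D(1)]] .
  moreover have "\<forall>v\<in>verts E. ?h (f (P v)) = Q v" "\<forall>e\<in>arcs E. ?h (f (S e)) = T e"
    using f(2,3) h D(2) by (auto simp: image_subset_iff)
  ultimately show ?thesis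
    by blast
qed

end

theory Submission
  imports Defs
begin

text \<open>
  If \<open>C\<close> is the primitive transfer of \<open>B\<close> at \<open>p\<close> given by the index sets \<open>K\<close> and \<open>M\<close>, then a
  Cuntz-Krieger family \<open>S\<close> of \<open>B\<close> and a family \<open>T\<close> of \<open>C\<close> in the same algebra, with the same vertex
  projections, determine each other by
  \<open>T (p, m) = (\<Sum>j. S (p, j) S (m, j)\<^sup>*)\<close> and \<open>S (p, j) = T (p, m) T (m, j)\<close>, where \<open>m \<in> M\<close> and \<open>(m, j)\<close>
  is an arc; all other isometries agree. Hence the algebra universal for one matrix is
  universal for the other, and along a chain of primitive equivalences the algebra never changes.

  Two facts on C*-algebras are needed: *-homomorphisms are contractive (so that universal algebras
  are unique), and projections whose sum is a projection are orthogonal (so that the ranges of the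
  isometries at a vertex are). Both are derived from a square root of \<open>1 - a\<close> for self-adjoint
  \<open>a\<close> of norm less than one, without spectral theory.
\<close>

section \<open>Contractivity and orthogonality in C*-algebras\<close>

text \<open>The relations of a Cuntz-Krieger family do not say that arcs leaving one vertex have
  orthogonal ranges, only that their range projections add up to a projection. Without orthogonality
  the product \<open>T (p, m) S (m, j)\<close> would keep cross terms and not reduce to
  \<open>S (p, j)\<close>. Orthogonality and contractivity usually come from positivity; here norm
  estimates take its place, and since no unit is available, \<open>1 - y\<close> is only ever used
  multiplied by some element.

  Three features of a transfer make the two formulas inverse to each other. No row in
  \<open>M\<close> is zero, so \<open>P m\<close> is the sum of the ranges of the
  \<open>S (m, j)\<close>, and this sum is the initial projection of \<open>T (p, m)\<close>. The
  index \<open>p\<close> is not in \<open>M\<close>, so the rows in \<open>M\<close> are shared by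
  both matrices. Row \<open>p\<close> has entries 0 and 1, so each arc leaving \<open>p\<close>
  belongs to exactly one \<open>k\<close> or one \<open>m\<close>.

  Row-finiteness is assumed at one end of the chain only. It has to be carried along each link, and
  links are crossed in both directions.\<close>

context pre_cstar_algebra
begin

section \<open>Elementary identities, finite sums and a norm estimate\<close>

lemma smult_zero_right: "a \<odot> \<zero> = \<zero>"
  using smult_smult[of \<zero> a 0] by (simp add: smult_zero_left)

lemma mult_zero_left: "x \<in> carrier A \<Longrightarrow> \<zero> \<otimes> x = \<zero>"
  using smult_mult_left[of \<zero> x 0] by (simp add: smult_zero_left)

lemma mult_zero_right: "x \<in> carrier A \<Longrightarrow> x \<otimes> \<zero> = \<zero>"
  using smult_mult_right[of x \<zero> 0] by (simp add: smult_zero_left)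

lemma star_zero: "star A \<zero> = \<zero>"
  using star_smult[of \<zero> 0] by (simp add: smult_zero_left)

lemma finsum_mult_left:
  assumes "x \<in> carrier A" "\<And>i. i \<in> I \<Longrightarrow> f i \<in> carrier A"
  shows "x \<otimes> (\<Oplus>i\<in>I. f i) = (\<Oplus>i\<in>I. x \<otimes> f i)"
  using assms(2)
proof (induction I rule: infinite_finite_induct)
  case (insert i I)
  have "f \<in> I \<rightarrow> carrier A" "(\<lambda>i. x \<otimes> f i) \<in> I \<rightarrow> carrier A" "f i \<in> carrier A"
    using insert.prems assms(1) by auto
  then show ?case
    using insert assms(1) by (simp add: mult_add_right)
qed (simp_all add: mult_zero_right assms(1))

lemma finsum_mult_right:
  assumes "x \<in> carrier A" "\<And>i. i \<in> I \<Longrightarrow> f i \<in> carrier A"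
  shows "(\<Oplus>i\<in>I. f i) \<otimes> x = (\<Oplus>i\<in>I. f i \<otimes> x)"
  using assms(2)
proof (induction I rule: infinite_finite_induct)
  case (insert i I)
  have "f \<in> I \<rightarrow> carrier A" "(\<lambda>i. f i \<otimes> x) \<in> I \<rightarrow> carrier A" "f i \<in> carrier A"
    using insert.prems assms(1) by auto
  then show ?case
    using insert assms(1) by (simp add: mult_add_left)
qed (simp_all add: mult_zero_left assms(1))

lemma star_finsum:
  assumes "\<And>i. i \<in> I \<Longrightarrow> f i \<in> carrier A"
  shows "star A (\<Oplus>i\<in>I. f i) = (\<Oplus>i\<in>I. star A (f i))"
  using assms
proof (induction I rule: infinite_finite_induct)
  case (insert i I)
  have "f \<in> I \<rightarrow> carrier A" "(\<lambda>i. star A (f i)) \<in> I \<rightarrow> carrier A" "f i \<in> carrier A"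
    using insert.prems by auto
  then show ?case
    using insert by (simp add: star_add)
qed (simp_all add: star_zero)

lemma finsum_single:
  assumes "finite I" "i \<in> I" "\<And>j. j \<in> I \<Longrightarrow> f j \<in> carrier A"
    and "\<And>j. \<lbrakk>j \<in> I; j \<noteq> i\<rbrakk> \<Longrightarrow> f j = \<zero>"
  shows "(\<Oplus>j\<in>I. f j) = f i"
proof -
  have "(\<Oplus>j\<in>I. f j) = (\<Oplus>j\<in>I. if i = j then f j else \<zero>)"
    using assms by (intro finsum_cong') auto
  also have "\<dots> = f i"
    using assms by (intro add.finprod_singleton) auto
  finally show ?thesis .
qed

lemma closed_star_subalgebra_finsum:
  assumes "closed_star_subalgebra A D" "\<And>i. i \<in> I \<Longrightarrow> f i \<in> D"
  shows "(\<Oplus>i\<in>I. f i) \<in> D"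
  using assms(2)
proof (induction I rule: infinite_finite_induct)
  case (insert i I)
  have "f \<in> I \<rightarrow> carrier A" "f i \<in> carrier A"
    using insert.prems closed_star_subalgebraD(1)[OF assms(1)] by auto
  then show ?case
    using insert closed_star_subalgebraD(3)[OF assms(1)] by simp
qed (simp_all add: closed_star_subalgebraD(2)[OF assms(1)])

lemma cnorm_diff_le:
  assumes "x \<in> carrier A" "y \<in> carrier A"
  shows "cnorm A (x \<ominus> y) \<le> cnorm A x + cnorm A y"
  using cnorm_add[of x "\<ominus> y"] assms by (simp add: minus_eq cnorm_minus)

lemma cnorm_smult_of_real:
  "\<lbrakk>x \<in> carrier A; 0 \<le> r\<rbrakk> \<Longrightarrow> cnorm A (of_real r \<odot> x) = r * cnorm A x"
  by (simp add: cnorm_smult)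

lemma add_cancel_diff:
  assumes "x \<in> carrier A" "y \<in> carrier A" "z \<in> carrier A" "x \<oplus> y = z"
  shows "x = z \<ominus> y"
  using assms by (auto simp: minus_eq a_assoc r_neg)

text \<open>With \<open>u = x + \<i> y\<close> one has \<open>u\<^sup>* u = x\<^sup>2 + y\<^sup>2\<close> and \<open>2 x = u + u\<^sup>*\<close>.\<close>

lemma cnorm_le_sum_squares:
  assumes x: "x \<in> carrier A" "star A x = x" and y: "y \<in> carrier A" "star A y = y"
    and xy: "x \<otimes> y = y \<otimes> x"
  shows "(cnorm A x)\<^sup>2 \<le> cnorm A (x \<otimes> x \<oplus> y \<otimes> y)"
proof -
  define u where "u = x \<oplus> \<i> \<odot> y"
  have u: "u \<in> carrier A"
    by (simp add: u_def x y)
  have su: "star A u = x \<oplus> (- \<i>) \<odot> y"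
    by (simp add: u_def star_add star_smult x y)
  have cancel: "\<i> \<odot> z \<oplus> (- \<i>) \<odot> z = \<zero>" if "z \<in> carrier A" for z
    using smult_add_left[OF that, of \<i> "- \<i>"] smult_zero_left[OF that] by simp
  \<comment> \<open>Brings the two mixed terms side by side, where \<open>cancel\<close> removes
    them.\<close>
  have four: "(a \<oplus> b) \<oplus> (c \<oplus> d) = a \<oplus> (b \<oplus> c) \<oplus> d"
    if "a \<in> carrier A" "b \<in> carrier A" "c \<in> carrier A" "d \<in> carrier A" for a b c d
    using that by (simp add: a_ac)
  have "star A u \<otimes> u = (x \<otimes> x \<oplus> \<i> \<odot> (x \<otimes> y)) \<oplus> ((- \<i>) \<odot> (x \<otimes> y) \<oplus> y \<otimes> y)"
    unfolding su using x y xy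
    by (simp add: u_def mult_add_left mult_add_right smult_mult_left smult_mult_right smult_smult
        smult_one smult_add_right a_ac)
  also have "\<dots> = x \<otimes> x \<oplus> y \<otimes> y"
    using x y cancel[of "x \<otimes> y"] by (subst four) simp_all
  finally have uu: "(cnorm A u)\<^sup>2 = cnorm A (x \<otimes> x \<oplus> y \<otimes> y)"
    using cstar_identity[OF u] by simp
  have "u \<oplus> star A u = (x \<oplus> \<i> \<odot> y) \<oplus> ((- \<i>) \<odot> y \<oplus> x)"
    unfolding su using x y by (simp add: u_def a_comm[of x "(- \<i>) \<odot> y"])
  also have "\<dots> = x \<oplus> x"
    using x y cancel[of y] by (subst four) simp_all
  also have "\<dots> = 2 \<odot> x"
    using smult_add_left[of x 1 1] x by (simp add: smult_one)
  finally have "2 * cnorm A x = cnorm A (u \<oplus> star A u)"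
    using cnorm_smult[of x 2] x by simp
  also have "\<dots> \<le> 2 * cnorm A u"
    using cnorm_add[of u "star A u"] u by (simp add: cnorm_star)
  finally have "cnorm A x \<le> cnorm A u"
    by simp
  then show ?thesis
    unfolding uu[symmetric] by (rule power_mono) (rule cnorm_nonneg[OF x(1)])
qed

end

section \<open>Square roots and automatic contractivity\<close>

text \<open>
  The equation says \<open>(1 - y)\<^sup>2 = 1 - a\<close> in the unitization. It is solved by iterating the
  contraction \<open>y \<mapsto> (a + y\<^sup>2) / 2\<close> of a ball of radius less than one.
\<close>

lemma (in cstar_algebra) quasi_square_root:
  assumes a: "a \<in> carrier A" "star A a = a" "cnorm A a < 1"
  shows "\<exists>y\<in>carrier A. star A y = y \<and> y \<oplus> y = a \<oplus> y \<otimes> y \<and>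
    (\<forall>z\<in>carrier A. z \<otimes> a = a \<otimes> z \<longrightarrow> z \<otimes> y = y \<otimes> z)"
proof -
  define F where "F y = (1 / 2) \<odot> (a \<oplus> y \<otimes> y)" for y
  \<comment> \<open>The midpoint of \<open>cnorm A a\<close> and 1. As
    \<open>cnorm A a = 2 * \<rho> - 1\<close>, the ball of radius \<open>\<rho>\<close> is mapped
    into itself because \<open>\<rho> * \<rho> \<le> 1\<close>. On it \<open>F\<close> has Lipschitz
    constant \<open>\<rho>\<close>: the factor 1/2 offsets the two terms of
    \<open>x\<^sup>2 - y\<^sup>2 = x (x - y) + (x - y) y\<close>.\<close>
  define \<rho> where "\<rho> = (1 + cnorm A a) / 2"
  have \<rho>: "0 \<le> \<rho>" "\<rho> < 1" "(cnorm A a + \<rho> * \<rho>) / 2 \<le> \<rho>"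
  proof -
    show "0 \<le> \<rho>" "\<rho> < 1"
      using a cnorm_nonneg[OF a(1)] by (simp_all add: \<rho>_def)
    then have "\<rho> * \<rho> \<le> 1"
      by (simp add: mult_le_one)
    then show "(cnorm A a + \<rho> * \<rho>) / 2 \<le> \<rho>"
      by (simp add: \<rho>_def)
  qed
  define \<sigma> where "\<sigma> n = (F ^^ n) \<zero>" for n
  have \<sigma>_0: "\<sigma> 0 = \<zero>" and \<sigma>_Suc: "\<sigma> (Suc n) = F (\<sigma> n)" for n
    by (simp_all add: \<sigma>_def)
  have F: "F y \<in> carrier A" if "y \<in> carrier A" for y
    using that a by (simp add: F_def)
  have \<sigma>: "\<sigma> n \<in> carrier A" for n
    by (induction n) (simp_all add: \<sigma>_0 \<sigma>_Suc F)
  have ball: "cnorm A (\<sigma> n) \<le> \<rho>" for n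
  proof (induction n)
    case (Suc n)
    have "cnorm A (a \<oplus> \<sigma> n \<otimes> \<sigma> n) \<le> cnorm A a + \<rho> * \<rho>"
      using cnorm_add[of a "\<sigma> n \<otimes> \<sigma> n"] cnorm_mult[OF \<sigma>[of n] \<sigma>[of n]] a \<sigma>[of n]
        mult_mono[OF Suc Suc \<rho>(1) cnorm_nonneg[OF \<sigma>[of n]]] by simp
    then show ?case
      using \<rho>(3) a \<sigma>[of n] by (simp add: \<sigma>_Suc F_def cnorm_smult)
  qed (simp add: \<sigma>_0 \<rho>)
  have lip: "cnorm A (F x \<ominus> F y) \<le> \<rho> * cnorm A (x \<ominus> y)"
    if x: "x \<in> carrier A" "cnorm A x \<le> \<rho>" and y: "y \<in> carrier A" "cnorm A y \<le> \<rho>" for x y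
  proof -
    have "F x \<ominus> F y = (1 / 2) \<odot> (x \<otimes> x \<ominus> y \<otimes> y)"
      using x y a by (simp add: F_def smult_diff_right[symmetric] add_diff_cancel)
    then have "cnorm A (F x \<ominus> F y) = cnorm A (x \<otimes> x \<ominus> y \<otimes> y) / 2"
      using x y by (simp add: cnorm_smult)
    moreover have "cnorm A (x \<otimes> x \<ominus> y \<otimes> y) \<le> cnorm A (x \<otimes> (x \<ominus> y)) + cnorm A ((x \<ominus> y) \<otimes> y)"
      using cnorm_diff_triangle[of "x \<otimes> x" "x \<otimes> y" "y \<otimes> y"] x y
      by (simp add: mult_diff_left mult_diff_right)
    moreover have "cnorm A (x \<otimes> (x \<ominus> y)) \<le> \<rho> * cnorm A (x \<ominus> y)"
      using x y cnorm_nonneg[of "x \<ominus> y"] by (intro order_trans[OF cnorm_mult] mult_right_mono) auto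
    moreover have "cnorm A ((x \<ominus> y) \<otimes> y) \<le> cnorm A (x \<ominus> y) * \<rho>"
      using x y cnorm_nonneg[of "x \<ominus> y"] by (intro order_trans[OF cnorm_mult] mult_left_mono) auto
    ultimately show ?thesis
      by (simp add: mult.commute)
  qed
  \<comment> \<open>Going back \<open>n\<close> steps from the indices \<open>n + k\<close> and
    \<open>n\<close> ends at \<open>\<sigma> k\<close> and \<open>\<sigma> 0 = \<zero>\<close>,
    whose distance is at most the radius. This bounds all \<open>k\<close> at once and avoids a
    geometric series.\<close>
  have diff: "cnorm A (\<sigma> (n + k) \<ominus> \<sigma> n) \<le> \<rho> ^ n * \<rho>" for n k
  proof (induction n)
    case 0
    then show ?case
      using ball[of k] \<sigma>[of k] cnorm_diff_le[of "\<sigma> k" \<zero>] by (simp add: \<sigma>_0)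
  next
    case (Suc n)
    have "cnorm A (\<sigma> (Suc n + k) \<ominus> \<sigma> (Suc n)) \<le> \<rho> * cnorm A (\<sigma> (n + k) \<ominus> \<sigma> n)"
      using lip[OF \<sigma> ball \<sigma> ball] by (simp add: \<sigma>_Suc)
    also have "\<dots> \<le> \<rho> * (\<rho> ^ n * \<rho>)"
      by (rule mult_left_mono[OF Suc \<rho>(1)])
    finally show ?case
      by simp
  qed
  have "\<exists>N. \<forall>m\<ge>N. \<forall>n\<ge>N. cnorm A (\<sigma> m \<ominus> \<sigma> n) < \<epsilon>" if \<epsilon>: "0 < \<epsilon>" for \<epsilon>
  proof -
    have "(\<lambda>n. \<rho> ^ n * \<rho>) \<longlonglongrightarrow> 0 * \<rho>"
      using \<rho> by (intro tendsto_mult LIMSEQ_power_zero tendsto_const) simp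
    then obtain N where N: "\<And>n. n \<ge> N \<Longrightarrow> \<rho> ^ n * \<rho> < \<epsilon>"
      using order_tendstoD(2)[of _ "0 * \<rho>" sequentially \<epsilon>] \<epsilon> by (auto simp: eventually_sequentially)
    have le: "cnorm A (\<sigma> m \<ominus> \<sigma> n) < \<epsilon>" if "m \<ge> n" "n \<ge> N" for m n
      using diff[of n "m - n"] N[OF that(2)] that(1) by simp
    have "cnorm A (\<sigma> m \<ominus> \<sigma> n) < \<epsilon>" if "m \<ge> N" "n \<ge> N" for m n
      using le[of n m] le[of m n] that cnorm_diff_commute[OF \<sigma>[of m] \<sigma>[of n]] nat_le_linear[of m n]
      by auto
    then show ?thesis
      by blast
  qed
  then obtain y where y: "y \<in> carrier A" "converges \<sigma> y"
    using complete[unfolded complete_iff, rule_format, of \<sigma>] \<sigma> by blast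
  have "converges (\<lambda>n. a \<oplus> \<sigma> n \<otimes> \<sigma> n) (a \<oplus> y \<otimes> y)"
    using a \<sigma> y converges_mult[OF \<sigma> \<sigma> y(1) y(1) y(2) y(2)]
    by (intro converges_add) (simp_all add: converges_def minus_eq r_neg)
  then have "converges (\<lambda>n. F (\<sigma> n)) (F y)"
    unfolding F_def using a \<sigma> y by (intro converges_smult) simp_all
  moreover have "converges (\<lambda>n. F (\<sigma> n)) y"
    using y(2) unfolding \<sigma>_Suc[symmetric] converges_def by (rule LIMSEQ_Suc)
  ultimately have "F y = y"
    using F \<sigma> y converges_unique[of "\<lambda>n. F (\<sigma> n)"] by blast
  then have "y \<oplus> y = 2 \<odot> F y"
    using smult_add_left[OF y(1), of 1 1] y(1) by (simp add: smult_one)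
  then have "y \<oplus> y = a \<oplus> y \<otimes> y"
    using a y by (simp add: F_def smult_smult smult_one)
  moreover have "star A (\<sigma> n) = \<sigma> n" for n
    by (induction n) (simp_all add: \<sigma>_0 \<sigma>_Suc star_zero F_def star_smult star_add star_mult a \<sigma>)
  then have "star A y = y"
    using converges_star[OF \<sigma> y] converges_unique[OF \<sigma> _ y(1) _ y(2), of "star A y"] y(1) by simp
  \<comment> \<open>The iterates are polynomials in \<open>a\<close>, so whatever commutes with
    \<open>a\<close> commutes with them and with their limit. This clause replaces the functional
    calculus when several roots have to commute.\<close>
  moreover have "z \<otimes> y = y \<otimes> z" if z: "z \<in> carrier A" "z \<otimes> a = a \<otimes> z" for z
  proof -
    have eq: "z \<otimes> \<sigma> n = \<sigma> n \<otimes> z" for n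
    proof (induction n)
      case (Suc n)
      have "z \<otimes> (\<sigma> n \<otimes> \<sigma> n) = (\<sigma> n \<otimes> \<sigma> n) \<otimes> z"
        using Suc z \<sigma>[of n] by (metis mult_assoc)
      then show ?case
        using z \<sigma>[of n] a
        by (simp add: \<sigma>_Suc F_def smult_mult_left smult_mult_right mult_add_left mult_add_right)
    qed (simp add: \<sigma>_0 mult_zero_left mult_zero_right z)
    have const: "converges (\<lambda>_. z) z"
      using z by (simp add: converges_def minus_eq r_neg)
    have "converges (\<lambda>n. z \<otimes> \<sigma> n) (z \<otimes> y)" "converges (\<lambda>n. z \<otimes> \<sigma> n) (y \<otimes> z)"
      using converges_mult[OF z(1) \<sigma> z(1) y(1) const y(2)]
        converges_mult[OF \<sigma> z(1) y(1) z(1) y(2) const] by (simp_all add: eq)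
    then show ?thesis
      using converges_unique[of "\<lambda>n. z \<otimes> \<sigma> n"] z \<sigma> y by blast
  qed
  ultimately show ?thesis
    using y(1) by blast
qed

text \<open>
  For self-adjoint \<open>a\<close> of norm less than one choose \<open>y\<close> with \<open>a\<^sup>2 + (1 - y)\<^sup>2 = 1\<close>. This equation
  survives under \<open>f\<close> although no spectral theory and no continuity is available yet; multiplied by
  \<open>b\<^sup>2\<close>, where \<open>b = f a\<close>, it bounds \<open>b\<^sup>4\<close> by \<open>b\<^sup>2\<close>.
\<close>

lemma star_hom_contractive:
  assumes f: "star_hom A B f" and A: "cstar_algebra A" and B: "cstar_algebra B"
    and x: "x \<in> carrier A"
  shows "cnorm B (f x) \<le> cnorm A x"
proof -
  interpret A: cstar_algebra A by fact
  interpret B: cstar_algebra B by fact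
  note hom = star_homD[OF f]
  have unit: "cnorm B (f a) \<le> 1"
    if a: "a \<in> carrier A" "star A a = a" "cnorm A a < 1" for a
  proof -
    have lt: "cnorm A (a \<otimes>\<^bsub>A\<^esub> a) < 1"
      using a A.cnorm_mult[OF a(1) a(1)] mult_strict_mono'[OF a(3) a(3)] A.cnorm_nonneg[OF a(1)]
      by simp
    have aa: "a \<otimes>\<^bsub>A\<^esub> a \<in> carrier A" "star A (a \<otimes>\<^bsub>A\<^esub> a) = a \<otimes>\<^bsub>A\<^esub> a"
      using a by (simp_all add: A.star_mult)
    obtain y where y: "y \<in> carrier A" "star A y = y" "y \<oplus>\<^bsub>A\<^esub> y = a \<otimes>\<^bsub>A\<^esub> a \<oplus>\<^bsub>A\<^esub> y \<otimes>\<^bsub>A\<^esub> y"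
        "\<And>z. \<lbrakk>z \<in> carrier A; z \<otimes>\<^bsub>A\<^esub> (a \<otimes>\<^bsub>A\<^esub> a) = (a \<otimes>\<^bsub>A\<^esub> a) \<otimes>\<^bsub>A\<^esub> z\<rbrakk> \<Longrightarrow> z \<otimes>\<^bsub>A\<^esub> y = y \<otimes>\<^bsub>A\<^esub> z"
      using A.quasi_square_root[OF aa lt] by blast
    have ay: "a \<otimes>\<^bsub>A\<^esub> y = y \<otimes>\<^bsub>A\<^esub> a"
      using a by (intro y(4)) (simp_all add: A.mult_assoc)
    define b where "b = f a"
    define w where "w = f y"
    have b: "b \<in> carrier B" "star B b = b" and w: "w \<in> carrier B" "star B w = w"
      using a y(1,2) by (simp_all add: b_def w_def hom(1) flip: hom(5))
    have bw: "b \<otimes>\<^bsub>B\<^esub> w = w \<otimes>\<^bsub>B\<^esub> b"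
      using hom(4)[OF a(1) y(1)] hom(4)[OF y(1) a(1)] ay by (simp add: b_def w_def)
    have ww: "w \<oplus>\<^bsub>B\<^esub> w = b \<otimes>\<^bsub>B\<^esub> b \<oplus>\<^bsub>B\<^esub> w \<otimes>\<^bsub>B\<^esub> w"
      using arg_cong[OF y(3), of f] a y(1) by (simp add: hom b_def w_def)
    define c where "c = b \<otimes>\<^bsub>B\<^esub> b"
    \<comment> \<open>\<open>v\<close> is \<open>b (1 - w)\<close> written without a unit. From
      \<open>(1 - w)\<^sup>2 = 1 - c\<close> follows
      \<open>c\<^sup>2 + v\<^sup>2 = c (c + (1 - w)\<^sup>2) = c\<close>.\<close>
    define v where "v = b \<oplus>\<^bsub>B\<^esub> (- 1) \<odot>\<^bsub>B\<^esub> (w \<otimes>\<^bsub>B\<^esub> b)"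
    have c: "c \<in> carrier B" "star B c = c" and v: "v \<in> carrier B" "star B v = v"
      using b w bw by (simp_all add: c_def v_def B.star_mult B.star_add B.star_smult)
    have bwx: "b \<otimes>\<^bsub>B\<^esub> (w \<otimes>\<^bsub>B\<^esub> x) = w \<otimes>\<^bsub>B\<^esub> (b \<otimes>\<^bsub>B\<^esub> x)" if "x \<in> carrier B" for x
      using that b w bw by (simp flip: B.mult_assoc)
    have bwb: "b \<otimes>\<^bsub>B\<^esub> (w \<otimes>\<^bsub>B\<^esub> b) = w \<otimes>\<^bsub>B\<^esub> c" "w \<otimes>\<^bsub>B\<^esub> b \<otimes>\<^bsub>B\<^esub> b = w \<otimes>\<^bsub>B\<^esub> c"
      "w \<otimes>\<^bsub>B\<^esub> b \<otimes>\<^bsub>B\<^esub> (w \<otimes>\<^bsub>B\<^esub> b) = w \<otimes>\<^bsub>B\<^esub> (w \<otimes>\<^bsub>B\<^esub> c)"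
      using b w by (simp_all add: c_def B.mult_assoc bwx)
    have cv: "c \<otimes>\<^bsub>B\<^esub> v = v \<otimes>\<^bsub>B\<^esub> c"
    proof -
      have "c \<otimes>\<^bsub>B\<^esub> b = b \<otimes>\<^bsub>B\<^esub> c" "c \<otimes>\<^bsub>B\<^esub> (w \<otimes>\<^bsub>B\<^esub> b) = w \<otimes>\<^bsub>B\<^esub> b \<otimes>\<^bsub>B\<^esub> c"
        using b w by (simp_all add: c_def B.mult_assoc bwx)
      then show ?thesis
        using b c w
        by (simp add: v_def B.mult_add_left B.mult_add_right B.smult_mult_left B.smult_mult_right)
    qed
    let ?z = "w \<otimes>\<^bsub>B\<^esub> c"
    have z: "?z \<in> carrier B"
      using c w by simp
    have zz: "?z \<oplus>\<^bsub>B\<^esub> ?z = c \<otimes>\<^bsub>B\<^esub> c \<oplus>\<^bsub>B\<^esub> w \<otimes>\<^bsub>B\<^esub> ?z"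
      using arg_cong[OF ww, of "\<lambda>t. t \<otimes>\<^bsub>B\<^esub> c"] b c w
      by (simp add: B.mult_add_left B.mult_assoc flip: c_def)
    have "v \<otimes>\<^bsub>B\<^esub> v = (c \<oplus>\<^bsub>B\<^esub> (- 1) \<odot>\<^bsub>B\<^esub> ?z) \<oplus>\<^bsub>B\<^esub> ((- 1) \<odot>\<^bsub>B\<^esub> ?z \<oplus>\<^bsub>B\<^esub> w \<otimes>\<^bsub>B\<^esub> ?z)"
      unfolding v_def using b w c
      by (simp add: B.mult_add_left B.mult_add_right B.smult_mult_left B.smult_mult_right bwb
          B.smult_smult B.smult_one B.a_ac B.smult_add_right flip: c_def)
    then have "c \<otimes>\<^bsub>B\<^esub> c \<oplus>\<^bsub>B\<^esub> v \<otimes>\<^bsub>B\<^esub> v =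
        c \<oplus>\<^bsub>B\<^esub> ((- 1) \<odot>\<^bsub>B\<^esub> ?z \<oplus>\<^bsub>B\<^esub> (- 1) \<odot>\<^bsub>B\<^esub> ?z) \<oplus>\<^bsub>B\<^esub> (?z \<oplus>\<^bsub>B\<^esub> ?z)"
      unfolding zz using c w by (simp add: B.a_ac)
    also have "\<dots> = c"
      using c z by (simp add: B.smult_uminus B.a_assoc B.r_neg1 B.l_neg)
    finally have "(cnorm B c)\<^sup>2 \<le> cnorm B c"
      using B.cnorm_le_sum_squares[OF c v cv] by simp
    moreover have "cnorm B c = (cnorm B b)\<^sup>2"
      using B.cstar_identity[OF b(1)] b(2) by (simp add: c_def)
    moreover have "cnorm B c \<le> 1" if "(cnorm B c)\<^sup>2 \<le> cnorm B c"
    proof (rule ccontr)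
      assume "\<not> cnorm B c \<le> 1"
      then have "cnorm B c * 1 < cnorm B c * cnorm B c"
        by (intro mult_strict_left_mono) simp_all
      then show False
        using that by (simp add: power2_eq_square)
    qed
    ultimately have "(cnorm B b)\<^sup>2 \<le> 1"
      by simp
    then show ?thesis
      using B.cnorm_nonneg[OF b(1)] by (simp add: b_def abs_square_le_1)
  qed
  have self_adjoint: "cnorm B (f a) \<le> cnorm A a" if a: "a \<in> carrier A" "star A a = a" for a
  proof (rule field_le_epsilon)
    fix \<epsilon> :: real assume \<epsilon>: "0 < \<epsilon>"
    \<comment> \<open>Dividing by a number strictly above the norm meets the strict bound in
      \<open>unit\<close>, also when the norm is zero.\<close>
    define t where "t = cnorm A a + \<epsilon>"
    have t: "0 < t" "cnorm A a < t"
      using \<epsilon> A.cnorm_nonneg[OF a(1)] by (simp_all add: t_def)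
    have "cnorm B (f (complex_of_real (1 / t) \<odot>\<^bsub>A\<^esub> a)) \<le> 1"
      using a t by (intro unit) (simp_all add: A.star_smult A.cnorm_smult norm_divide)
    then show "cnorm B (f a) \<le> cnorm A a + \<epsilon>"
      using a t hom(1)[OF a(1)] by (simp add: hom(3) B.cnorm_smult norm_divide divide_le_eq flip: t_def)
  qed
  have "(cnorm B (f x))\<^sup>2 = cnorm B (f (star A x \<otimes>\<^bsub>A\<^esub> x))"
    using x hom B.cstar_identity[of "f x"] by simp
  also have "\<dots> \<le> cnorm A (star A x \<otimes>\<^bsub>A\<^esub> x)"
    using x by (intro self_adjoint) (simp_all add: A.star_mult A.star_star)
  also have "\<dots> = (cnorm A x)\<^sup>2"
    by (rule A.cstar_identity[OF x])
  finally show ?thesis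
    by (rule power2_le_imp_le) (rule A.cnorm_nonneg[OF x])
qed

lemma star_hom_converges:
  assumes f: "star_hom A B f" and A: "cstar_algebra A" and B: "cstar_algebra B"
    and \<sigma>: "\<And>n. \<sigma> n \<in> carrier A" "l \<in> carrier A" "pre_cstar_algebra.converges A \<sigma> l"
  shows "pre_cstar_algebra.converges B (\<lambda>n. f (\<sigma> n)) (f l)"
proof -
  interpret A: cstar_algebra A by fact
  interpret B: cstar_algebra B by fact
  show ?thesis
  proof (rule B.convergesI)
    fix n
    have "f (\<sigma> n) \<ominus>\<^bsub>B\<^esub> f l = f (\<sigma> n \<ominus>\<^bsub>A\<^esub> l)"
      using \<sigma> star_homD[OF f] by (simp add: A.diff_smult B.diff_smult)
    then show "cnorm B (f (\<sigma> n) \<ominus>\<^bsub>B\<^esub> f l) \<le> cnorm A (\<sigma> n \<ominus>\<^bsub>A\<^esub> l)"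
      using star_hom_contractive[OF f A B, of "\<sigma> n \<ominus>\<^bsub>A\<^esub> l"] \<sigma> by simp
  qed (use \<sigma> star_homD(1)[OF f] in \<open>simp_all add: A.converges_def\<close>)
qed

text \<open>The fixed points of \<open>f\<close> form a *-subalgebra, which is closed because a
  contractive linear map is continuous. Uniqueness of universal algebras needs contractivity for
  this.\<close>

lemma star_hom_identity_if_generated:
  assumes f: "star_hom A A f" and A: "cstar_algebra A" and X: "cstar_generated_by A X"
    and fX: "\<And>x. x \<in> X \<Longrightarrow> f x = x" and x: "x \<in> carrier A"
  shows "f x = x"
proof -
  interpret cstar_algebra A by fact
  note hom = star_homD[OF f]
  let ?D = "{x \<in> carrier A. f x = x}"
  have "closed_star_subalgebra A ?D"
  proof (rule closed_star_subalgebraI)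
    fix \<sigma> l assume \<sigma>: "\<And>n. \<sigma> n \<in> ?D" and l: "l \<in> carrier A" "converges \<sigma> l"
    have "converges \<sigma> (f l)"
      using star_hom_converges[OF f A A _ l] \<sigma> by simp
    then show "l \<in> ?D"
      using converges_unique[of \<sigma> l "f l"] \<sigma> l hom(1) by simp
  qed (simp_all add: hom star_hom_zero[OF f pre_cstar_algebra_axioms pre_cstar_algebra_axioms])
  moreover have "X \<subseteq> ?D"
    using X fX by (auto simp: cstar_generated_by_def)
  ultimately have "?D = carrier A"
    using X unfolding cstar_generated_by_def by blast
  then have "x \<in> ?D"
    using x by (simp only:)
  then show ?thesis
    by simp
qed

section \<open>Extremality of projections and orthogonality of summands\<close>

context cstar_algebra
begin

text \<open>
  For \<open>0 < t < 1\<close> there are commuting self-adjoint square roots \<open>s\<close>, \<open>s'\<close> of \<open>q - t (q + h)\<close> and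
  \<open>q - t (q - h)\<close>. Their squares add up to \<open>2 (1 - t) q\<close>, which forces \<open>h = 0\<close> as \<open>t \<rightarrow> 1\<close>.
\<close>

lemma projection_extreme:
  assumes q: "projection A q" and h: "h \<in> carrier A" "star A h = h" "q \<otimes> h = h" "h \<otimes> q = h"
    and le: "cnorm A (q \<oplus> h) \<le> 1" "cnorm A (q \<ominus> h) \<le> 1"
  shows "h = \<zero>"
proof -
  have q': "q \<in> carrier A" "star A q = q" "q \<otimes> q = q"
    using q by (simp_all add: projection_def)
  have bound: "t * cnorm A h \<le> 3 * (1 - t)" if t: "0 < t" "t < 1" for t :: real
  proof -
    define k where "k = (\<lambda>z. of_real t \<odot> (q \<oplus> z))"
    have k: "k z \<in> carrier A" "star A (k z) = k z" "q \<otimes> k z = k z" "k z \<otimes> q = k z"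
      if "z = h \<or> z = (- 1) \<odot> h" for z
      using that q' h
      by (auto simp: k_def star_smult star_add mult_add_left mult_add_right smult_mult_left
          smult_mult_right)
    have comm: "k h \<otimes> k ((- 1) \<odot> h) = k ((- 1) \<odot> h) \<otimes> k h"
      using q' h
      by (simp add: k_def mult_add_left mult_add_right smult_mult_left smult_mult_right
          smult_add_right smult_smult a_ac)
    have less: "cnorm A (k z) < 1" if "z = h \<or> z = (- 1) \<odot> h" for z
    proof -
      have "cnorm A (q \<oplus> z) \<le> 1"
        using that le h q' by (auto simp: diff_smult)
      moreover have "cnorm A (k z) = t * cnorm A (q \<oplus> z)"
        using that t h q' by (auto simp: k_def cnorm_smult)
      ultimately show ?thesis
        using t mult_left_mono[of "cnorm A (q \<oplus> z)" 1 t] by linarith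
    qed
    obtain y where y: "y \<in> carrier A" "star A y = y" "y \<oplus> y = k h \<oplus> y \<otimes> y"
      "\<And>z. \<lbrakk>z \<in> carrier A; z \<otimes> k h = k h \<otimes> z\<rbrakk> \<Longrightarrow> z \<otimes> y = y \<otimes> z"
      using quasi_square_root[OF k(1,2) less, OF disjI1[OF refl] disjI1[OF refl] disjI1[OF refl]] by blast
    obtain y' where y': "y' \<in> carrier A" "star A y' = y'" "y' \<oplus> y' = k ((- 1) \<odot> h) \<oplus> y' \<otimes> y'"
      "\<And>z. \<lbrakk>z \<in> carrier A; z \<otimes> k ((- 1) \<odot> h) = k ((- 1) \<odot> h) \<otimes> z\<rbrakk> \<Longrightarrow> z \<otimes> y' = y' \<otimes> z"
      using quasi_square_root[OF k(1,2) less, OF disjI2[OF refl] disjI2[OF refl] disjI2[OF refl]] by blast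
    have qy: "q \<otimes> y = y \<otimes> q" and qy': "q \<otimes> y' = y' \<otimes> q"
      using q' by (auto intro!: y(4) y'(4) simp: k)
    \<comment> \<open>The commutant clause is used twice: \<open>k ((- 1) \<odot> h)\<close>
      commutes with \<open>k h\<close>, hence with \<open>y\<close>; so \<open>y\<close> commutes
      with \<open>k ((- 1) \<odot> h)\<close>, hence with \<open>y'\<close>.\<close>
    have "k ((- 1) \<odot> h) \<otimes> y = y \<otimes> k ((- 1) \<odot> h)"
      by (rule y(4)) (simp_all add: k comm)
    then have yy': "y \<otimes> y' = y' \<otimes> y"
      by (intro y'(4)) (simp_all add: y)
    \<comment> \<open>\<open>s u\<close> is \<open>q (1 - u)\<close>, the root of
      \<open>1 - a\<close> cut down to the corner in which \<open>q\<close> is the unit.\<close>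
    define s where "s = (\<lambda>u. q \<oplus> (- 1) \<odot> (q \<otimes> u))"
    have s: "s u \<in> carrier A" "star A (s u) = s u" if "u \<in> carrier A" "star A u = u" "q \<otimes> u = u \<otimes> q" for u
      using that q' by (simp_all add: s_def star_add star_smult star_mult)
    have ss: "s u \<otimes> s u = q \<ominus> a"
      if u: "u \<in> carrier A" "q \<otimes> u = u \<otimes> q" "u \<oplus> u = a \<oplus> u \<otimes> u"
        and a: "a \<in> carrier A" "q \<otimes> a = a" for u a
    proof -
      have qu: "q \<otimes> u \<in> carrier A" "q \<otimes> (q \<otimes> u) = q \<otimes> u" "q \<otimes> u \<otimes> q = q \<otimes> u"
        "q \<otimes> u \<otimes> (q \<otimes> u) = q \<otimes> (u \<otimes> u)"
        using u q' by (metis mult_assoc mult_closed)+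
      have two: "q \<otimes> u \<oplus> q \<otimes> u = a \<oplus> q \<otimes> (u \<otimes> u)"
        using arg_cong[OF u(3), of "\<lambda>z. q \<otimes> z"] u(1) a q' by (simp add: mult_add_right)
      have "s u \<otimes> s u = (q \<oplus> (- 1) \<odot> (q \<otimes> u)) \<oplus> ((- 1) \<odot> (q \<otimes> u) \<oplus> q \<otimes> (u \<otimes> u))"
        unfolding s_def using q' qu u
        by (simp add: mult_add_left mult_add_right smult_mult_left smult_mult_right smult_smult
            smult_one smult_add_right a_ac)
      then have "s u \<otimes> s u \<oplus> a =
          q \<oplus> ((- 1) \<odot> (q \<otimes> u) \<oplus> (- 1) \<odot> (q \<otimes> u)) \<oplus> (q \<otimes> u \<oplus> q \<otimes> u)"
        unfolding two using q' qu(1) u a by (simp add: a_ac)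
      also have "\<dots> = q"
        using q' qu(1) by (simp add: smult_uminus a_assoc r_neg1 l_neg)
      finally show ?thesis
        using add_cancel_diff[of "s u \<otimes> s u" a q] q' qu u a by (simp add: s_def)
    qed
    note sy = s[OF y(1,2) qy] s[OF y'(1,2) qy']
    have comm': "s y \<otimes> s y' = s y' \<otimes> s y"
    proof -
      have "q \<otimes> (q \<otimes> y) = q \<otimes> y" "q \<otimes> (q \<otimes> y') = q \<otimes> y'" "q \<otimes> y \<otimes> q = q \<otimes> y" "q \<otimes> y' \<otimes> q = q \<otimes> y'"
        "q \<otimes> y \<otimes> (q \<otimes> y') = q \<otimes> y' \<otimes> (q \<otimes> y)"
        using y(1) y'(1) qy qy' q' yy' by (metis mult_assoc mult_closed)+
      then show ?thesis
        unfolding s_def using q' y(1) y'(1)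
        by (simp add: mult_add_left mult_add_right smult_mult_left smult_mult_right smult_smult
            smult_one smult_add_right a_ac)
    qed
    have "s y \<otimes> s y \<oplus> s y' \<otimes> s y' = of_real (2 * (1 - t)) \<odot> q"
    proof -
      have "s y \<otimes> s y \<oplus> s y' \<otimes> s y' = (q \<ominus> k h) \<oplus> (q \<ominus> k ((- 1) \<odot> h))"
        using ss[OF y(1) qy y(3)] ss[OF y'(1) qy' y'(3)] by (simp add: k)
      also have "\<dots> = (q \<oplus> q) \<oplus> ((of_real (- t) \<odot> q \<oplus> of_real (- t) \<odot> q)
          \<oplus> (of_real (- t) \<odot> h \<oplus> of_real t \<odot> h))"
        using q' h by (simp add: k_def diff_smult smult_add_right smult_smult a_ac)
      also have "of_real (- t) \<odot> h \<oplus> of_real t \<odot> h = \<zero>"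
        using smult_add_left[of h "of_real (- t)" "of_real t"] h by (simp add: smult_zero_left)
      also have "q \<oplus> q = (1 \<odot> q) \<oplus> (1 \<odot> q)"
        using q' by (simp add: smult_one)
      finally show ?thesis
        using q' by (simp add: algebra_simps flip: smult_add_left)
    qed
    then have "(cnorm A (s y))\<^sup>2 \<le> cnorm A (of_real (2 * (1 - t)) \<odot> q)"
      using cnorm_le_sum_squares[OF sy comm'] by simp
    also have "\<dots> = (2 * (1 - t)) * cnorm A q"
      using t by (intro cnorm_smult_of_real q'(1)) simp
    also have "\<dots> \<le> 2 * (1 - t)"
      using projection_cnorm[OF q] t by (simp add: mult_left_le)
    finally have "(cnorm A (s y))\<^sup>2 \<le> 2 * (1 - t)" .
    then have 1: "cnorm A (q \<ominus> k h) \<le> 2 * (1 - t)"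
      using ss[OF y(1) qy y(3)] cstar_identity[OF sy(1)] sy(2) by (simp add: k)
    \<comment> \<open>The 3 in \<open>bound\<close> arises here: \<open>(1 - t) q\<close>
      contributes 1 and \<open>q - k h\<close>, which is the square of \<open>s y\<close>,
      contributes 2.\<close>
    have "of_real t \<odot> h = (of_real (1 - t) \<odot> q) \<ominus> (q \<ominus> k h)"
    proof -
      have "(of_real (1 - t) \<odot> q) \<ominus> (q \<ominus> k h) =
          ((of_real (1 - t) \<odot> q \<oplus> (- 1) \<odot> q) \<oplus> of_real t \<odot> q) \<oplus> of_real t \<odot> h"
        using q' h by (simp add: k_def diff_smult smult_add_right smult_smult smult_one a_ac)
      also have "(of_real (1 - t) \<odot> q \<oplus> (- 1) \<odot> q) \<oplus> of_real t \<odot> q = \<zero>"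
        using q' by (simp add: smult_zero_left flip: smult_add_left)
      finally show ?thesis
        using h by simp
    qed
    moreover have "cnorm A ((of_real (1 - t) \<odot> q) \<ominus> (q \<ominus> k h)) \<le>
        cnorm A (of_real (1 - t) \<odot> q) + cnorm A (q \<ominus> k h)"
      using q' by (intro cnorm_diff_le) (simp_all add: k)
    moreover have "cnorm A (of_real (1 - t) \<odot> q) \<le> 1 - t"
      using cnorm_smult_of_real[OF q'(1), of "1 - t"] t projection_cnorm[OF q]
      by (simp add: mult_left_le del: of_real_diff)
    moreover have "cnorm A (of_real t \<odot> h) = t * cnorm A h"
      using cnorm_smult_of_real[OF h(1), of t] t by simp
    ultimately show ?thesis
      using 1 by simp
  qed
  have "cnorm A h \<le> 0"
  proof (rule field_le_epsilon)
    fix \<epsilon> :: real assume \<epsilon>: "0 < \<epsilon>"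
    define t where "t = 3 / (3 + \<epsilon>)"
    have "0 < t" "t < 1" "3 * (1 - t) = t * \<epsilon>"
      using \<epsilon> by (simp_all add: t_def field_simps)
    then have "t * cnorm A h \<le> t * \<epsilon>"
      using bound[of t] by simp
    then show "cnorm A h \<le> 0 + \<epsilon>"
      using \<open>0 < t\<close> by simp
  qed
  then show ?thesis
    using cnorm_nonneg[OF h(1)] cnorm_eq_zero_iff[OF h(1)] by simp
qed

text \<open>With a unit, \<open>q - q p q\<close> would be the compression of the projection
  \<open>1 - p\<close>. Without one, the reflection \<open>1 - 2 p\<close> is used in the form
  \<open>u = q - 2 p q\<close>: it satisfies \<open>u\<^sup>* u = q\<close>, so it has norm at most
  one, and \<open>2 (q - p q) = q + u\<close>.\<close>

lemma cnorm_projection_minus_compression: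
  assumes q: "projection A q" and p: "projection A p"
  shows "cnorm A (q \<ominus> q \<otimes> (p \<otimes> q)) \<le> 1"
proof -
  have q': "q \<in> carrier A" "star A q = q" "q \<otimes> q = q" and p': "p \<in> carrier A" "star A p = p" "p \<otimes> p = p"
    using q p by (simp_all add: projection_def)
  have pp: "p \<otimes> (p \<otimes> q) = p \<otimes> q"
    using p' q' by (metis mult_assoc)
  let ?u = "q \<oplus> (- 2) \<odot> (p \<otimes> q)"
  have u: "?u \<in> carrier A"
    using p' q' by simp
  have "star A ?u \<otimes> ?u = q \<oplus> (((- 2) \<odot> (q \<otimes> (p \<otimes> q)) \<oplus> (- 2) \<odot> (q \<otimes> (p \<otimes> q))) \<oplus> 4 \<odot> (q \<otimes> (p \<otimes> q)))"
    using p' q' pp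
    by (simp add: star_add star_smult star_mult mult_add_left mult_add_right smult_mult_left
        smult_mult_right smult_smult smult_add_right mult_assoc a_ac)
  also have "\<dots> = q"
    using p' q' by (simp add: smult_zero_left flip: smult_add_left)
  finally have "cnorm A ?u \<le> 1"
    using cnorm_le_one_if_projection[OF u] q by simp
  moreover have "2 \<odot> (q \<ominus> p \<otimes> q) = q \<oplus> ?u"
    using p' q' smult_add_left[of q 1 1]
    by (simp add: diff_smult smult_add_right smult_smult smult_one a_ac)
  ultimately have "2 * cnorm A (q \<ominus> p \<otimes> q) \<le> 2"
    using cnorm_add[OF q'(1) u] projection_cnorm[OF q] cnorm_smult[of "q \<ominus> p \<otimes> q" 2] p' q' by simp
  moreover have "q \<otimes> (q \<ominus> p \<otimes> q) = q \<ominus> q \<otimes> (p \<otimes> q)"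
    using p' q' by (simp add: mult_diff_right)
  then have "cnorm A (q \<ominus> q \<otimes> (p \<otimes> q)) \<le> cnorm A q * cnorm A (q \<ominus> p \<otimes> q)"
    using cnorm_mult[of q "q \<ominus> p \<otimes> q"] p' q' by simp
  moreover have "\<dots> \<le> 1 * cnorm A (q \<ominus> p \<otimes> q)"
    using projection_cnorm[OF q] p' q' by (intro mult_right_mono cnorm_nonneg) simp_all
  ultimately show ?thesis
    by simp
qed

text \<open>
  If \<open>r\<close> is the sum of the projections and \<open>q\<close> is one of them, then \<open>q r q\<close> has norm at most one
  and equals \<open>q\<close> plus positive elements, which have to vanish because \<open>q\<close> is extreme.
\<close>

lemma projections_orthogonal_if_sum_projection:
  assumes I: "finite I" "i \<in> I" "j \<in> I" "i \<noteq> j"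
    and p: "\<And>l. l \<in> I \<Longrightarrow> projection A (p l)" and sum: "projection A (\<Oplus>l\<in>I. p l)"
  shows "p i \<otimes> p j = \<zero>"
proof -
  define q where "q = p i"
  define h where "h l = q \<otimes> (p l \<otimes> q)" for l
  define L where "L = I - {i, j}"
  have q: "projection A q" "q \<in> carrier A" "star A q = q" "q \<otimes> q = q"
    using p[OF I(2)] by (simp_all add: q_def projection_def)
  have p': "p l \<in> carrier A" "star A (p l) = p l" "p l \<otimes> p l = p l" if "l \<in> I" for l
    using p[OF that] by (simp_all add: projection_def)
  have h: "h l \<in> carrier A" "star A (h l) = h l" "q \<otimes> h l = h l" "h l \<otimes> q = h l" if "l \<in> I" for l
  proof -
    show "h l \<in> carrier A" "star A (h l) = h l"
      using p'[OF that] q by (simp_all add: h_def star_mult mult_assoc)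
    show "q \<otimes> h l = h l" "h l \<otimes> q = h l"
      using p'[OF that] q unfolding h_def by (metis mult_assoc mult_closed)+
  qed
  \<comment> \<open>Stands in for the positivity of the unwanted summands. Each \<open>h l\<close>
    differs from \<open>q\<close> by an element of norm at most one, and \<open>R\<close> collects
    these differences.\<close>
  have "\<exists>R\<in>carrier A. cnorm A R \<le> card L' \<and> (\<Oplus>l\<in>L'. h l) \<oplus> R = of_nat (card L') \<odot> q"
    if "finite L'" "L' \<subseteq> I" for L'
    using that
  proof (induction L' rule: finite_induct)
    case (insert l L')
    then obtain R where R: "R \<in> carrier A" "cnorm A R \<le> card L'"
      "(\<Oplus>l\<in>L'. h l) \<oplus> R = of_nat (card L') \<odot> q"
      by auto
    have l: "l \<in> I" "h \<in> L' \<rightarrow> carrier A" "(\<Oplus>l\<in>L'. h l) \<in> carrier A"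
      using insert.prems h(1) by (auto intro!: finsum_closed)
    have "h l \<oplus> (q \<ominus> h l) = q"
      using l h(1)[of l] q by (simp add: minus_eq a_comm[of q] r_neg1 r_neg2)
    then have "(\<Oplus>l\<in>insert l L'. h l) \<oplus> (R \<oplus> (q \<ominus> h l)) = of_nat (card L') \<odot> q \<oplus> q"
      using insert.hyps l h(1)[of l] R(1) q unfolding R(3)[symmetric]
      by (simp add: a_assoc a_lcomm[of "h l"])
    also have "\<dots> = of_nat (card (insert l L')) \<odot> q"
      using insert.hyps q by (simp add: smult_add_left smult_one a_comm)
    finally show ?case
      using R cnorm_projection_minus_compression[OF q(1) p[OF l(1)]] l h(1)[of l] q insert.hyps
        cnorm_add[of R "q \<ominus> h l"]
      by (intro bexI[of _ "R \<oplus> (q \<ominus> h l)"]) (auto simp flip: h_def)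
  qed (auto intro!: bexI[of _ \<zero>] simp: smult_zero_left q)
  from this[of L] obtain R where R: "R \<in> carrier A" "cnorm A R \<le> card L"
      "(\<Oplus>l\<in>L. h l) \<oplus> R = of_nat (card L) \<odot> q"
    using I(1) by (auto simp: L_def)
  let ?S = "\<Oplus>l\<in>I. p l"
  have S: "?S \<in> carrier A"
    using sum by (simp add: projection_def)
  have "q \<otimes> (?S \<otimes> q) = (\<Oplus>l\<in>I. h l)"
    unfolding h_def using q p' by (simp add: finsum_mult_left finsum_mult_right)
  also have "(\<Oplus>l\<in>I. h l) = (\<Oplus>l\<in>insert i (insert j L). h l)"
    using I by (intro arg_cong[of _ _ "finsum A h"]) (auto simp: L_def)
  also have "\<dots> = h i \<oplus> (h j \<oplus> (\<Oplus>l\<in>L. h l))"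
    using I h(1) by (simp add: L_def Pi_def)
  also have "h i = q"
    using q by (simp add: h_def flip: q_def)
  finally have qSq: "q \<otimes> (?S \<otimes> q) = q \<oplus> (h j \<oplus> (\<Oplus>l\<in>L. h l))" .
  have hL: "(\<Oplus>l\<in>L. h l) \<in> carrier A"
    using h(1) by (auto simp: L_def intro!: finsum_closed)
  \<comment> \<open>Adding \<open>R\<close> to \<open>q r q\<close> turns the summands over
    \<open>L\<close> into \<open>card L\<close> copies of \<open>q\<close>, so what is left is
    \<open>n q + h j\<close>, of norm at most \<open>1 + card L\<close>. Division by
    \<open>n\<close> yields the upper bound required for extremality.\<close>
  define n where "n = 1 + real (card L)"
  have n: "0 < n" "1 \<le> n"
    by (simp_all add: n_def)
  have "q \<otimes> (?S \<otimes> q) \<oplus> R = (q \<oplus> of_nat (card L) \<odot> q) \<oplus> h j"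
    unfolding qSq R(3)[symmetric] using q R(1) h(1)[OF I(3)] hL by (simp add: a_ac)
  also have "q \<oplus> of_nat (card L) \<odot> q = of_real n \<odot> q"
    using q by (simp add: n_def smult_add_left smult_one)
  finally have sum_eq: "q \<otimes> (?S \<otimes> q) \<oplus> R = of_real n \<odot> q \<oplus> h j" .
  have "cnorm A (q \<otimes> (?S \<otimes> q)) \<le> 1 * (1 * 1)"
    using q S projection_cnorm[OF sum] projection_cnorm[OF q(1)]
    by (intro order_trans[OF cnorm_mult] mult_mono order_trans[OF cnorm_mult[of ?S q]])
      (auto simp: cnorm_nonneg)
  then have le: "cnorm A (of_real n \<odot> q \<oplus> h j) \<le> n"
    using cnorm_add[of "q \<otimes> (?S \<otimes> q)" R] R S q unfolding sum_eq by (simp add: n_def)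
  define g where "g = of_real (1 / n) \<odot> h j"
  have g: "g \<in> carrier A" "star A g = g" "q \<otimes> g = g" "g \<otimes> q = g"
    using h[OF I(3)] q by (simp_all add: g_def star_smult smult_mult_left smult_mult_right)
  have "q \<oplus> g = of_real (1 / n) \<odot> (of_real n \<odot> q \<oplus> h j)"
    using n q h(1)[OF I(3)] by (simp add: g_def smult_add_right smult_smult smult_one)
  then have "cnorm A (q \<oplus> g) = cnorm A (of_real n \<odot> q \<oplus> h j) / n"
    using n q h(1)[OF I(3)] cnorm_smult[of "of_real n \<odot> q \<oplus> h j" "of_real (1 / n)"]
    by (simp add: norm_divide)
  then have 1: "cnorm A (q \<oplus> g) \<le> 1"
    using le n by simp
  \<comment> \<open>The lower side is a convex combination of \<open>q\<close> and
    \<open>q - h j\<close>, both of norm at most one.\<close>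
  have "q \<ominus> g = of_real (1 - 1 / n) \<odot> q \<oplus> of_real (1 / n) \<odot> (q \<ominus> h j)"
  proof -
    have "of_real (1 - 1 / n) \<odot> q \<oplus> of_real (1 / n) \<odot> (q \<ominus> h j) =
        (of_real (1 - 1 / n) \<odot> q \<oplus> of_real (1 / n) \<odot> q) \<oplus> of_real (- 1 / n) \<odot> h j"
      using q h(1)[OF I(3)] by (simp add: diff_smult smult_add_right smult_smult a_assoc)
    also have "of_real (1 - 1 / n) \<odot> q \<oplus> of_real (1 / n) \<odot> q = q"
      using q by (simp add: smult_one flip: smult_add_left)
    finally show ?thesis
      using q h(1)[OF I(3)] by (simp add: g_def diff_smult smult_smult)
  qed
  then have "cnorm A (q \<ominus> g) \<le> cnorm A (of_real (1 - 1 / n) \<odot> q) + cnorm A (of_real (1 / n) \<odot> (q \<ominus> h j))"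
    using q h(1)[OF I(3)] by (simp add: cnorm_add del: of_real_diff of_real_divide)
  also have "\<dots> \<le> (1 - 1 / n) * 1 + (1 / n) * 1"
  proof (intro add_mono)
    show "cnorm A (of_real (1 - 1 / n) \<odot> q) \<le> (1 - 1 / n) * 1"
      using cnorm_smult[OF q(2), of "of_real (1 - 1 / n)"] n projection_cnorm[OF q(1)]
      by (simp add: mult_left_le del: of_real_diff of_real_divide)
    show "cnorm A (of_real (1 / n) \<odot> (q \<ominus> h j)) \<le> (1 / n) * 1"
      using cnorm_smult[of "q \<ominus> h j" "of_real (1 / n)"] n q h(1)[OF I(3)]
        cnorm_projection_minus_compression[OF q(1) p[OF I(3)]]
      by (simp add: divide_right_mono norm_divide flip: h_def)
  qed
  finally have 2: "cnorm A (q \<ominus> g) \<le> 1"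
    by simp
  have "g = \<zero>"
    by (rule projection_extreme[OF q(1) g 1 2])
  moreover have "h j = of_real n \<odot> g"
    using n h(1)[OF I(3)] by (simp add: g_def smult_smult smult_one)
  ultimately have "h j = \<zero>"
    by (simp add: smult_zero_right)
  \<comment> \<open>\<open>h j\<close> is \<open>x x\<^sup>*\<close> for \<open>x = q (p j)\<close>,
    so the C*-identity turns its vanishing into that of \<open>x\<close>.\<close>
  moreover have "q \<otimes> p j \<otimes> star A (q \<otimes> p j) = h j"
    using q p'[OF I(3)] unfolding h_def by (metis mult_assoc mult_closed star_mult)
  ultimately have "cnorm A (star A (q \<otimes> p j)) = 0"
    using cstar_identity[of "star A (q \<otimes> p j)"] q p'[OF I(3)] by (simp add: star_star)
  then show ?thesis
    using q p'[OF I(3)] by (simp add: cnorm_star cnorm_eq_zero_iff q_def)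
qed

end

section \<open>Uniqueness and graphs of matrices\<close>

text \<open>The homomorphisms given by the two universal properties match generators, so both
  composites fix a generating set. Countability of the graph extends the universal property to
  algebras of arbitrary type.\<close>

lemma graph_cstar_unique:
  assumes "countable (verts E)" "countable (arcs E)"
    and A: "is_graph_cstar E A P S" and B: "is_graph_cstar E B Q T"
  shows "cstar_isomorphic A B"
proof -
  have A': "cstar_algebra A" "cuntz_krieger_family E A P S" "cstar_generated_by A (P ` verts E \<union> S ` arcs E)"
    and B': "cstar_algebra B" "cuntz_krieger_family E B Q T" "cstar_generated_by B (Q ` verts E \<union> T ` arcs E)"
    using A B by (simp_all add: is_graph_cstar_def)
  obtain f where f: "star_hom A B f" "\<And>v. v \<in> verts E \<Longrightarrow> f (P v) = Q v" "\<And>e. e \<in> arcs E \<Longrightarrow> f (S e) = T e"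
    using is_graph_cstar_universal[OF assms(1,2) A B'(1,2)] by blast
  obtain g where g: "star_hom B A g" "\<And>v. v \<in> verts E \<Longrightarrow> g (Q v) = P v" "\<And>e. e \<in> arcs E \<Longrightarrow> g (T e) = S e"
    using is_graph_cstar_universal[OF assms(1,2) B A'(1,2)] by blast
  have gf: "g (f x) = x" if "x \<in> carrier A" for x
    by (rule star_hom_identity_if_generated[OF star_hom_comp[OF f(1) g(1)] A'(1,3) _ that])
      (auto simp: f g)
  have fg: "f (g x) = x" if "x \<in> carrier B" for x
    by (rule star_hom_identity_if_generated[OF star_hom_comp[OF g(1) f(1)] B'(1,3) _ that])
      (auto simp: f g)
  have "bij_betw f (carrier A) (carrier B)"
    by (rule bij_betw_byWitness[where f'=g]) (auto simp: gf fg star_homD(1)[OF f(1)] star_homD(1)[OF g(1)])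
  then show ?thesis
    unfolding cstar_isomorphic_def using f(1) by blast
qed

definition graph_isomorphism ::
    "('v \<Rightarrow> 'w) \<Rightarrow> ('e \<Rightarrow> 'f) \<Rightarrow> ('v, 'e) pre_digraph \<Rightarrow> ('w, 'f) pre_digraph \<Rightarrow> bool" where
  "graph_isomorphism \<phi> \<psi> E F \<longleftrightarrow>
     wf_digraph E \<and> wf_digraph F \<and>
     bij_betw \<phi> (verts E) (verts F) \<and> bij_betw \<psi> (arcs E) (arcs F) \<and>
     (\<forall>e\<in>arcs E. tail F (\<psi> e) = \<phi> (tail E e) \<and> head F (\<psi> e) = \<phi> (head E e))"

lemma graph_isomorphism_inverse:
  assumes "graph_isomorphism \<phi> \<psi> E F"
  shows "graph_isomorphism (inv_into (verts E) \<phi>) (inv_into (arcs E) \<psi>) F E"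
proof -
  have iso: "wf_digraph E" "wf_digraph F" "bij_betw \<phi> (verts E) (verts F)" "bij_betw \<psi> (arcs E) (arcs F)"
    "\<And>e. e \<in> arcs E \<Longrightarrow> tail F (\<psi> e) = \<phi> (tail E e)" "\<And>e. e \<in> arcs E \<Longrightarrow> head F (\<psi> e) = \<phi> (head E e)"
    using assms by (auto simp: graph_isomorphism_def)
  have "tail E (inv_into (arcs E) \<psi> e) = inv_into (verts E) \<phi> (tail F e) \<and>
      head E (inv_into (arcs E) \<psi> e) = inv_into (verts E) \<phi> (head F e)" if e: "e \<in> arcs F" for e
  proof -
    obtain d where d: "d \<in> arcs E" "e = \<psi> d"
      using iso(4) e by (auto simp: bij_betw_def)
    then have "tail E d \<in> verts E" "head E d \<in> verts E"
      using iso(1) by (simp_all add: wf_digraph_def)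
    then show ?thesis
      using d iso(3-6) by (simp add: bij_betw_def)
  qed
  then show ?thesis
    using iso by (simp add: graph_isomorphism_def bij_betw_inv_into)
qed

lemma (in pre_cstar_algebra) cuntz_krieger_family_isomorphism:
  assumes iso: "graph_isomorphism \<phi> \<psi> E F" and CK: "cuntz_krieger_family F A P S"
  shows "cuntz_krieger_family E A (\<lambda>v. P (\<phi> v)) (\<lambda>e. S (\<psi> e))"
proof -
  have \<phi>: "\<phi> v \<in> verts F" if "v \<in> verts E" for v
    using iso that by (auto simp: graph_isomorphism_def bij_betw_def)
  have \<phi>_eq: "\<phi> v = \<phi> w \<longleftrightarrow> v = w" if "v \<in> verts E" "w \<in> verts E" for v w
    using iso that by (auto simp: graph_isomorphism_def bij_betw_def inj_on_eq_iff)
  have \<psi>: "\<psi> e \<in> arcs F" "tail F (\<psi> e) = \<phi> (tail E e)" "head F (\<psi> e) = \<phi> (head E e)"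
    "tail E e \<in> verts E"
    if "e \<in> arcs E" for e
    using iso that by (auto simp: graph_isomorphism_def bij_betw_def wf_digraph_def)
  have out: "out_arcs F (\<phi> v) = \<psi> ` out_arcs E v" if v: "v \<in> verts E" for v
  proof
    show "\<psi> ` out_arcs E v \<subseteq> out_arcs F (\<phi> v)"
      using \<psi> by auto
    show "out_arcs F (\<phi> v) \<subseteq> \<psi> ` out_arcs E v"
    proof
      fix f assume f: "f \<in> out_arcs F (\<phi> v)"
      moreover have "arcs F = \<psi> ` arcs E"
        using iso by (simp add: graph_isomorphism_def bij_betw_def)
      ultimately obtain e where "e \<in> arcs E" "f = \<psi> e"
        by auto
      then show "f \<in> \<psi> ` out_arcs E v"
        using f \<psi>[of e] \<phi>_eq[of "tail E e" v] v by auto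
    qed
  qed
  have S: "S f \<in> carrier A" if "f \<in> arcs F" for f
    using CK that by (simp add: cuntz_krieger_family_def partial_isometry_def)
  have "P (\<phi> v) = (\<Oplus>e\<in>out_arcs E v. S (\<psi> e) \<otimes> star A (S (\<psi> e)))" if v: "v \<in> tail E ` arcs E" for v
  proof -
    have vE: "v \<in> verts E" and "\<phi> v \<in> tail F ` arcs F"
      using v \<psi> by (auto simp: image_iff) metis
    then have "P (\<phi> v) = (\<Oplus>f\<in>\<psi> ` out_arcs E v. S f \<otimes> star A (S f))"
      using CK unfolding cuntz_krieger_family_def out[OF vE, symmetric] by blast
    also have "\<dots> = (\<Oplus>e\<in>out_arcs E v. S (\<psi> e) \<otimes> star A (S (\<psi> e)))"
    proof (rule add.finprod_reindex)
      show "inj_on \<psi> (out_arcs E v)"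
        using iso by (auto simp: graph_isomorphism_def bij_betw_def intro: inj_on_subset)
    qed (use S \<psi> in auto)
    finally show ?thesis .
  qed
  then show ?thesis
    using CK \<phi> \<phi>_eq \<psi> by (simp add: cuntz_krieger_family_def)
qed

text \<open>The algebra is kept and only its generators are renamed; a family of \<open>E\<close> in
  a test algebra becomes one of \<open>F\<close> along the inverse isomorphism.\<close>

lemma is_graph_cstar_isomorphism:
  assumes iso: "graph_isomorphism \<phi> \<psi> E F" and A: "is_graph_cstar F A P S"
  shows "is_graph_cstar E A (\<lambda>v. P (\<phi> v)) (\<lambda>e. S (\<psi> e))"
proof -
  have A': "cstar_algebra A" "cuntz_krieger_family F A P S" "cstar_generated_by A (P ` verts F \<union> S ` arcs F)"
    "\<And>(B :: real cstar) Q T. cstar_algebra B \<Longrightarrow> cuntz_krieger_family F B Q T \<Longrightarrow>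
        (\<exists>f. star_hom A B f \<and> (\<forall>v\<in>verts F. f (P v) = Q v) \<and> (\<forall>e\<in>arcs F. f (S e) = T e))"
    using A by (simp_all add: is_graph_cstar_def)
  interpret cstar_algebra A
    by fact
  have bij: "bij_betw \<phi> (verts E) (verts F)" "bij_betw \<psi> (arcs E) (arcs F)"
    using iso by (simp_all add: graph_isomorphism_def)
  have "(\<lambda>v. P (\<phi> v)) ` verts E = P ` verts F" "(\<lambda>e. S (\<psi> e)) ` arcs E = S ` arcs F"
    unfolding bij_betw_imp_surj_on[OF bij(1), symmetric] bij_betw_imp_surj_on[OF bij(2), symmetric]
    by (simp_all add: image_image)
  moreover have "\<exists>f. star_hom A B f \<and> (\<forall>v\<in>verts E. f (P (\<phi> v)) = Q v) \<and> (\<forall>e\<in>arcs E. f (S (\<psi> e)) = T e)"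
    if B: "cstar_algebra B" "cuntz_krieger_family E B Q T" for B :: "real cstar" and Q T
  proof -
    have "cuntz_krieger_family F B (\<lambda>v. Q (inv_into (verts E) \<phi> v)) (\<lambda>e. T (inv_into (arcs E) \<psi> e))"
      using pre_cstar_algebra.cuntz_krieger_family_isomorphism[OF cstar_algebra.axioms(1)[OF B(1)]
          graph_isomorphism_inverse[OF iso] B(2)] .
    from A'(4)[OF B(1) this] obtain f where "star_hom A B f"
      "\<And>v. v \<in> verts F \<Longrightarrow> f (P v) = Q (inv_into (verts E) \<phi> v)"
      "\<And>e. e \<in> arcs F \<Longrightarrow> f (S e) = T (inv_into (arcs E) \<psi> e)"
      by blast
    then show ?thesis
      using bij_betw_apply[OF bij(1)] bij_betw_apply[OF bij(2)]
      by (intro exI[of _ f]) (simp add: bij_betw_inv_into_left[OF bij(1)] bij_betw_inv_into_left[OF bij(2)])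
  qed
  ultimately show ?thesis
    using A'(1,3) cuntz_krieger_family_isomorphism[OF iso A'(2)] by (simp add: is_graph_cstar_def)
qed

text \<open>The common frame for both directions of a transfer, free of explicit formulas.
  \<open>gen\<close> says that the old isometries can be recovered from the new ones;
  \<open>univ\<close> says that every test family of \<open>F\<close> comes from one of
  \<open>E\<close> in such a way that a homomorphism realizing the latter also realizes the
  former.\<close>

lemma is_graph_cstar_change_arcs:
  assumes A: "is_graph_cstar E A P S" and verts: "verts F = verts E"
    and CK: "cuntz_krieger_family F A P T"
    and gen: "\<And>D. \<lbrakk>closed_star_subalgebra A D; T ` arcs F \<subseteq> D\<rbrakk> \<Longrightarrow> S ` arcs E \<subseteq> D"
    and univ: "\<And>(B :: real cstar) Q U. \<lbrakk>cstar_algebra B; cuntz_krieger_family F B Q U\<rbrakk> \<Longrightarrow>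
      \<exists>V. cuntz_krieger_family E B Q V \<and>
        (\<forall>f. star_hom A B f \<and> (\<forall>e\<in>arcs E. f (S e) = V e) \<longrightarrow> (\<forall>e\<in>arcs F. f (T e) = U e))"
  shows "is_graph_cstar F A P T"
proof -
  have A': "cstar_algebra A" "cuntz_krieger_family E A P S" "cstar_generated_by A (P ` verts E \<union> S ` arcs E)"
    "\<And>(B :: real cstar) Q T. cstar_algebra B \<Longrightarrow> cuntz_krieger_family E B Q T \<Longrightarrow>
        (\<exists>f. star_hom A B f \<and> (\<forall>v\<in>verts E. f (P v) = Q v) \<and> (\<forall>e\<in>arcs E. f (S e) = T e))"
    using A by (simp_all add: is_graph_cstar_def)
  have "P ` verts F \<union> T ` arcs F \<subseteq> carrier A"
    using CK by (auto simp: cuntz_krieger_family_def projection_def partial_isometry_def)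
  then have "cstar_generated_by A (P ` verts F \<union> T ` arcs F)"
    using A'(3) gen unfolding cstar_generated_by_def verts by (meson le_sup_iff)
  moreover have "\<exists>f. star_hom A B f \<and> (\<forall>v\<in>verts F. f (P v) = Q v) \<and> (\<forall>e\<in>arcs F. f (T e) = U e)"
    if B: "cstar_algebra B" "cuntz_krieger_family F B Q U" for B :: "real cstar" and Q U
    using univ[OF B] A'(4)[OF B(1)] unfolding verts by metis
  ultimately show ?thesis
    using A'(1) CK by (simp add: is_graph_cstar_def)
qed

section \<open>Graphs of matrices and their Cuntz-Krieger families\<close>

definition row_support :: "'i set \<Rightarrow> ('i \<Rightarrow> 'i \<Rightarrow> nat) \<Rightarrow> 'i \<Rightarrow> 'i set" where
  "row_support I B i = {j \<in> I. B i j \<noteq> 0}"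

text \<open>Arcs are pairs of indices, so all matrices over \<open>I\<close> have graphs of one type
  and a chain of matrices can be followed by one predicate.\<close>

definition matrix_digraph :: "'i set \<Rightarrow> ('i \<Rightarrow> 'i \<Rightarrow> nat) \<Rightarrow> ('i, 'i \<times> 'i) pre_digraph" where
  "matrix_digraph I B = \<lparr>verts = I, arcs = Sigma I (row_support I B), tail = fst, head = snd\<rparr>"

lemma matrix_digraph_simps [simp]:
  "verts (matrix_digraph I B) = I" "arcs (matrix_digraph I B) = Sigma I (row_support I B)"
  "tail (matrix_digraph I B) = fst" "head (matrix_digraph I B) = snd"
  by (simp_all add: matrix_digraph_def)

lemma row_support_subset: "row_support I B i \<subseteq> I"
  by (auto simp: row_support_def)

lemma wf_matrix_digraph: "wf_digraph (matrix_digraph I B)"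
  using row_support_subset by (fastforce simp: wf_digraph_def)

lemma (in pre_cstar_algebra) cuntz_krieger_family_matrix_digraph:
  "cuntz_krieger_family (matrix_digraph I B) A P S \<longleftrightarrow>
     (\<forall>i\<in>I. projection A (P i)) \<and>
     (\<forall>i\<in>I. \<forall>j\<in>I. i \<noteq> j \<longrightarrow> P i \<otimes> P j = \<zero>) \<and>
     (\<forall>i\<in>I. \<forall>j\<in>row_support I B i.
        partial_isometry A (S (i, j)) \<and> star A (S (i, j)) \<otimes> S (i, j) = P j) \<and>
     (\<forall>i\<in>I. row_support I B i \<noteq> {} \<longrightarrow>
        P i = (\<Oplus>j\<in>row_support I B i. S (i, j) \<otimes> star A (S (i, j))))"
proof -
  have tails: "fst ` Sigma I (row_support I B) = {i \<in> I. row_support I B i \<noteq> {}}"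
    by force
  have out: "out_arcs (matrix_digraph I B) i = Pair i ` row_support I B i" if "i \<in> I" for i
    using that by (auto simp: out_arcs_def)
  have "(\<Oplus>e\<in>out_arcs (matrix_digraph I B) i. S e \<otimes> star A (S e)) =
      (\<Oplus>j\<in>row_support I B i. S (i, j) \<otimes> star A (S (i, j)))"
    if "i \<in> I" "\<And>j. j \<in> row_support I B i \<Longrightarrow> S (i, j) \<in> carrier A" for i
    unfolding out[OF that(1)] using that by (intro add.finprod_reindex) (auto intro: inj_onI)
  then have eq: "(P i = (\<Oplus>e\<in>out_arcs (matrix_digraph I B) i. S e \<otimes> star A (S e))) \<longleftrightarrow>
      P i = (\<Oplus>j\<in>row_support I B i. S (i, j) \<otimes> star A (S (i, j)))"
    if "\<forall>i\<in>I. \<forall>j\<in>row_support I B i. partial_isometry A (S (i, j))" "i \<in> I" for i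
    using that by (simp add: partial_isometry_def)
  show ?thesis
  \<comment> \<open>Reindexing the sums requires their terms to lie in the carrier. If some
    \<open>S (i, j)\<close> is not a partial isometry, both sides are false.\<close>
  proof (cases "\<forall>i\<in>I. \<forall>j\<in>row_support I B i. partial_isometry A (S (i, j))")
    case True
    then show ?thesis
      by (auto simp: cuntz_krieger_family_def tails eq[OF True])
  qed (auto simp: cuntz_krieger_family_def)
qed

context pre_cstar_algebra
begin

lemma finsum_UN_disjoint:
  assumes "finite J" "\<And>i. i \<in> J \<Longrightarrow> finite (X i)"
    and "\<And>i j. \<lbrakk>i \<in> J; j \<in> J; i \<noteq> j\<rbrakk> \<Longrightarrow> X i \<inter> X j = {}"
    and "\<And>i x. \<lbrakk>i \<in> J; x \<in> X i\<rbrakk> \<Longrightarrow> f x \<in> carrier A"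
  shows "(\<Oplus>x\<in>(\<Union>i\<in>J. X i). f x) = (\<Oplus>i\<in>J. \<Oplus>x\<in>X i. f x)"
  using assms
proof (induction J rule: finite_induct)
  case (insert i J)
  have IH: "(\<Oplus>x\<in>(\<Union>i\<in>J. X i). f x) = (\<Oplus>i\<in>J. \<Oplus>x\<in>X i. f x)"
    using insert.prems by (intro insert.IH) blast+
  have closed: "(\<Oplus>x\<in>X k. f x) \<in> carrier A" if "k \<in> insert i J" for k
    using insert.prems(3)[OF that] by (auto intro: finsum_closed)
  have "(\<Oplus>x\<in>X i \<union> (\<Union>i\<in>J. X i). f x) = (\<Oplus>x\<in>X i. f x) \<oplus> (\<Oplus>x\<in>(\<Union>i\<in>J. X i). f x)"
  proof (intro add.finprod_Un_disjoint)
    show "X i \<inter> (\<Union>i\<in>J. X i) = {}"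
      using insert.hyps insert.prems(2)[of i] by auto
    show "f \<in> X i \<rightarrow> carrier A" "f \<in> (\<Union>i\<in>J. X i) \<rightarrow> carrier A"
      using insert.prems(3) by blast+
  qed (use insert.hyps insert.prems(1) in auto)
  also have "\<dots> = (\<Oplus>i\<in>insert i J. \<Oplus>x\<in>X i. f x)"
    unfolding IH using insert.hyps closed by (intro finsum_insert[symmetric]) auto
  finally show ?case
    by simp
qed simp

text \<open>The sum carries the range of each \<open>t l\<close> to that of \<open>s l\<close>: as
  the ranges of the \<open>t l\<close> are orthogonal, multiplication by \<open>t j\<close> leaves
  only \<open>s j \<otimes> q j = s j\<close>. Exchanging \<open>s\<close> and \<open>t\<close>
  gives the same for the adjoint, and \<open>s = t\<close> gives the range projection.\<close>

lemma finsum_partial_isometries: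
  assumes L: "finite L"
    and s: "\<And>l. l \<in> L \<Longrightarrow> s l \<in> carrier A" "\<And>l. l \<in> L \<Longrightarrow> s l \<otimes> q l = s l"
    and t: "\<And>l. l \<in> L \<Longrightarrow> t l \<in> carrier A" "\<And>l. l \<in> L \<Longrightarrow> star A (t l) \<otimes> t l = q l"
    and orth: "\<And>k l. \<lbrakk>k \<in> L; l \<in> L; k \<noteq> l\<rbrakk> \<Longrightarrow> star A (t k) \<otimes> t l = \<zero>"
  shows "(\<Oplus>l\<in>L. s l \<otimes> star A (t l)) \<in> carrier A"
    and "star A (\<Oplus>l\<in>L. s l \<otimes> star A (t l)) = (\<Oplus>l\<in>L. t l \<otimes> star A (s l))"
    and "j \<in> L \<Longrightarrow> (\<Oplus>l\<in>L. s l \<otimes> star A (t l)) \<otimes> t j = s j"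
proof -
  show "(\<Oplus>l\<in>L. s l \<otimes> star A (t l)) \<in> carrier A"
    using s t by (auto intro!: finsum_closed)
  have "star A (\<Oplus>l\<in>L. s l \<otimes> star A (t l)) = (\<Oplus>l\<in>L. star A (s l \<otimes> star A (t l)))"
    using s t by (intro star_finsum) simp
  also have "\<dots> = (\<Oplus>l\<in>L. t l \<otimes> star A (s l))"
    using s t by (intro finsum_cong') (auto simp: star_mult star_star)
  finally show "star A (\<Oplus>l\<in>L. s l \<otimes> star A (t l)) = (\<Oplus>l\<in>L. t l \<otimes> star A (s l))" .
  assume j: "j \<in> L"
  have "(\<Oplus>l\<in>L. s l \<otimes> star A (t l)) \<otimes> t j = (\<Oplus>l\<in>L. s l \<otimes> star A (t l) \<otimes> t j)"
    using s t j by (intro finsum_mult_right) simp_all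
  also have "\<dots> = s j \<otimes> star A (t j) \<otimes> t j"
    using s t j by (intro finsum_single L) (simp_all add: mult_assoc orth mult_zero_right)
  also have "\<dots> = s j"
    using s t j by (simp add: mult_assoc)
  finally show "(\<Oplus>l\<in>L. s l \<otimes> star A (t l)) \<otimes> t j = s j" .
qed

end

locale matrix_cuntz_krieger_family = cstar_algebra A for A :: "'a cstar" (structure) +
  fixes I :: "'i set" and B :: "'i \<Rightarrow> 'i \<Rightarrow> nat" and P :: "'i \<Rightarrow> 'a" and S :: "'i \<times> 'i \<Rightarrow> 'a"
  assumes finite_row: "i \<in> I \<Longrightarrow> finite (row_support I B i)"
    and family: "cuntz_krieger_family (matrix_digraph I B) A P S"
begin

lemma projection_P: "i \<in> I \<Longrightarrow> projection A (P i)"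
  and P_orthogonal: "\<lbrakk>i \<in> I; j \<in> I; i \<noteq> j\<rbrakk> \<Longrightarrow> P i \<otimes> P j = \<zero>"
  and partial_isometry_S: "\<lbrakk>i \<in> I; j \<in> row_support I B i\<rbrakk> \<Longrightarrow> partial_isometry A (S (i, j))"
  and star_S_S: "\<lbrakk>i \<in> I; j \<in> row_support I B i\<rbrakk> \<Longrightarrow> star A (S (i, j)) \<otimes> S (i, j) = P j"
  and P_eq_finsum: "\<lbrakk>i \<in> I; j \<in> row_support I B i\<rbrakk> \<Longrightarrow>
        P i = (\<Oplus>j\<in>row_support I B i. S (i, j) \<otimes> star A (S (i, j)))"
  using family by (auto simp: cuntz_krieger_family_matrix_digraph)

lemma P_closed [simp]: "i \<in> I \<Longrightarrow> P i \<in> carrier A"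
  using projection_P by (simp add: projection_def)

lemma S_closed [simp]: "\<lbrakk>i \<in> I; j \<in> row_support I B i\<rbrakk> \<Longrightarrow> S (i, j) \<in> carrier A"
  using partial_isometry_S by (simp add: partial_isometry_def)

lemma S_star_S_S: "\<lbrakk>i \<in> I; j \<in> row_support I B i\<rbrakk> \<Longrightarrow> S (i, j) \<otimes> star A (S (i, j)) \<otimes> S (i, j) = S (i, j)"
  using partial_isometry_S by (simp add: partial_isometry_def)

lemma S_P: "\<lbrakk>i \<in> I; j \<in> row_support I B i\<rbrakk> \<Longrightarrow> S (i, j) \<otimes> P j = S (i, j)"
  using S_star_S_S[of i j] by (simp add: mult_assoc star_S_S)

text \<open>The range projections of the arcs leaving \<open>i\<close> sum to the projection
  \<open>P i\<close>, hence are pairwise orthogonal.\<close>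

lemma star_S_S_orthogonal:
  assumes i: "i \<in> I" and j: "j \<in> row_support I B i" and k: "k \<in> row_support I B i" and "j \<noteq> k"
  shows "star A (S (i, j)) \<otimes> S (i, k) = \<zero>"
proof -
  let ?p = "\<lambda>l. S (i, l) \<otimes> star A (S (i, l))"
  have "projection A (?p l)" if "l \<in> row_support I B i" for l
  proof -
    have "?p l \<otimes> ?p l = (S (i, l) \<otimes> star A (S (i, l)) \<otimes> S (i, l)) \<otimes> star A (S (i, l))"
      using i that by (simp add: mult_assoc)
    then show ?thesis
      using i that by (simp add: projection_def star_mult star_star S_star_S_S)
  qed
  moreover have "projection A (\<Oplus>l\<in>row_support I B i. ?p l)"
    using P_eq_finsum[OF i j] projection_P[OF i] by simp
  ultimately have "?p j \<otimes> ?p k = \<zero>"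
    by (rule projections_orthogonal_if_sum_projection[OF finite_row[OF i] j k \<open>j \<noteq> k\<close>])
  \<comment> \<open>Sandwiching undoes the passage to range projections, since
    \<open>S S\<^sup>* S = S\<close> absorbs them on both sides.\<close>
  then have "star A (S (i, j)) \<otimes> (?p j \<otimes> ?p k) \<otimes> S (i, k) = \<zero>"
    using i j k by (simp add: mult_zero_left mult_zero_right)
  moreover have "star A (S (i, j)) \<otimes> (?p j \<otimes> ?p k) \<otimes> S (i, k) =
      star A (S (i, j) \<otimes> star A (S (i, j)) \<otimes> S (i, j)) \<otimes> (S (i, k) \<otimes> star A (S (i, k)) \<otimes> S (i, k))"
    using i j k by (simp add: mult_assoc star_mult star_star)
  ultimately show ?thesis
    using i j k by (simp add: S_star_S_S)
qed

lemma P_S: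
  assumes i: "i \<in> I" and j: "j \<in> row_support I B i"
  shows "P i \<otimes> S (i, j) = S (i, j)"
proof -
  have "P i \<otimes> S (i, j) = (\<Oplus>l\<in>row_support I B i. S (i, l) \<otimes> star A (S (i, l))) \<otimes> S (i, j)"
    by (subst P_eq_finsum[OF i j]) (rule refl)
  also have "\<dots> = S (i, j)"
    using i j by (intro finsum_partial_isometries(3)[where q=P])
      (auto simp: finite_row S_P star_S_S star_S_S_orthogonal)
  finally show ?thesis .
qed

end

section \<open>Primitive transfers\<close>

text \<open>The row equation read as a disjoint union of supports. Loops at \<open>p\<close> are
  allowed: \<open>p\<close> may lie in \<open>K\<close> or in the support of a row in
  \<open>M\<close>.\<close>

locale support_transfer =
  fixes I :: "'i set" and p :: 'i and B C :: "'i \<Rightarrow> 'i \<Rightarrow> nat" and K M :: "'i set"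
  assumes finite_row: "i \<in> I \<Longrightarrow> finite (row_support I B i)"
    and p: "p \<in> I" and finite: "finite K" "finite M" and sub: "K \<subseteq> I" "M \<subseteq> I"
    and disjoint: "K \<inter> M = {}" and p_notin: "p \<notin> M"
    and nonempty: "m \<in> M \<Longrightarrow> row_support I B m \<noteq> {}" and nonempty_p: "row_support I B p \<noteq> {}"
    and support_p: "row_support I B p = K \<union> (\<Union>m\<in>M. row_support I B m)"
    and disjoint_K: "m \<in> M \<Longrightarrow> K \<inter> row_support I B m = {}"
    and disjoint_M: "\<lbrakk>m \<in> M; n \<in> M; m \<noteq> n\<rbrakk> \<Longrightarrow> row_support I B m \<inter> row_support I B n = {}"
    and support'_p: "row_support I C p = K \<union> M"
    and support': "\<lbrakk>i \<in> I; i \<noteq> p\<rbrakk> \<Longrightarrow> row_support I C i = row_support I B i"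
begin

lemma finite_row': "i \<in> I \<Longrightarrow> finite (row_support I C i)"
  using finite finite_row[of i] support'_p support'[of i] by (cases "i = p") simp_all

lemma M_in: "m \<in> M \<Longrightarrow> m \<in> I" and M_neq: "m \<in> M \<Longrightarrow> m \<noteq> p"
  using sub p_notin by auto

lemma support'_M: "m \<in> M \<Longrightarrow> row_support I C m = row_support I B m"
  using support' M_in M_neq by blast

text \<open>The vertex through which the path replacing the arc \<open>(p, j)\<close> runs. It is
  unique by \<open>disjoint_M\<close>; if no row in \<open>M\<close> contains \<open>j\<close>, the
  value is arbitrary.\<close>

definition middle :: "'i \<Rightarrow> 'i" where
  "middle j = (SOME m. m \<in> M \<and> j \<in> row_support I B m)"

lemma middle_eq:
  assumes "m \<in> M" "j \<in> row_support I B m"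
  shows "middle j = m"
  unfolding middle_def
proof (rule some_equality)
  show "n = m" if "n \<in> M \<and> j \<in> row_support I B n" for n
    using that assms disjoint_M[of n m] by blast
qed (use assms in simp)

text \<open>
  The arc \<open>(p, m)\<close> of the new graph replaces the paths from \<open>p\<close> through \<open>m\<close>, so the two families
  are related by \<open>S (p, j) = T (p, m) T (m, j)\<close> for every arc \<open>(m, j)\<close>.
\<close>

definition transfer_isometries :: "'a cstar \<Rightarrow> ('i \<times> 'i \<Rightarrow> 'a) \<Rightarrow> 'i \<times> 'i \<Rightarrow> 'a" where
  "transfer_isometries A S = (\<lambda>(i, j). if i = p \<and> j \<in> M
     then \<Oplus>\<^bsub>A\<^esub>l\<in>row_support I B j. S (p, l) \<otimes>\<^bsub>A\<^esub> star A (S (j, l)) else S (i, j))"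

text \<open>The test is \<open>j \<notin> K\<close>, not \<open>j \<in> M\<close>: an index in
  \<open>M\<close> may lie in the support of a row in \<open>M\<close>, and then
  \<open>(p, j)\<close> is an arc of both graphs, but in the old one it stands for a path through
  \<open>middle j\<close>.\<close>

definition untransfer_isometries :: "'a cstar \<Rightarrow> ('i \<times> 'i \<Rightarrow> 'a) \<Rightarrow> 'i \<times> 'i \<Rightarrow> 'a" where
  "untransfer_isometries A T = (\<lambda>(i, j). if i = p \<and> j \<notin> K
     then T (p, middle j) \<otimes>\<^bsub>A\<^esub> T (middle j, j) else T (i, j))"

lemma transfer_isometries_simps:
  "m \<in> M \<Longrightarrow> transfer_isometries A S (p, m) =
    (\<Oplus>\<^bsub>A\<^esub>l\<in>row_support I B m. S (p, l) \<otimes>\<^bsub>A\<^esub> star A (S (m, l)))"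
  "k \<in> K \<Longrightarrow> transfer_isometries A S (p, k) = S (p, k)"
  "i \<noteq> p \<Longrightarrow> transfer_isometries A S (i, j) = S (i, j)"
  using disjoint by (auto simp: transfer_isometries_def)

lemma untransfer_isometries_simps:
  "\<lbrakk>m \<in> M; j \<in> row_support I B m\<rbrakk> \<Longrightarrow> untransfer_isometries A T (p, j) = T (p, m) \<otimes>\<^bsub>A\<^esub> T (m, j)"
  "k \<in> K \<Longrightarrow> untransfer_isometries A T (p, k) = T (p, k)"
  "i \<noteq> p \<Longrightarrow> untransfer_isometries A T (i, j) = T (i, j)"
  using disjoint_K[of m] middle_eq[of m j] by (auto simp: untransfer_isometries_def)

lemma arc_cases:
  assumes "e \<in> Sigma I (row_support I B)"
  obtains (path) m j where "m \<in> M" "j \<in> row_support I B m" "e = (p, j)"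
  | (kept) k where "k \<in> K" "e = (p, k)"
  | (other) i j where "i \<in> I" "i \<noteq> p" "j \<in> row_support I B i" "e = (i, j)"
proof (cases e)
  case (Pair i j)
  with assms have ij: "i \<in> I" "j \<in> row_support I B i"
    by simp_all
  show thesis
  proof (cases "i = p")
    case True
    with ij(2) have "j \<in> K \<or> (\<exists>m\<in>M. j \<in> row_support I B m)"
      by (simp add: support_p)
    with True Pair path kept show thesis
      by blast
  qed (rule other[OF ij(1) _ ij(2) Pair])
qed

lemma arc_cases':
  assumes "e \<in> Sigma I (row_support I C)"
  obtains (path) m where "m \<in> M" "e = (p, m)"
  | (kept) k where "k \<in> K" "e = (p, k)"
  | (other) i j where "i \<in> I" "i \<noteq> p" "j \<in> row_support I B i" "e = (i, j)"
proof (cases e)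
  case (Pair i j)
  with assms have ij: "i \<in> I" "j \<in> row_support I C i"
    by simp_all
  show thesis
  proof (cases "i = p")
    case True
    with ij(2) Pair path kept show thesis
      by (auto simp: support'_p)
  next
    case False
    with other[OF ij(1) False _ Pair] ij support' show thesis
      by simp
  qed
qed

lemma finsum_support_p:
  assumes "pre_cstar_algebra A" "\<And>j. j \<in> row_support I B p \<Longrightarrow> f j \<in> carrier A"
  shows "(\<Oplus>\<^bsub>A\<^esub>j\<in>row_support I B p. f j) =
    (\<Oplus>\<^bsub>A\<^esub>k\<in>K. f k) \<oplus>\<^bsub>A\<^esub> (\<Oplus>\<^bsub>A\<^esub>m\<in>M. \<Oplus>\<^bsub>A\<^esub>j\<in>row_support I B m. f j)"
proof -
  interpret pre_cstar_algebra A by fact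
  have f: "f j \<in> carrier A" if "j \<in> K \<or> (\<exists>m\<in>M. j \<in> row_support I B m)" for j
    using assms(2)[of j] that support_p by blast
  have "(\<Oplus>\<^bsub>A\<^esub>j\<in>row_support I B p. f j) =
      (\<Oplus>\<^bsub>A\<^esub>k\<in>K. f k) \<oplus>\<^bsub>A\<^esub> (\<Oplus>\<^bsub>A\<^esub>j\<in>(\<Union>m\<in>M. row_support I B m). f j)"
    unfolding support_p
  proof (rule add.finprod_Un_disjoint)
    show "K \<inter> (\<Union>m\<in>M. row_support I B m) = {}"
      using disjoint_K by blast
  qed (use finite finite_row M_in f in auto)
  also have "(\<Oplus>\<^bsub>A\<^esub>j\<in>(\<Union>m\<in>M. row_support I B m). f j) = (\<Oplus>\<^bsub>A\<^esub>m\<in>M. \<Oplus>\<^bsub>A\<^esub>j\<in>row_support I B m. f j)"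
    by (rule finsum_UN_disjoint) (use finite finite_row M_in disjoint_M f in blast)+
  finally show ?thesis .
qed

lemma finsum_support'_p:
  assumes "pre_cstar_algebra A" "\<And>j. j \<in> K \<union> M \<Longrightarrow> f j \<in> carrier A"
  shows "(\<Oplus>\<^bsub>A\<^esub>j\<in>row_support I C p. f j) = (\<Oplus>\<^bsub>A\<^esub>k\<in>K. f k) \<oplus>\<^bsub>A\<^esub> (\<Oplus>\<^bsub>A\<^esub>m\<in>M. f m)"
proof -
  interpret pre_cstar_algebra A by fact
  show ?thesis
    unfolding support'_p using finite disjoint assms(2) by (intro add.finprod_Un_disjoint) auto
qed

section \<open>The two families determine each other\<close>

text \<open>\<open>V = T (p, m)\<close> carries the range of each \<open>S (m, l)\<close> to that of
  \<open>S (p, l)\<close>, and its adjoint goes back. So \<open>V\<^sup>* V\<close> is the sum of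
  the \<open>S (m, l) S (m, l)\<^sup>*\<close>, which is \<open>P m\<close> because row
  \<open>m\<close> is not zero.\<close>

lemma transfer_isometries_path:
  assumes A: "cstar_algebra A" and S: "cuntz_krieger_family (matrix_digraph I B) A P S"
    and m: "m \<in> M"
  shows "transfer_isometries A S (p, m) \<in> carrier A"
    and "j \<in> row_support I B m \<Longrightarrow> transfer_isometries A S (p, m) \<otimes>\<^bsub>A\<^esub> S (m, j) = S (p, j)"
    and "partial_isometry A (transfer_isometries A S (p, m))"
    and "star A (transfer_isometries A S (p, m)) \<otimes>\<^bsub>A\<^esub> transfer_isometries A S (p, m) = P m"
    and "transfer_isometries A S (p, m) \<otimes>\<^bsub>A\<^esub> star A (transfer_isometries A S (p, m)) =
      (\<Oplus>\<^bsub>A\<^esub>l\<in>row_support I B m. S (p, l) \<otimes>\<^bsub>A\<^esub> star A (S (p, l)))"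
proof -
  interpret cstar_algebra A by fact
  interpret F: matrix_cuntz_krieger_family A I B P S
    by unfold_locales (use S finite_row in auto)
  let ?L = "row_support I B m"
  have mI: "m \<in> I" "?L \<subseteq> row_support I B p" "finite ?L"
    using m M_in support_p finite_row by auto
  have L: "S (p, l) \<in> carrier A" "S (m, l) \<in> carrier A" "S (p, l) \<otimes>\<^bsub>A\<^esub> P l = S (p, l)"
    "S (m, l) \<otimes>\<^bsub>A\<^esub> P l = S (m, l)" "star A (S (p, l)) \<otimes>\<^bsub>A\<^esub> S (p, l) = P l"
    "star A (S (m, l)) \<otimes>\<^bsub>A\<^esub> S (m, l) = P l" if l: "l \<in> ?L" for l
    using F.S_closed[OF p subsetD[OF mI(2) l]] F.S_closed[OF mI(1) l] F.S_P[OF p subsetD[OF mI(2) l]]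
      F.S_P[OF mI(1) l] F.star_S_S[OF p subsetD[OF mI(2) l]] F.star_S_S[OF mI(1) l]
    by simp_all
  have orth: "star A (S (p, k)) \<otimes>\<^bsub>A\<^esub> S (p, l) = \<zero>\<^bsub>A\<^esub>" "star A (S (m, k)) \<otimes>\<^bsub>A\<^esub> S (m, l) = \<zero>\<^bsub>A\<^esub>"
    if kl: "k \<in> ?L" "l \<in> ?L" "k \<noteq> l" for k l
    using F.star_S_S_orthogonal[OF p subsetD[OF mI(2) kl(1)] subsetD[OF mI(2) kl(2)] kl(3)]
      F.star_S_S_orthogonal[OF mI(1) kl]
    by simp_all
  define V where "V = transfer_isometries A S (p, m)"
  have V: "V = (\<Oplus>\<^bsub>A\<^esub>l\<in>?L. S (p, l) \<otimes>\<^bsub>A\<^esub> star A (S (m, l)))"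
    by (simp add: V_def transfer_isometries_simps m)
  have V1: "V \<in> carrier A" "star A V = (\<Oplus>\<^bsub>A\<^esub>l\<in>?L. S (m, l) \<otimes>\<^bsub>A\<^esub> star A (S (p, l)))"
    "\<And>j. j \<in> ?L \<Longrightarrow> V \<otimes>\<^bsub>A\<^esub> S (m, j) = S (p, j)"
    unfolding V using mI(3) L orth by (intro finsum_partial_isometries[where q=P]; simp)+
  have V2: "star A V \<otimes>\<^bsub>A\<^esub> S (p, j) = S (m, j)" if "j \<in> ?L" for j
    unfolding V1(2) using mI(3) L orth that by (intro finsum_partial_isometries[where q=P]) simp_all
  have VV: "star A V \<otimes>\<^bsub>A\<^esub> V = P m"
  proof -
    have "star A V \<otimes>\<^bsub>A\<^esub> V = (\<Oplus>\<^bsub>A\<^esub>l\<in>?L. star A V \<otimes>\<^bsub>A\<^esub> (S (p, l) \<otimes>\<^bsub>A\<^esub> star A (S (m, l))))"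
      using V1(1) L by (subst (2) V) (intro finsum_mult_left, simp_all)
    also have "\<dots> = (\<Oplus>\<^bsub>A\<^esub>l\<in>?L. S (m, l) \<otimes>\<^bsub>A\<^esub> star A (S (m, l)))"
      using V1(1) V2 L by (intro finsum_cong') (auto simp flip: mult_assoc)
    also have "\<dots> = P m"
      using F.P_eq_finsum mI nonempty[OF m] by auto
    finally show ?thesis .
  qed
  have "V \<otimes>\<^bsub>A\<^esub> star A V = (\<Oplus>\<^bsub>A\<^esub>l\<in>?L. V \<otimes>\<^bsub>A\<^esub> (S (m, l) \<otimes>\<^bsub>A\<^esub> star A (S (p, l))))"
    unfolding V1(2) using V1(1) L by (intro finsum_mult_left) simp_all
  also have "\<dots> = (\<Oplus>\<^bsub>A\<^esub>l\<in>?L. S (p, l) \<otimes>\<^bsub>A\<^esub> star A (S (p, l)))"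
    using V1 L by (intro finsum_cong') (auto simp flip: mult_assoc)
  finally have VV': "V \<otimes>\<^bsub>A\<^esub> star A V = (\<Oplus>\<^bsub>A\<^esub>l\<in>?L. S (p, l) \<otimes>\<^bsub>A\<^esub> star A (S (p, l)))" .
  \<comment> \<open>The ranges of the \<open>S (m, l)\<close> lie under \<open>P m\<close>, so
    \<open>V P m = V\<close>; with \<open>V\<^sup>* V = P m\<close> this makes \<open>V\<close> a
    partial isometry.\<close>
  have "star A (S (m, l)) \<otimes>\<^bsub>A\<^esub> P m = star A (S (m, l))" if l: "l \<in> ?L" for l
  proof -
    have "star A (S (m, l)) \<otimes>\<^bsub>A\<^esub> P m = star A (P m \<otimes>\<^bsub>A\<^esub> S (m, l))"
      using F.projection_P[OF mI(1)] L(2)[OF l] by (simp add: star_mult projection_def)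
    then show ?thesis
      using F.P_S[OF mI(1) l] by simp
  qed
  then have "V \<otimes>\<^bsub>A\<^esub> P m = V"
    unfolding V using L mI
    by (subst finsum_mult_right) (auto simp: mult_assoc intro!: finsum_cong')
  then have "partial_isometry A V"
    using V1(1) VV by (simp add: partial_isometry_def mult_assoc)
  then show "transfer_isometries A S (p, m) \<in> carrier A"
    "partial_isometry A (transfer_isometries A S (p, m))"
    "star A (transfer_isometries A S (p, m)) \<otimes>\<^bsub>A\<^esub> transfer_isometries A S (p, m) = P m"
    "transfer_isometries A S (p, m) \<otimes>\<^bsub>A\<^esub> star A (transfer_isometries A S (p, m)) =
      (\<Oplus>\<^bsub>A\<^esub>l\<in>row_support I B m. S (p, l) \<otimes>\<^bsub>A\<^esub> star A (S (p, l)))"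
    "j \<in> ?L \<Longrightarrow> transfer_isometries A S (p, m) \<otimes>\<^bsub>A\<^esub> S (m, j) = S (p, j)"
    using V1(1,3) VV VV' by (simp_all add: V_def)
qed

text \<open>The decomposition of \<open>P p\<close> is only regrouped: the ranges belonging to row
  \<open>m\<close> are merged into the single range of \<open>T (p, m)\<close>.\<close>

lemma transfer_family:
  assumes A: "cstar_algebra A" and S: "cuntz_krieger_family (matrix_digraph I B) A P S"
  shows "cuntz_krieger_family (matrix_digraph I C) A P (transfer_isometries A S)"
proof -
  interpret cstar_algebra A by fact
  interpret F: matrix_cuntz_krieger_family A I B P S
    by unfold_locales (use S finite_row in auto)
  let ?T = "transfer_isometries A S"
  note path = transfer_isometries_path[OF A S]
  have K: "S (p, k) \<in> carrier A" if "k \<in> K" for k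
    using that p support_p by simp
  have iso: "partial_isometry A (?T (i, j)) \<and> star A (?T (i, j)) \<otimes>\<^bsub>A\<^esub> ?T (i, j) = P j"
    if ij: "i \<in> I" "j \<in> row_support I C i" for i j
  proof -
    have "(i, j) \<in> Sigma I (row_support I C)"
      using ij by simp
    then show ?thesis
    proof (cases rule: arc_cases')
      case (path m)
      then show ?thesis
        using transfer_isometries_path[OF A S] by simp
    next
      case (kept k)
      then show ?thesis
        using p support_p F.partial_isometry_S F.star_S_S by (simp add: transfer_isometries_simps)
    next
      case (other i' j')
      then show ?thesis
        using F.partial_isometry_S F.star_S_S by (simp add: transfer_isometries_simps)
    qed
  qed
  have sum: "P i = (\<Oplus>\<^bsub>A\<^esub>j\<in>row_support I C i. ?T (i, j) \<otimes>\<^bsub>A\<^esub> star A (?T (i, j)))"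
    if i: "i \<in> I" "row_support I C i \<noteq> {}" for i
  proof (cases "i = p")
    case True
    have "P p = (\<Oplus>\<^bsub>A\<^esub>j\<in>row_support I B p. S (p, j) \<otimes>\<^bsub>A\<^esub> star A (S (p, j)))"
      using F.P_eq_finsum p nonempty_p by blast
    also have "\<dots> = (\<Oplus>\<^bsub>A\<^esub>k\<in>K. S (p, k) \<otimes>\<^bsub>A\<^esub> star A (S (p, k))) \<oplus>\<^bsub>A\<^esub>
        (\<Oplus>\<^bsub>A\<^esub>m\<in>M. \<Oplus>\<^bsub>A\<^esub>j\<in>row_support I B m. S (p, j) \<otimes>\<^bsub>A\<^esub> star A (S (p, j)))"
      using p by (intro finsum_support_p pre_cstar_algebra_axioms) simp
    also have "\<dots> = (\<Oplus>\<^bsub>A\<^esub>k\<in>K. ?T (p, k) \<otimes>\<^bsub>A\<^esub> star A (?T (p, k))) \<oplus>\<^bsub>A\<^esub>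
        (\<Oplus>\<^bsub>A\<^esub>m\<in>M. ?T (p, m) \<otimes>\<^bsub>A\<^esub> star A (?T (p, m)))"
      using K path by (intro arg_cong2[of _ _ _ _ "(\<oplus>\<^bsub>A\<^esub>)"] finsum_cong') (auto simp: transfer_isometries_simps(2))
    also have "\<dots> = (\<Oplus>\<^bsub>A\<^esub>j\<in>row_support I C p. ?T (p, j) \<otimes>\<^bsub>A\<^esub> star A (?T (p, j)))"
      using K path
      by (intro finsum_support'_p[symmetric] pre_cstar_algebra_axioms) (auto simp: transfer_isometries_simps(2))
    finally show ?thesis
      by (simp add: True)
  next
    case False
    then show ?thesis
      using i support'[OF i(1)] F.P_eq_finsum[OF i(1)] by (auto simp: transfer_isometries_simps)
  qed
  show ?thesis
    unfolding cuntz_krieger_family_matrix_digraph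
    using F.projection_P F.P_orthogonal iso sum by blast
qed

text \<open>A product \<open>T (p, m) T (m, j)\<close> is a partial isometry because the initial
  projection \<open>P m\<close> of the first factor contains the range of the second.\<close>

lemma untransfer_family:
  assumes A: "cstar_algebra A" and T: "cuntz_krieger_family (matrix_digraph I C) A P T"
  shows "cuntz_krieger_family (matrix_digraph I B) A P (untransfer_isometries A T)"
proof -
  interpret cstar_algebra A by fact
  interpret F: matrix_cuntz_krieger_family A I C P T
    by unfold_locales (use T finite_row' in auto)
  let ?S = "untransfer_isometries A T"
  have K: "T (p, k) \<in> carrier A" if "k \<in> K" for k
    using that p support'_p by simp
  have M: "T (p, m) \<in> carrier A" "P m \<in> carrier A" "T (p, m) \<otimes>\<^bsub>A\<^esub> P m = T (p, m)"
    "star A (T (p, m)) \<otimes>\<^bsub>A\<^esub> T (p, m) = P m" if "m \<in> M" for m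
    using that p support'_p M_in F.S_P F.star_S_S by simp_all
  have TM: "T (m, j) \<in> carrier A" "P m \<otimes>\<^bsub>A\<^esub> T (m, j) = T (m, j)" "T (m, j) \<otimes>\<^bsub>A\<^esub> P j = T (m, j)"
    "star A (T (m, j)) \<otimes>\<^bsub>A\<^esub> T (m, j) = P j" "P j \<in> carrier A"
    if mj: "m \<in> M" "j \<in> row_support I B m" for m j
    using mj support'_M M_in F.P_S F.S_P F.star_S_S subsetD[OF row_support_subset mj(2)] by simp_all
  have iso: "partial_isometry A (?S (i, j)) \<and> star A (?S (i, j)) \<otimes>\<^bsub>A\<^esub> ?S (i, j) = P j"
    if ij: "i \<in> I" "j \<in> row_support I B i" for i j
  proof -
    have "(i, j) \<in> Sigma I (row_support I B)"
      using ij by simp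
    then show ?thesis
    proof (cases rule: arc_cases)
      case (path m j')
      note mj = M[OF path(1)] TM[OF path(1,2)]
      let ?W = "T (p, m) \<otimes>\<^bsub>A\<^esub> T (m, j')"
      have "star A ?W \<otimes>\<^bsub>A\<^esub> ?W = star A (T (m, j')) \<otimes>\<^bsub>A\<^esub> (star A (T (p, m)) \<otimes>\<^bsub>A\<^esub> T (p, m) \<otimes>\<^bsub>A\<^esub> T (m, j'))"
        using mj(1,5) by (simp add: star_mult mult_assoc)
      then have WW: "star A ?W \<otimes>\<^bsub>A\<^esub> ?W = P j'"
        by (simp add: mj)
      have "?W \<otimes>\<^bsub>A\<^esub> P j' = ?W"
        using mj by (simp add: mult_assoc)
      then have "?W \<otimes>\<^bsub>A\<^esub> star A ?W \<otimes>\<^bsub>A\<^esub> ?W = ?W"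
        using mult_assoc[of ?W "star A ?W" ?W] mj(1,5) WW by simp
      then have "partial_isometry A ?W"
        using mj(1,5) by (simp add: partial_isometry_def)
      then show ?thesis
        using path WW by (simp add: untransfer_isometries_simps)
    next
      case (kept k)
      then show ?thesis
        using p support'_p F.partial_isometry_S F.star_S_S by (simp add: untransfer_isometries_simps)
    next
      case (other i' j')
      then show ?thesis
        using F.partial_isometry_S F.star_S_S support' by (simp add: untransfer_isometries_simps)
    qed
  qed
  have sum: "P i = (\<Oplus>\<^bsub>A\<^esub>j\<in>row_support I B i. ?S (i, j) \<otimes>\<^bsub>A\<^esub> star A (?S (i, j)))"
    if i: "i \<in> I" "row_support I B i \<noteq> {}" for i
  proof (cases "i = p")
    case True
    \<comment> \<open>Row \<open>m\<close> is not zero, so the ranges of the paths through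
      \<open>m\<close> sum to \<open>T (p, m) (P m) T (p, m)\<^sup>*\<close>, the range of
      \<open>T (p, m)\<close>.\<close>
    have inner: "(\<Oplus>\<^bsub>A\<^esub>j\<in>row_support I B m. ?S (p, j) \<otimes>\<^bsub>A\<^esub> star A (?S (p, j))) = T (p, m) \<otimes>\<^bsub>A\<^esub> star A (T (p, m))"
      if m: "m \<in> M" for m
    proof -
      have "(\<Oplus>\<^bsub>A\<^esub>j\<in>row_support I B m. ?S (p, j) \<otimes>\<^bsub>A\<^esub> star A (?S (p, j))) =
          (\<Oplus>\<^bsub>A\<^esub>j\<in>row_support I B m. T (p, m) \<otimes>\<^bsub>A\<^esub> (T (m, j) \<otimes>\<^bsub>A\<^esub> star A (T (m, j)) \<otimes>\<^bsub>A\<^esub> star A (T (p, m))))"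
        using M(1)[OF m] TM(1)[OF m]
        by (intro finsum_cong') (auto simp: untransfer_isometries_simps(1)[OF m] star_mult mult_assoc)
      also have "\<dots> = T (p, m) \<otimes>\<^bsub>A\<^esub> ((\<Oplus>\<^bsub>A\<^esub>j\<in>row_support I B m. T (m, j) \<otimes>\<^bsub>A\<^esub> star A (T (m, j))) \<otimes>\<^bsub>A\<^esub> star A (T (p, m)))"
        using M(1)[OF m] TM(1)[OF m] by (simp add: finsum_mult_left finsum_mult_right)
      also have "(\<Oplus>\<^bsub>A\<^esub>j\<in>row_support I B m. T (m, j) \<otimes>\<^bsub>A\<^esub> star A (T (m, j))) = P m"
        using F.P_eq_finsum[OF M_in[OF m]] nonempty[OF m] support'_M[OF m] by auto
      also have "T (p, m) \<otimes>\<^bsub>A\<^esub> (P m \<otimes>\<^bsub>A\<^esub> star A (T (p, m))) = T (p, m) \<otimes>\<^bsub>A\<^esub> star A (T (p, m))"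
        using M[OF m] by (simp flip: mult_assoc)
      finally show ?thesis .
    qed
    \<comment> \<open>The relation at \<open>p\<close> is available only if the new row
      \<open>p\<close> is nonzero too.\<close>
    have "K \<union> M \<noteq> {}"
      using nonempty_p support_p by auto
    then have "P p = (\<Oplus>\<^bsub>A\<^esub>j\<in>row_support I C p. T (p, j) \<otimes>\<^bsub>A\<^esub> star A (T (p, j)))"
      using F.P_eq_finsum p support'_p by blast
    also have "\<dots> = (\<Oplus>\<^bsub>A\<^esub>k\<in>K. T (p, k) \<otimes>\<^bsub>A\<^esub> star A (T (p, k))) \<oplus>\<^bsub>A\<^esub>
        (\<Oplus>\<^bsub>A\<^esub>m\<in>M. T (p, m) \<otimes>\<^bsub>A\<^esub> star A (T (p, m)))"
      using K M(1) by (intro finsum_support'_p pre_cstar_algebra_axioms) auto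
    also have "\<dots> = (\<Oplus>\<^bsub>A\<^esub>k\<in>K. ?S (p, k) \<otimes>\<^bsub>A\<^esub> star A (?S (p, k))) \<oplus>\<^bsub>A\<^esub>
        (\<Oplus>\<^bsub>A\<^esub>m\<in>M. \<Oplus>\<^bsub>A\<^esub>j\<in>row_support I B m. ?S (p, j) \<otimes>\<^bsub>A\<^esub> star A (?S (p, j)))"
      using K M(1) inner
      by (intro arg_cong2[of _ _ _ _ "(\<oplus>\<^bsub>A\<^esub>)"] finsum_cong') (auto simp: untransfer_isometries_simps(2))
    also have "\<dots> = (\<Oplus>\<^bsub>A\<^esub>j\<in>row_support I B p. ?S (p, j) \<otimes>\<^bsub>A\<^esub> star A (?S (p, j)))"
      using iso[OF p]
      by (intro finsum_support_p[symmetric] pre_cstar_algebra_axioms) (simp add: partial_isometry_def)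
    finally show ?thesis
      by (simp add: True)
  next
    case False
    then show ?thesis
      using i support'[OF i(1)] F.P_eq_finsum[OF i(1)] by (auto simp: untransfer_isometries_simps)
  qed
  show ?thesis
    unfolding cuntz_krieger_family_matrix_digraph
    using F.projection_P F.P_orthogonal iso sum by blast
qed

lemma untransfer_transfer:
  assumes A: "cstar_algebra A" and S: "cuntz_krieger_family (matrix_digraph I B) A P S"
    and e: "e \<in> Sigma I (row_support I B)"
  shows "untransfer_isometries A (transfer_isometries A S) e = S e"
  using e
proof (cases rule: arc_cases)
  case (path m j)
  then show ?thesis
    using transfer_isometries_path(2)[OF A S] M_neq
    by (simp add: untransfer_isometries_simps transfer_isometries_simps(3))
qed (simp_all add: untransfer_isometries_simps transfer_isometries_simps)

lemma transfer_untransfer: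
  assumes A: "cstar_algebra A" and T: "cuntz_krieger_family (matrix_digraph I C) A P T"
    and e: "e \<in> Sigma I (row_support I C)"
  shows "transfer_isometries A (untransfer_isometries A T) e = T e"
  using e
proof (cases rule: arc_cases')
  case (path m)
  interpret cstar_algebra A by fact
  interpret F: matrix_cuntz_krieger_family A I C P T
    by unfold_locales (use T finite_row' in auto)
  note m = path(1)
  have mI: "m \<in> I" "m \<in> row_support I C p"
    using m M_in support'_p by simp_all
  have "transfer_isometries A (untransfer_isometries A T) (p, m) =
      (\<Oplus>\<^bsub>A\<^esub>l\<in>row_support I C m. T (p, m) \<otimes>\<^bsub>A\<^esub> (T (m, l) \<otimes>\<^bsub>A\<^esub> star A (T (m, l))))"
    unfolding transfer_isometries_simps(1)[OF m]
    using m mI p M_neq[OF m]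
    by (intro finsum_cong') (auto simp: untransfer_isometries_simps support'_M mult_assoc)
  also have "\<dots> = T (p, m) \<otimes>\<^bsub>A\<^esub> (\<Oplus>\<^bsub>A\<^esub>l\<in>row_support I C m. T (m, l) \<otimes>\<^bsub>A\<^esub> star A (T (m, l)))"
    using mI p by (intro finsum_mult_left[symmetric]) simp_all
  also have "\<dots> = T (p, m)"
    using F.P_eq_finsum[OF mI(1)] nonempty[OF m] support'_M[OF m] F.S_P[OF p mI(2)] by auto
  finally show ?thesis
    by (simp add: path(2))
qed (simp_all add: untransfer_isometries_simps transfer_isometries_simps)

text \<open>The formula uses only operations that a homomorphism preserves; \<open>S'\<close>
  records the values of \<open>f\<close> on arcs.\<close>

lemma transfer_isometries_hom:
  assumes f: "star_hom A A' f" and A: "cstar_algebra A" and A': "cstar_algebra A'"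
    and S: "cuntz_krieger_family (matrix_digraph I B) A P S"
    and fS: "\<And>e. e \<in> Sigma I (row_support I B) \<Longrightarrow> f (S e) = S' e"
    and e: "e \<in> Sigma I (row_support I C)"
  shows "f (transfer_isometries A S e) = transfer_isometries A' S' e"
  using e
proof (cases rule: arc_cases')
  case (path m)
  interpret cstar_algebra A by fact
  interpret A': cstar_algebra A' by fact
  interpret F: matrix_cuntz_krieger_family A I B P S
    by unfold_locales (use S finite_row in auto)
  note hom = star_homD[OF f]
  have L: "S (p, l) \<in> carrier A" "S (m, l) \<in> carrier A" "f (S (p, l)) = S' (p, l)" "f (S (m, l)) = S' (m, l)"
    "S' (p, l) \<in> carrier A'" "S' (m, l) \<in> carrier A'"
    if "l \<in> row_support I B m" for l
  proof -
    have "l \<in> row_support I B p" "m \<in> I"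
      using that path(1) support_p M_in by auto
    then show "S (p, l) \<in> carrier A" "S (m, l) \<in> carrier A" "f (S (p, l)) = S' (p, l)" "f (S (m, l)) = S' (m, l)"
      using that p fS by simp_all
    then show "S' (p, l) \<in> carrier A'" "S' (m, l) \<in> carrier A'"
      using hom(1) by metis+
  qed
  have "f (transfer_isometries A S (p, m)) =
      (\<Oplus>\<^bsub>A'\<^esub>l\<in>row_support I B m. f (S (p, l) \<otimes>\<^bsub>A\<^esub> star A (S (m, l))))"
    unfolding transfer_isometries_simps(1)[OF path(1)]
    by (rule star_hom_finsum[OF f pre_cstar_algebra_axioms A'.pre_cstar_algebra_axioms]) (simp add: L)
  also have "\<dots> = transfer_isometries A' S' (p, m)"
    unfolding transfer_isometries_simps(1)[OF path(1)] using L hom by (intro A'.finsum_cong') auto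
  finally show ?thesis
    by (simp add: path(2))
qed (use fS p support_p in \<open>simp_all add: transfer_isometries_simps\<close>)

lemma untransfer_isometries_hom:
  assumes f: "star_hom A A' f" and A: "cstar_algebra A"
    and T: "cuntz_krieger_family (matrix_digraph I C) A P T"
    and fT: "\<And>e. e \<in> Sigma I (row_support I C) \<Longrightarrow> f (T e) = T' e"
    and e: "e \<in> Sigma I (row_support I B)"
  shows "f (untransfer_isometries A T e) = untransfer_isometries A' T' e"
  using e
proof (cases rule: arc_cases)
  case (path m j)
  interpret cstar_algebra A by fact
  interpret F: matrix_cuntz_krieger_family A I C P T
    by unfold_locales (use T finite_row' in auto)
  have "m \<in> row_support I C p" "j \<in> row_support I C m" "m \<in> I"
    using path(1,2) support'_p support'_M M_in by simp_all
  then show ?thesis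
    using p fT path star_homD(4)[OF f] by (simp add: untransfer_isometries_simps)
qed (use fT p support'_p support' in \<open>simp_all add: untransfer_isometries_simps\<close>)

section \<open>Universality survives a transfer in both directions\<close>

text \<open>A test family \<open>U\<close> of the new graph is turned into one of the old graph,
  where universality applies. The homomorphism obtained sends the transferred generators to the
  transfer of that family, which is \<open>U\<close> again.\<close>

lemma is_graph_cstar_transfer:
  assumes A: "is_graph_cstar (matrix_digraph I B) A P S"
  shows "is_graph_cstar (matrix_digraph I C) A P (transfer_isometries A S)"
proof -
  have A': "cstar_algebra A" "cuntz_krieger_family (matrix_digraph I B) A P S"
    using A by (simp_all add: is_graph_cstar_def)
  show ?thesis
  proof (rule is_graph_cstar_change_arcs[OF A _ transfer_family[OF A']])
    fix D assume D: "closed_star_subalgebra A D"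
      "transfer_isometries A S ` arcs (matrix_digraph I C) \<subseteq> D"
    have T: "transfer_isometries A S (i, j) \<in> D" if "i \<in> I" "j \<in> row_support I C i" for i j
      using D(2) that by auto
    have "untransfer_isometries A (transfer_isometries A S) e \<in> D"
      if e: "e \<in> Sigma I (row_support I B)" for e
      using e
    proof (cases rule: arc_cases)
      case (path m j)
      then show ?thesis
        using closed_star_subalgebraD(5)[OF D(1)] T p support'_p support'_M M_in
        by (simp add: untransfer_isometries_simps(1)[OF path(1,2)])
    qed (use T p support'_p support' in \<open>simp_all add: untransfer_isometries_simps\<close>)
    then show "S ` arcs (matrix_digraph I B) \<subseteq> D"
      using untransfer_transfer[OF A'] by auto
  next
    fix X :: "real cstar" and Q U
    assume X: "cstar_algebra X" "cuntz_krieger_family (matrix_digraph I C) X Q U"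
    show "\<exists>V. cuntz_krieger_family (matrix_digraph I B) X Q V \<and>
        (\<forall>f. star_hom A X f \<and> (\<forall>e\<in>arcs (matrix_digraph I B). f (S e) = V e) \<longrightarrow>
          (\<forall>e\<in>arcs (matrix_digraph I C). f (transfer_isometries A S e) = U e))"
    proof (intro exI[of _ "untransfer_isometries X U"] conjI allI impI ballI)
      fix f e
      assume f: "star_hom A X f \<and>
          (\<forall>e\<in>arcs (matrix_digraph I B). f (S e) = untransfer_isometries X U e)"
        and e: "e \<in> arcs (matrix_digraph I C)"
      then have "f (transfer_isometries A S e) = transfer_isometries X (untransfer_isometries X U) e"
        by (intro transfer_isometries_hom[OF _ A'(1) X(1) A'(2)]) auto
      also have "\<dots> = U e"
        using transfer_untransfer[OF X] e by simp
      finally show "f (transfer_isometries A S e) = U e" .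
    qed (rule untransfer_family[OF X])
  qed simp
qed

lemma is_graph_cstar_untransfer:
  assumes A: "is_graph_cstar (matrix_digraph I C) A P T"
  shows "is_graph_cstar (matrix_digraph I B) A P (untransfer_isometries A T)"
proof -
  have A': "cstar_algebra A" "cuntz_krieger_family (matrix_digraph I C) A P T"
    using A by (simp_all add: is_graph_cstar_def)
  interpret cstar_algebra A
    by (rule A'(1))
  show ?thesis
  proof (rule is_graph_cstar_change_arcs[OF A _ untransfer_family[OF A']])
    fix D assume D: "closed_star_subalgebra A D"
      "untransfer_isometries A T ` arcs (matrix_digraph I B) \<subseteq> D"
    have S: "untransfer_isometries A T (i, j) \<in> D" if "i \<in> I" "j \<in> row_support I B i" for i j
      using D(2) that by auto
    have "transfer_isometries A (untransfer_isometries A T) e \<in> D"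
      if e: "e \<in> Sigma I (row_support I C)" for e
      using e
    proof (cases rule: arc_cases')
      case (path m)
      have "untransfer_isometries A T (p, l) \<in> D" "untransfer_isometries A T (m, l) \<in> D"
        if "l \<in> row_support I B m" for l
        using that path(1) S[of p l] S[of m l] p support_p M_in by auto
      then show ?thesis
        using path closed_star_subalgebraD(5,6)[OF D(1)]
        by (simp add: transfer_isometries_simps closed_star_subalgebra_finsum[OF D(1)])
    qed (use S p support_p in \<open>simp_all add: transfer_isometries_simps\<close>)
    then show "T ` arcs (matrix_digraph I C) \<subseteq> D"
      using transfer_untransfer[OF A'] by auto
  next
    fix X :: "real cstar" and Q U
    assume X: "cstar_algebra X" "cuntz_krieger_family (matrix_digraph I B) X Q U"
    show "\<exists>V. cuntz_krieger_family (matrix_digraph I C) X Q V \<and>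
        (\<forall>f. star_hom A X f \<and> (\<forall>e\<in>arcs (matrix_digraph I C). f (T e) = V e) \<longrightarrow>
          (\<forall>e\<in>arcs (matrix_digraph I B). f (untransfer_isometries A T e) = U e))"
    proof (intro exI[of _ "transfer_isometries X U"] conjI allI impI ballI)
      fix f e
      assume f: "star_hom A X f \<and>
          (\<forall>e\<in>arcs (matrix_digraph I C). f (T e) = transfer_isometries X U e)"
        and e: "e \<in> arcs (matrix_digraph I B)"
      then have "f (untransfer_isometries A T e) = untransfer_isometries X (transfer_isometries X U) e"
        by (intro untransfer_isometries_hom[OF _ A']) auto
      also have "\<dots> = U e"
        using untransfer_transfer[OF X] e by simp
      finally show "f (untransfer_isometries A T e) = U e" .
    qed (rule transfer_family[OF X])
  qed simp
qed

end

section \<open>Links of a chain of matrices\<close>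

text \<open>The entry of row \<open>p\<close> at \<open>j\<close> counts the occurrences of
  \<open>j\<close> in \<open>K\<close> and in the rows of \<open>M\<close>; being at most one, it
  rules out overlaps. Finiteness may be known for either matrix: they agree off \<open>p\<close>,
  and row \<open>p\<close> of \<open>B\<close> is a finite union involving only other rows.\<close>

lemma support_transferI:
  assumes t: "primitive_transfer_at I p B C"
    and fin: "(\<forall>i\<in>I. finite (row_support I B i)) \<or> (\<forall>i\<in>I. finite (row_support I C i))"
  shows "\<exists>K M. support_transfer I p B C K M"
proof -
  obtain K M where zo: "zero_one_matrix I B" and p: "p \<in> I" "\<not> zero_row I B p"
    and KM: "finite K" "finite M" "K \<subseteq> I" "M \<subseteq> I" "K \<inter> M = {}" "p \<notin> M"
    and M: "\<And>m. m \<in> M \<Longrightarrow> \<not> zero_row I B m"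
    and Bp: "\<And>j. j \<in> I \<Longrightarrow> B p j = (\<Sum>k\<in>K. if j = k then 1 else 0) + (\<Sum>m\<in>M. B m j)"
    and C: "\<And>i j. \<lbrakk>i \<in> I; i \<noteq> p; j \<in> I\<rbrakk> \<Longrightarrow> C i j = B i j"
    and Cp: "\<And>j. j \<in> I \<Longrightarrow> C p j = (if j \<in> K \<union> M then 1 else 0)"
    using t unfolding primitive_transfer_at_def by auto
  have nonempty: "row_support I B i \<noteq> {}" if "\<not> zero_row I B i" for i
    using that by (auto simp: zero_row_def row_support_def)
  have Bp': "B p j = (if j \<in> K then 1 else 0) + (\<Sum>m\<in>M. B m j)" if "j \<in> I" for j
    using Bp[OF that] KM(1) by simp
  have le: "B p j \<le> 1" if "j \<in> I" for j
  proof -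
    have "B p j \<in> {0, 1}"
      using zo p(1) that unfolding zero_one_matrix_def by blast
    then show ?thesis
      by auto
  qed
  have support_p: "row_support I B p = K \<union> (\<Union>m\<in>M. row_support I B m)"
    using KM by (auto simp: row_support_def Bp')
  have disjoint_K: "K \<inter> row_support I B m = {}" if m: "m \<in> M" for m
  proof -
    have False if j: "j \<in> K" "j \<in> I" "B m j \<noteq> 0" for j
    proof -
      have "B m j \<le> (\<Sum>m\<in>M. B m j)"
        using member_le_sum[OF m, of "\<lambda>m. B m j"] KM(2) by simp
      then show False
        using le[OF j(2)] Bp'[OF j(2)] j by simp
    qed
    then show ?thesis
      by (auto simp: row_support_def)
  qed
  have disjoint_M: "row_support I B m \<inter> row_support I B n = {}" if mn: "m \<in> M" "n \<in> M" "m \<noteq> n" for m n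
  proof -
    have False if j: "j \<in> I" "B m j \<noteq> 0" "B n j \<noteq> 0" for j
    proof -
      have "(\<Sum>m\<in>{m, n}. B m j) \<le> (\<Sum>m\<in>M. B m j)"
        using mn KM(2) by (intro sum_mono2) auto
      then show False
        using le[OF j(1)] Bp'[OF j(1)] j mn(3) by simp
    qed
    then show ?thesis
      by (auto simp: row_support_def)
  qed
  have support'_p: "row_support I C p = K \<union> M"
    using KM Cp by (auto simp: row_support_def)
  have support': "row_support I C i = row_support I B i" if "i \<in> I" "i \<noteq> p" for i
    using C[OF that] by (auto simp: row_support_def)
  have finite_row: "finite (row_support I B i)" if i: "i \<in> I" for i
  proof (cases "\<forall>i\<in>I. finite (row_support I B i)")
    case False
    then have fin': "\<And>i. i \<in> I \<Longrightarrow> finite (row_support I C i)"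
      using fin by blast
    have other: "finite (row_support I B i)" if "i \<in> I" "i \<noteq> p" for i
      using fin'[OF that(1)] support'[OF that] by simp
    have "finite (row_support I B m)" if "m \<in> M" for m
      using other[of m] that KM(4,6) by blast
    then have "finite (row_support I B p)"
      unfolding support_p using KM(1,2) by simp
    then show ?thesis
      using other[OF i] by (cases "i = p") simp_all
  qed (use i in blast)
  have "support_transfer I p B C K M"
  proof
    show "row_support I B p \<noteq> {}"
      by (rule nonempty[OF p(2)])
  qed (use finite_row p KM M nonempty support_p disjoint_K disjoint_M support'_p support' in \<open>simp_all\<close>)
  then show ?thesis
    by blast
qed

text \<open>Finiteness of the rows is part of both conclusions, so that the next link of the chain
  can be crossed.\<close>

lemma is_graph_cstar_primitive_transfer:
  assumes "primitive_transfer I B C"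
  shows "\<lbrakk>is_graph_cstar (matrix_digraph I B) A P S; \<forall>i\<in>I. finite (row_support I B i)\<rbrakk> \<Longrightarrow>
      (\<exists>T. is_graph_cstar (matrix_digraph I C) A P T) \<and> (\<forall>i\<in>I. finite (row_support I C i))"
    and "\<lbrakk>is_graph_cstar (matrix_digraph I C) A P T; \<forall>i\<in>I. finite (row_support I C i)\<rbrakk> \<Longrightarrow>
      (\<exists>S. is_graph_cstar (matrix_digraph I B) A P S) \<and> (\<forall>i\<in>I. finite (row_support I B i))"
proof -
  obtain p where p: "primitive_transfer_at I p B C"
    using assms by (auto simp: primitive_transfer_def)
  show "(\<exists>T. is_graph_cstar (matrix_digraph I C) A P T) \<and> (\<forall>i\<in>I. finite (row_support I C i))"
    if A: "is_graph_cstar (matrix_digraph I B) A P S" and fin: "\<forall>i\<in>I. finite (row_support I B i)"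
  proof -
    obtain K M where "support_transfer I p B C K M"
      using support_transferI[OF p] fin by blast
    then interpret support_transfer I p B C K M .
    show ?thesis
      using is_graph_cstar_transfer[OF A] finite_row' by blast
  qed
  show "(\<exists>S. is_graph_cstar (matrix_digraph I B) A P S) \<and> (\<forall>i\<in>I. finite (row_support I B i))"
    if A: "is_graph_cstar (matrix_digraph I C) A P T" and fin: "\<forall>i\<in>I. finite (row_support I C i)"
  proof -
    obtain K M where "support_transfer I p B C K M"
      using support_transferI[OF p] fin by blast
    then interpret support_transfer I p B C K M .
    show ?thesis
      using is_graph_cstar_untransfer[OF A] finite_row by blast
  qed
qed

lemma is_graph_cstar_permutation:
  assumes "permutation_conjugate I B C" "is_graph_cstar (matrix_digraph I B) A P S"
    and fin: "\<forall>i\<in>I. finite (row_support I B i)"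
  shows "(\<exists>P' T. is_graph_cstar (matrix_digraph I C) A P' T) \<and> (\<forall>i\<in>I. finite (row_support I C i))"
proof -
  obtain \<pi> where \<pi>: "bij_betw \<pi> I I" "\<And>i j. \<lbrakk>i \<in> I; j \<in> I\<rbrakk> \<Longrightarrow> B i j = C (\<pi> i) (\<pi> j)"
    using assms(1) by (auto simp: permutation_conjugate_def)
  have inj: "inj_on \<pi> I" and surj: "\<pi> ` I = I"
    using \<pi>(1) by (auto simp: bij_betw_def)
  have row: "row_support I C (\<pi> i) = \<pi> ` row_support I B i" if i: "i \<in> I" for i
  proof
    show "row_support I C (\<pi> i) \<subseteq> \<pi> ` row_support I B i"
    proof
      fix j assume "j \<in> row_support I C (\<pi> i)"
      then have "j \<in> \<pi> ` I" "C (\<pi> i) j \<noteq> 0"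
        by (auto simp: row_support_def surj)
      then show "j \<in> \<pi> ` row_support I B i"
        using i \<pi>(2) by (auto simp: row_support_def)
    qed
    show "\<pi> ` row_support I B i \<subseteq> row_support I C (\<pi> i)"
      using i \<pi>(2) surj by (auto simp: row_support_def)
  qed
  have "bij_betw (map_prod \<pi> \<pi>) (Sigma I (row_support I B)) (Sigma I (row_support I C))"
    unfolding bij_betw_def
  proof
    show "inj_on (map_prod \<pi> \<pi>) (Sigma I (row_support I B))"
      by (rule inj_on_subset[OF map_prod_inj_on[OF inj inj]]) (auto dest: subsetD[OF row_support_subset])
    show "map_prod \<pi> \<pi> ` Sigma I (row_support I B) = Sigma I (row_support I C)"
    proof
      show "map_prod \<pi> \<pi> ` Sigma I (row_support I B) \<subseteq> Sigma I (row_support I C)"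
        using row surj by auto
      show "Sigma I (row_support I C) \<subseteq> map_prod \<pi> \<pi> ` Sigma I (row_support I B)"
      proof
        fix e assume "e \<in> Sigma I (row_support I C)"
        then obtain i j where e: "e = (i, j)" "i \<in> \<pi> ` I" "j \<in> row_support I C i"
          by (auto simp: surj)
        then obtain k where k: "k \<in> I" "i = \<pi> k"
          by blast
        then obtain l where "l \<in> row_support I B k" "j = \<pi> l"
          using e(3) row[OF k(1)] by blast
        then show "e \<in> map_prod \<pi> \<pi> ` Sigma I (row_support I B)"
          using e(1) k by force
      qed
    qed
  qed
  then have "graph_isomorphism \<pi> (map_prod \<pi> \<pi>) (matrix_digraph I B) (matrix_digraph I C)"
    using \<pi>(1) by (auto simp: graph_isomorphism_def wf_matrix_digraph)
  \<comment> \<open>The permutation maps the graph of \<open>B\<close> to that of \<open>C\<close>,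
    while generators are pulled back; hence the inverse.\<close>
  from is_graph_cstar_isomorphism[OF graph_isomorphism_inverse[OF this] assms(2)]
  have "\<exists>P' T. is_graph_cstar (matrix_digraph I C) A P' T"
    by blast
  moreover have "finite (row_support I C i)" if "i \<in> I" for i
  proof -
    have "i \<in> \<pi> ` I"
      using that by (simp add: surj)
    then obtain k where "k \<in> I" "i = \<pi> k"
      by blast
    then show ?thesis
      using row fin by simp
  qed
  ultimately show ?thesis
    by blast
qed

section \<open>Vertex matrices and chains of equivalences\<close>

text \<open>Without multiple arcs the counted set has at most one element. This matters because
  \<open>card\<close> is zero on infinite sets.\<close>

lemma vertex_matrix_pos_iff:
  assumes "nomulti_digraph E"
  shows "0 < vertex_matrix E v w \<longleftrightarrow> (\<exists>e\<in>arcs E. tail E e = v \<and> head E e = w)"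
proof -
  interpret nomulti_digraph E by fact
  let ?X = "{e \<in> arcs E. tail E e = v \<and> head E e = w}"
  have eq: "f = e" if "e \<in> ?X" "f \<in> ?X" for e f
    using no_multi_arcs[of f e] that by (simp add: arc_to_ends_def)
  have "finite ?X"
  proof (cases "?X = {}")
    case False
    then obtain e where "e \<in> ?X"
      by blast
    then have "?X \<subseteq> {e}"
      using eq by blast
    then show ?thesis
      by (rule finite_subset) simp
  qed (simp only: finite.emptyI)
  then show ?thesis
    by (auto simp: vertex_matrix_def card_gt_0_iff)
qed

text \<open>Without multiple arcs an arc is determined by its ends, so it may be replaced by a pair
  of indices. The index set need not be the vertex set, which allows \<open>F\<close> to be indexed
  by the vertices of \<open>E\<close>.\<close>

lemma graph_isomorphism_vertex_matrix:
  assumes E: "nomulti_digraph E" and \<phi>: "bij_betw \<phi> I (verts E)"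
  shows "graph_isomorphism (inv_into I \<phi>)
    (\<lambda>e. (inv_into I \<phi> (tail E e), inv_into I \<phi> (head E e))) E
    (matrix_digraph I (\<lambda>v w. vertex_matrix E (\<phi> v) (\<phi> w)))"
proof -
  interpret nomulti_digraph E by fact
  let ?\<chi> = "inv_into I \<phi>" and ?M = "\<lambda>v w. vertex_matrix E (\<phi> v) (\<phi> w)"
  let ?\<psi> = "\<lambda>e. (?\<chi> (tail E e), ?\<chi> (head E e))"
  have \<chi>: "bij_betw ?\<chi> (verts E) I"
    by (rule bij_betw_inv_into[OF \<phi>])
  have \<chi>_in: "?\<chi> v \<in> I" and \<phi>_\<chi>: "\<phi> (?\<chi> v) = v" if "v \<in> verts E" for v
    using that \<chi> \<phi> by (auto simp: bij_betw_apply bij_betw_inv_into_right)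
  have \<chi>_\<phi>: "?\<chi> (\<phi> v) = v" if "v \<in> I" for v
    using that \<phi> by (simp add: bij_betw_inv_into_left)
  have "bij_betw ?\<psi> (arcs E) (Sigma I (row_support I ?M))"
    unfolding bij_betw_def
  proof
    show "inj_on ?\<psi> (arcs E)"
    proof (rule inj_onI)
      fix e f assume ef: "e \<in> arcs E" "f \<in> arcs E" "?\<psi> e = ?\<psi> f"
      then have "\<phi> (?\<chi> (tail E e)) = \<phi> (?\<chi> (tail E f))" "\<phi> (?\<chi> (head E e)) = \<phi> (?\<chi> (head E f))"
        by simp_all
      then show "e = f"
        using ef(1,2) by (intro no_multi_arcs) (simp_all add: arc_to_ends_def \<phi>_\<chi>)
    qed
    show "?\<psi> ` arcs E = Sigma I (row_support I ?M)"
    proof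
      show "?\<psi> ` arcs E \<subseteq> Sigma I (row_support I ?M)"
        by (auto simp: row_support_def vertex_matrix_pos_iff[OF E] \<chi>_in \<phi>_\<chi>)
      show "Sigma I (row_support I ?M) \<subseteq> ?\<psi> ` arcs E"
      proof
        fix x assume "x \<in> Sigma I (row_support I ?M)"
        then obtain v w e where "x = (v, w)" "v \<in> I" "w \<in> I" "e \<in> arcs E" "tail E e = \<phi> v" "head E e = \<phi> w"
          by (auto simp: row_support_def vertex_matrix_pos_iff[OF E])
        then show "x \<in> ?\<psi> ` arcs E"
          by (intro image_eqI[of _ _ e]) (simp_all add: \<chi>_\<phi>)
      qed
    qed
  qed
  then show ?thesis
    using \<chi> wf_digraph by (simp add: graph_isomorphism_def wf_matrix_digraph)
qed

lemma primitively_equivalent_induct: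
  fixes I :: "'i set"
  assumes "primitively_equivalent I B C" and "R B"
    and step: "\<And>X Y. \<lbrakk>R X; primitive_transfer I Y X \<or> primitive_transfer I X Y \<or> permutation_conjugate I X Y\<rbrakk>
      \<Longrightarrow> R Y"
  shows "R C"
  using assms(1) unfolding primitively_equivalent_def
proof (elim conjE exE)
  fix D :: "nat \<Rightarrow> 'i \<Rightarrow> 'i \<Rightarrow> nat" and q
  assume q: "1 \<le> q" "D 1 = B" "D q = C"
    and chain: "\<forall>i. 1 \<le> i \<and> i \<le> q - 1 \<longrightarrow>
      primitive_transfer I (D (i + 1)) (D i) \<or> primitive_transfer I (D i) (D (i + 1)) \<or>
      permutation_conjugate I (D i) (D (i + 1))"
  have "i \<le> q \<longrightarrow> R (D i)" if "1 \<le> i" for i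
    using that
  proof (induction i rule: dec_induct)
    case (step i)
    show ?case
    proof
      assume "Suc i \<le> q"
      then have i: "1 \<le> i" "i \<le> q - 1" and "R (D i)"
        using step by auto
      then show "R (D (Suc i))"
        using assms(3)[OF \<open>R (D i)\<close> chain[rule_format, OF conjI[OF i]]] by simp
    qed
  qed (use assms(2) q in simp)
  then show "R C"
    using q by blast
qed

theorem theorem3p11:
  fixes E :: "('v, 'e) pre_digraph" and F :: "('w, 'f) pre_digraph"
    and A :: "'a cstar" and P :: "'v \<Rightarrow> 'a" and S :: "'e \<Rightarrow> 'a"
    and B :: "'b cstar" and Q :: "'w \<Rightarrow> 'b" and T :: "'f \<Rightarrow> 'b"
  assumes "countable_connected_digraph E" and "row_finite E"
    and "countable_connected_digraph F"
    and "graphs_primitively_equivalent E F"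
    and "is_graph_cstar E A P S"
    and "is_graph_cstar F B Q T"
  shows "cstar_isomorphic A B"
proof -
  let ?I = "verts E"
  have E: "nomulti_digraph E" and F: "nomulti_digraph F" "countable (verts F)" "countable (arcs F)"
    using assms(1,3) by (simp_all add: countable_connected_digraph_def)
  obtain \<phi> where \<phi>: "bij_betw \<phi> ?I (verts F)"
    and pe: "primitively_equivalent ?I (vertex_matrix E) (\<lambda>v w. vertex_matrix F (\<phi> v) (\<phi> w))"
    using assms(4) unfolding graphs_primitively_equivalent_def by blast
  \<comment> \<open>The algebra \<open>A\<close> is fixed. The generators are quantified because a
    permutation relabels even the vertex projections.\<close>
  define R where "R X \<longleftrightarrow> (\<exists>P' S'. is_graph_cstar (matrix_digraph ?I X) A P' S') \<and>
      (\<forall>v\<in>?I. finite (row_support ?I X v))" for X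
  have "finite (row_support ?I (vertex_matrix E) v)" if v: "v \<in> ?I" for v
  proof (rule finite_subset)
    show "row_support ?I (vertex_matrix E) v \<subseteq> head E ` out_arcs E v"
      by (auto simp: row_support_def vertex_matrix_pos_iff[OF E])
    show "finite (head E ` out_arcs E v)"
      using assms(2) v by (simp add: row_finite_def)
  qed
  moreover have "\<exists>P' S'. is_graph_cstar (matrix_digraph ?I (vertex_matrix E)) A P' S'"
    using is_graph_cstar_isomorphism[OF graph_isomorphism_inverse[OF
          graph_isomorphism_vertex_matrix[OF E bij_betw_id]] assms(5)]
    by (auto simp: id_def)
  ultimately have "R (vertex_matrix E)"
    by (simp add: R_def)
  moreover have "R Y" if "R X" and
    step: "primitive_transfer ?I Y X \<or> primitive_transfer ?I X Y \<or> permutation_conjugate ?I X Y"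
    for X Y
  proof -
    obtain P' S' where X: "is_graph_cstar (matrix_digraph ?I X) A P' S'"
        "\<forall>v\<in>?I. finite (row_support ?I X v)"
      using \<open>R X\<close> unfolding R_def by blast
    from step show ?thesis
      unfolding R_def
      using is_graph_cstar_primitive_transfer(2)[OF _ X] is_graph_cstar_primitive_transfer(1)[OF _ X]
        is_graph_cstar_permutation[OF _ X] by blast
  qed
  ultimately have "R (\<lambda>v w. vertex_matrix F (\<phi> v) (\<phi> w))"
    by (rule primitively_equivalent_induct[OF pe])
  then obtain P' S' where
    "is_graph_cstar (matrix_digraph ?I (\<lambda>v w. vertex_matrix F (\<phi> v) (\<phi> w))) A P' S'"
    unfolding R_def by blast
  \<comment> \<open>Now \<open>A\<close> itself is a universal algebra of \<open>F\<close>, and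
    uniqueness compares it with \<open>B\<close>.\<close>
  from is_graph_cstar_isomorphism[OF graph_isomorphism_vertex_matrix[OF F(1) \<phi>] this]
  show ?thesis
    using graph_cstar_unique[OF F(2,3) _ assms(6)] by blast
qed

end
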